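(* Let $(B,\mathfrak{n})$ be a two-dimensional Cohen-Macaulay (Noetherian) local ring with minimal multiplicity, i.e. $e(B) = 1 + \operatorname{codim}(B)$. Let $(A,\mathfrak{m})$ be a one-dimensional Cohen-Macaulay local ring which is a quotient of $B$. If $M$ is a (finitely generated) maximal Cohen-Macaulay $A$-module, then the Hilbert function of $M$ with respect to $\mathfrak{m}$ is non-decreasing, i.e. $H(M,n) \le H(M,n+1)$ for all $n \ge 0$.
   Context: All rings are Noetherian and all modules are finitely generated. For a local ring $(R,\mathfrak{m})$ of dimension $d$: $\mu(\cdot)$ denotes the minimal number of generators, $\ell(\cdot)$ denotes length, and $\operatorname{codim}(R) = \mu(\mathfrak{m}) - d$ is the codimension of $R$. For an $R$-module $M$, the Hilbert function of $M$ with respect to $\mathfrak{m}$ is $H(M,n) = \ell(\mathfrak{m}^nM/\mathfrak{m}^{n+1}M)$ for $n \ge 0$. Its generating series has the form $\sum_{n\ge 0} H(M,n)z^n = h_M(z)/(1-z)^{\dim M}$ with $h_M(z) \in \mathbb{Z}[z]$, and the multiplicity of $M$ (with respect to $\mathfrak{m}$) is $e(M) = h_M(1)$. A Cohen-Macaulay local ring $R$ is said to have minimal multiplicity if $e(R) = 1 + \operatorname{codim}(R)$. An $R$-module $M$ is maximal Cohen-Macaulay if $\operatorname{depth} M = \dim R$. *)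

theory Defs
  imports
    "HOL-Library.Extended_Nat"
    "HOL-Computational_Algebra.Polynomial_FPS"
    "HOL-Algebra.Ideal_Product"
    "HOL-Algebra.Ring_Divisibility"
    "HOL-Algebra.Module"
begin

section \<open>Modules over a commutative ring\<close>

definition ring_module :: "('a, 'm) ring_scheme \<Rightarrow> ('a, 'a) module"
  where "ring_module R =
    \<lparr>carrier = carrier R, mult = mult R, one = one R, zero = zero R, add = add R,
     smult = mult R\<rparr>"

text \<open>The fields \<open>mult\<close> and \<open>one\<close> of a module record carry no meaning, so they are left
  unspecified here.\<close>

definition quot_module :: "('a, 'b, 'm) module_scheme \<Rightarrow> 'b set \<Rightarrow> ('a, 'b set) module"
  where "quot_module M N =
    \<lparr>carrier = a_rcosets\<^bsub>M\<^esub> N, mult = undefined, one = undefined, zero = N, add = set_add M,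
     smult = (\<lambda>a X. \<Union>x\<in>X. N +>\<^bsub>M\<^esub> (a \<odot>\<^bsub>M\<^esub> x))\<rparr>"

definition gen_submodule ::
    "('a, 'r) ring_scheme \<Rightarrow> ('a, 'b, 'm) module_scheme \<Rightarrow> 'b set \<Rightarrow> 'b set"
  where "gen_submodule R M S = \<Inter>{N. submodule N R M \<and> S \<subseteq> N}"

definition finitely_generated ::
    "('a, 'r) ring_scheme \<Rightarrow> ('a, 'b, 'm) module_scheme \<Rightarrow> bool"
  where "finitely_generated R M \<longleftrightarrow>
    (\<exists>S. S \<subseteq> carrier M \<and> finite S \<and> gen_submodule R M S = carrier M)"

text \<open>Meaningful for finitely generated \<open>M\<close> only.\<close>

definition min_gens :: "('a, 'r) ring_scheme \<Rightarrow> ('a, 'b, 'm) module_scheme \<Rightarrow> nat"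
  where "min_gens R M =
    (LEAST k. \<exists>S. S \<subseteq> carrier M \<and> finite S \<and> card S = k \<and> gen_submodule R M S = carrier M)"

definition ideal_smult ::
    "('a, 'r) ring_scheme \<Rightarrow> 'a set \<Rightarrow> ('a, 'b, 'm) module_scheme \<Rightarrow> 'b set"
  where "ideal_smult R I M = gen_submodule R M {a \<odot>\<^bsub>M\<^esub> x | a x. a \<in> I \<and> x \<in> carrier M}"

definition annihilator ::
    "('a, 'r) ring_scheme \<Rightarrow> ('a, 'b, 'm) module_scheme \<Rightarrow> 'a set"
  where "annihilator R M = {a \<in> carrier R. \<forall>x\<in>carrier M. a \<odot>\<^bsub>M\<^esub> x = \<zero>\<^bsub>M\<^esub>}"

definition module_length ::
    "('a, 'r) ring_scheme \<Rightarrow> ('a, 'b, 'm) module_scheme \<Rightarrow> enat"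
  where "module_length R M = Sup {enat n | n.
    \<exists>N :: nat \<Rightarrow> 'b set. (\<forall>i\<le>n. submodule (N i) R M) \<and> (\<forall>i<n. N i \<subset> N (Suc i))}"


section \<open>Local rings, dimension and depth\<close>

locale noetherian_local_ring = cring R + noetherian_ring R
  for R :: "('a, 'r) ring_scheme" (structure) and \<mm> :: "'a set" +
  assumes maximal: "maximalideal \<mm> R"
    and maximal_unique: "\<And>J. maximalideal J R \<Longrightarrow> J = \<mm>"

definition krull_dim :: "('a, 'r) ring_scheme \<Rightarrow> enat"
  where "krull_dim R = Sup {enat n | n.
    \<exists>P :: nat \<Rightarrow> 'a set. (\<forall>i\<le>n. primeideal (P i) R) \<and> (\<forall>i<n. P i \<subset> P (Suc i))}"

definition module_dim ::
    "('a, 'r) ring_scheme \<Rightarrow> ('a, 'b, 'm) module_scheme \<Rightarrow> enat"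
  where "module_dim R M = krull_dim (R Quot annihilator R M)"

definition nonzerodivisor_on ::
    "'a \<Rightarrow> ('a, 'b, 'm) module_scheme \<Rightarrow> bool"
  where "nonzerodivisor_on a M \<longleftrightarrow> (\<forall>x\<in>carrier M. a \<odot>\<^bsub>M\<^esub> x = \<zero>\<^bsub>M\<^esub> \<longrightarrow> x = \<zero>\<^bsub>M\<^esub>)"

definition regular_sequence ::
    "('a, 'r) ring_scheme \<Rightarrow> ('a, 'b, 'm) module_scheme \<Rightarrow> 'a list \<Rightarrow> bool"
  where "regular_sequence R M xs \<longleftrightarrow> set xs \<subseteq> carrier R
    \<and> (\<forall>i<length xs. nonzerodivisor_on (xs ! i)
          (quot_module M (ideal_smult R (Idl\<^bsub>R\<^esub> (set (take i xs))) M)))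
    \<and> ideal_smult R (Idl\<^bsub>R\<^esub> (set xs)) M \<noteq> carrier M"

text \<open>Supremum over the regular sequences in the maximal ideal.  With this definition the
  zero module has depth 0 (the supremum of the empty set).\<close>

definition depth ::
    "('a, 'r) ring_scheme \<Rightarrow> 'a set \<Rightarrow> ('a, 'b, 'm) module_scheme \<Rightarrow> enat"
  where "depth R \<mm> M =
    Sup {enat (length xs) | xs. set xs \<subseteq> \<mm> \<and> regular_sequence R M xs}"

definition cohen_macaulay_ring :: "('a, 'r) ring_scheme \<Rightarrow> 'a set \<Rightarrow> bool"
  where "cohen_macaulay_ring R \<mm> \<longleftrightarrow> depth R \<mm> (ring_module R) = krull_dim R"

definition maximal_cohen_macaulay ::
    "('a, 'r) ring_scheme \<Rightarrow> 'a set \<Rightarrow> ('a, 'b, 'm) module_scheme \<Rightarrow> bool"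
  where "maximal_cohen_macaulay R \<mm> M \<longleftrightarrow> depth R \<mm> M = krull_dim R"

text \<open>An integer, so that no truncated subtraction is involved.  The Krull dimension of a
  Noetherian local ring is finite.\<close>

definition codim :: "('a, 'r) ring_scheme \<Rightarrow> 'a set \<Rightarrow> int"
  where "codim R \<mm> =
    int (min_gens R ((ring_module R)\<lparr>carrier := \<mm>\<rparr>)) - int (the_enat (krull_dim R))"


section \<open>Hilbert function and multiplicity\<close>

text \<open>Powers of ideals are powers in the library's semiring of ideals, so the zeroth power of
  \<open>\<mm>\<close> is \<open>carrier R\<close>.  The lengths are finite for finitely generated modules over a Noetherian
  local ring.\<close>

definition hilbert_fun ::
    "('a, 'r) ring_scheme \<Rightarrow> 'a set \<Rightarrow> ('a, 'b, 'm) module_scheme \<Rightarrow> nat \<Rightarrow> nat"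
  where "hilbert_fun R \<mm> M n = the_enat (module_length R
    (quot_module (M\<lparr>carrier := ideal_smult R (\<mm> [^]\<^bsub>ideals_set R\<^esub> n) M\<rparr>)
       (ideal_smult R (\<mm> [^]\<^bsub>ideals_set R\<^esub> Suc n) M)))"

text \<open>The numerator of the Hilbert series: the identity
  \<open>(\<Sum>n. H(M, n) z ^ n) = h z / (1 - z) ^ dim M\<close> with the denominator cleared.\<close>

definition h_poly ::
    "('a, 'r) ring_scheme \<Rightarrow> 'a set \<Rightarrow> ('a, 'b, 'm) module_scheme \<Rightarrow> int poly"
  where "h_poly R \<mm> M = (THE h.
    Abs_fps (\<lambda>n. int (hilbert_fun R \<mm> M n)) * (1 - fps_X) ^ the_enat (module_dim R M)
      = fps_of_poly h)"

definition multiplicity ::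
    "('a, 'r) ring_scheme \<Rightarrow> 'a set \<Rightarrow> ('a, 'b, 'm) module_scheme \<Rightarrow> int"
  where "multiplicity R \<mm> M = poly (h_poly R \<mm> M) 1"

definition minimal_multiplicity :: "('a, 'r) ring_scheme \<Rightarrow> 'a set \<Rightarrow> bool"
  where "minimal_multiplicity R \<mm> \<longleftrightarrow> multiplicity R \<mm> (ring_module R) = 1 + codim R \<mm>"

end

theory Submission
  imports Defs "HOL-Library.Function_Algebras" "HOL-Algebra.Free_Abelian_Groups"
begin

text \<open>Put \<open>e = e(B)\<close>, let \<open>N = \<mm>\<^sup>n M\<close> be minimally generated by \<open>r\<close> elements and let \<open>K\<close> be the kernel
  of the induced map \<open>B\<^sup>r \<rightarrow> N\<close>.  It lies in \<open>\<nn>B\<^sup>r\<close>, and with \<open>K\<^sub>s = K \<inter> \<nn>\<^sup>s B\<^sup>r\<close> one has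
  \<open>H(M, n + 1) = \<ell>(\<nn>B\<^sup>r / \<nn>\<^sup>2 B\<^sup>r) - \<mu> = r (codim B + 2) - \<mu>\<close> for \<open>\<mu> = \<ell>(K / K\<^sub>2)\<close>,
  while \<open>H(M, n) = r\<close>.  As \<open>depth B = 2\<close> and \<open>depth N > 0\<close>, the module \<open>K\<close> has depth two.  For a
  superficial element \<open>\<xi> \<in> \<nn>\<close> this makes multiplication by \<open>\<xi>\<close> from \<open>K / K\<^sub>s\<close> to \<open>K / K\<^sub>s\<^sub>+\<^sub>1\<close>
  injective for large \<open>s\<close>.  Its cokernel is the quotient of \<open>K / \<xi>K\<close> by the image of \<open>K\<^sub>s\<^sub>+\<^sub>1\<close>.
  Multiplication by a second superficial element, which is regular on \<open>K / \<xi>K\<close>, and the inclusion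
  \<open>\<xi>K \<subseteq> K\<^sub>2\<close> show that the lengths of these cokernels grow by at least \<open>\<mu>\<close> with each \<open>s\<close>.
  Hence \<open>\<ell>(K / K\<^sub>s)\<close> is eventually at least \<open>\<mu> s\<^sup>2 / 2\<close> up to linear terms.  It is at most
  \<open>\<ell>(B\<^sup>r / \<nn>\<^sup>s B\<^sup>r)\<close>, which grows like \<open>r e s\<^sup>2 / 2\<close>.  So \<open>\<mu> \<le> r e = r (1 + codim B)\<close>, and
  \<open>H(M, n + 1) \<ge> r = H(M, n)\<close>.

  Quotients are avoided: \<open>B\<close> and \<open>A\<close> are presented as images of one polynomial ring \<open>P\<close> over the
  integers, modules as images of free \<open>P\<close>-modules, and the length of \<open>N / L\<close> is \<open>len L N\<close>.\<close>


section \<open>Length of submodules\<close>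

text \<open>The inequality \<open>\<mu> \<le> r e\<close> is a filtered form of the fact that a
  maximal Cohen-Macaulay module needs at most as many generators as its multiplicity:
  \<open>K\<close> has depth two and sits in a free module of rank \<open>r\<close>, which bounds
  its multiplicity by \<open>r e\<close>. Minimal multiplicity says that the embedding dimension
  \<open>codim B + 2\<close> equals \<open>e + 1\<close>; of the \<open>r (e + 1)\<close> dimensions
  of \<open>\<nn>B^r / \<nn>^2 B^r\<close> at most \<open>r e\<close> are lost to \<open>K\<close>.

  The obstacle is the residue field: if it is finite, superficial elements need not exist. Their
  place is taken by a generic combination of generators of \<open>\<nn>\<close> whose coefficients
  are the powers of a new variable, with a further variable for the second one. By McCoy's theorem
  it is regular as soon as no nonzero element is killed by all generators, so regularity becomes a
  colon condition on \<open>\<nn>\<close>. Multiplication by it raises degrees, which costs a factor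
  \<open>(E + m) / E\<close> in each comparison of lengths of polynomials of degree less than
  \<open>E\<close>; as \<open>E\<close> is arbitrary, the cost disappears in the limit. The colon
  conditions hold for high powers by Noetherianity of the Rees algebra.\<close>

definition chain_length :: "('x set \<Rightarrow> bool) \<Rightarrow> enat"
  where "chain_length P = Sup {enat n | n.
    \<exists>C :: nat \<Rightarrow> 'x set. (\<forall>i\<le>n. P (C i)) \<and> (\<forall>i<n. C i \<subset> C (Suc i))}"

lemma chain_length_geI:
  assumes "\<And>i. i \<le> n \<Longrightarrow> P (C i)" and "\<And>i. i < n \<Longrightarrow> C i \<subset> C (Suc i)"
  shows "enat n \<le> chain_length P"
  unfolding chain_length_def using assms by (intro Sup_upper) blast

lemma chain_length_leI:
  assumes "\<And>n C. (\<And>i. i \<le> n \<Longrightarrow> P (C i)) \<Longrightarrow> (\<And>i. i < n \<Longrightarrow> C i \<subset> C (Suc i)) \<Longrightarrow> enat n \<le> k"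
  shows "chain_length P \<le> k"
  unfolding chain_length_def using assms by (intro Sup_least) blast

text \<open>A longer chain is cut off after \<open>n\<close> steps. For \<open>n = 0\<close> the
  lower bound carries no information, since the supremum of the empty set is 0, and the chain is
  made from \<open>X\<close>.\<close>

lemma chain_length_geE:
  assumes "enat n \<le> chain_length P" and "P X"
  obtains C where "\<And>i. i \<le> n \<Longrightarrow> P (C i)" and "\<And>i. i < n \<Longrightarrow> C i \<subset> C (Suc i)"
proof (cases "n = 0")
  case True
  then show ?thesis using that[of "\<lambda>_. X"] assms(2) by auto
next
  case False
  then obtain k where k: "n = Suc k" using not0_implies_Suc by blast
  have "\<not> chain_length P \<le> enat k"
    using assms(1) k by (metis Suc_ile_eq not_le)
  then obtain m C where *: "\<And>i. i \<le> m \<Longrightarrow> P (C i)" "\<And>i. i < m \<Longrightarrow> C i \<subset> C (Suc i)"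
      "\<not> enat m \<le> enat k"
    using chain_length_leI[of P "enat k"] by metis
  then show ?thesis using that[of C] k by force
qed

lemma chain_length_le_map:
  assumes "\<And>X. P X \<Longrightarrow> Q (f X)" and "\<And>X Y. P X \<Longrightarrow> P Y \<Longrightarrow> X \<subset> Y \<Longrightarrow> f X \<subset> f Y"
  shows "chain_length P \<le> chain_length Q"
proof (rule chain_length_leI)
  fix n and C :: "nat \<Rightarrow> 'a set"
  assume "\<And>i. i \<le> n \<Longrightarrow> P (C i)" "\<And>i. i < n \<Longrightarrow> C i \<subset> C (Suc i)"
  then show "enat n \<le> chain_length Q"
    by (intro chain_length_geI[of _ _ "\<lambda>i. f (C i)"]) (use assms in auto)
qed

lemma weak_chain_length:
  assumes "\<And>i. i \<le> n \<Longrightarrow> P (C i)" and "\<And>i. i < n \<Longrightarrow> C i \<subseteq> C (Suc i)"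
  shows "enat (card {i. i < n \<and> C i \<noteq> C (Suc i)}) \<le> chain_length P"
proof -
  \<comment> \<open>Recording that the thinned chain ends in \<open>C n\<close> lets the induction
    append the next strict step.\<close>
  have "\<exists>D. (\<forall>i\<le>card {i. i < n \<and> C i \<noteq> C (Suc i)}. P (D i)) \<and>
      (\<forall>i<card {i. i < n \<and> C i \<noteq> C (Suc i)}. D i \<subset> D (Suc i)) \<and>
      D (card {i. i < n \<and> C i \<noteq> C (Suc i)}) = C n"
    using assms
  proof (induction n)
    case 0
    then show ?case by (intro exI[of _ "\<lambda>_. C 0"]) auto
  next
    case (Suc n)
    let ?p = "card {i. i < n \<and> C i \<noteq> C (Suc i)}"
    obtain D where D: "\<forall>i\<le>?p. P (D i)" "\<forall>i<?p. D i \<subset> D (Suc i)" "D ?p = C n"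
      using Suc by auto
    show ?case
    proof (cases "C n = C (Suc n)")
      case True
      then have "{i. i < Suc n \<and> C i \<noteq> C (Suc i)} = {i. i < n \<and> C i \<noteq> C (Suc i)}"
        by (auto simp: less_Suc_eq)
      with D True show ?thesis by (intro exI[of _ D]) simp
    next
      case False
      then have "{i. i < Suc n \<and> C i \<noteq> C (Suc i)} = insert n {i. i < n \<and> C i \<noteq> C (Suc i)}"
        by (auto simp: less_Suc_eq)
      then have c: "card {i. i < Suc n \<and> C i \<noteq> C (Suc i)} = Suc ?p"
        by simp
      show ?thesis unfolding c
      proof (rule exI[of _ "\<lambda>i. if i \<le> ?p then D i else C (Suc n)"], intro conjI allI impI)
        fix i assume "i \<le> Suc ?p"
        then show "P (if i \<le> ?p then D i else C (Suc n))" using D(1) Suc.prems(1)[of "Suc n"] by simp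
      next
        fix i assume "i < Suc ?p"
        then consider "i < ?p" | "i = ?p" by linarith
        then show "(if i \<le> ?p then D i else C (Suc n)) \<subset> (if Suc i \<le> ?p then D (Suc i) else C (Suc n))"
          by cases (use D(2,3) False Suc.prems(2)[of n] in auto)
      qed simp
    qed
  qed
  then show ?thesis using chain_length_geI by blast
qed

section \<open>Sums of submodules, the modular law and additivity of length\<close>

definition ssum :: "'v::plus set \<Rightarrow> 'v set \<Rightarrow> 'v set"
  where "ssum A B = {x + y | x y. x \<in> A \<and> y \<in> B}"

lemma ssumI: "x \<in> A \<Longrightarrow> y \<in> B \<Longrightarrow> x + y \<in> ssum A B"
  unfolding ssum_def by blast

lemma ssum_mono: "A \<subseteq> A' \<Longrightarrow> B \<subseteq> B' \<Longrightarrow> ssum A B \<subseteq> ssum A' B'"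
  unfolding ssum_def by blast

text \<open>A length can be infinite and is then attained by no chain. Working with finite lower
  bounds of both summands leaves only genuine chains to be concatenated.\<close>

lemma enat_add_leI:
  assumes "\<And>n k. enat n \<le> a \<Longrightarrow> enat k \<le> b \<Longrightarrow> enat (n + k) \<le> c"
  shows "a + b \<le> c"
proof (cases c)
  case (enat cc)
  have "enat 0 \<le> a" "enat 0 \<le> b" by (simp_all flip: zero_enat_def)
  then have "a \<noteq> \<infinity>" "b \<noteq> \<infinity>"
    using assms[of "Suc cc" 0] assms[of 0 "Suc cc"] enat
    by (metis add.right_neutral enat_ord_simps(1,3) not_less_eq_eq order_refl,
        metis add.left_neutral enat_ord_simps(1,3) not_less_eq_eq order_refl)
  then show ?thesis using assms by fastforce
qed auto

locale pmod = Modules.module scale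
  for scale :: "'p::comm_ring_1 \<Rightarrow> 'v::ab_group_add \<Rightarrow> 'v" (infixr "*s" 75)
begin

lemma subspace_ssum: "subspace A \<Longrightarrow> subspace B \<Longrightarrow> subspace (ssum A B)"
  by (rule subspaceI) (auto simp: ssum_def, insert subspace_0, force,
    metis (no_types, opaque_lifting) add.assoc add.left_commute subspace_add,
    metis scale_right_distrib subspace_scale)

lemma ssum_upper1: "subspace B \<Longrightarrow> A \<subseteq> ssum A B"
  unfolding ssum_def using subspace_0 by force

lemma ssum_upper2: "subspace A \<Longrightarrow> B \<subseteq> ssum A B"
  unfolding ssum_def using subspace_0 by force

lemma ssum_least: "A \<subseteq> N \<Longrightarrow> B \<subseteq> N \<Longrightarrow> subspace N \<Longrightarrow> ssum A B \<subseteq> N"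
  unfolding ssum_def using subspace_add by blast

lemma ssum_absorb: "subspace A \<Longrightarrow> subspace B \<Longrightarrow> B \<subseteq> A \<Longrightarrow> ssum A B = A"
  using ssum_least[of A A B] ssum_upper1[of B A] by blast

text \<open>The modular law. It makes every proper step of a chain visible in the intersection with
  \<open>N\<close> or in the sum with \<open>N\<close>, which gives additivity of length directly
  from chains, infinite lengths included.\<close>

lemma modular_eq:
  assumes "subspace E" "subspace E'" "subspace N" "E \<subseteq> E'"
    and "E \<inter> N = E' \<inter> N" "ssum E N = ssum E' N"
  shows "E = E'"
proof -
  have "x \<in> E" if x: "x \<in> E'" for x
  proof -
    have "x \<in> ssum E N" using x assms ssum_upper1[of N E'] by auto
    then obtain y z where yz: "x = y + z" "y \<in> E" "z \<in> N" unfolding ssum_def by blast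
    then have "z \<in> E' \<inter> N" using assms x subspace_diff[of E' x y] by auto
    then have "z \<in> E" using assms(5) by blast
    then show ?thesis using assms(1) yz subspace_add by blast
  qed
  then show ?thesis using assms by blast
qed

definition len :: "'v set \<Rightarrow> 'v set \<Rightarrow> enat"
  where "len L N = chain_length (\<lambda>C. subspace C \<and> L \<subseteq> C \<and> C \<subseteq> N)"

lemma len_add:
  assumes "subspace L" "subspace N" "subspace Q" "L \<subseteq> N" "N \<subseteq> Q"
  shows "len L Q = len L N + len N Q"
proof (rule antisym)
  show "len L N + len N Q \<le> len L Q"
  proof (rule enat_add_leI)
    fix n k
    assume "enat n \<le> len L N" "enat k \<le> len N Q"
    note nk = this[unfolded len_def]
    obtain C where
      C: "\<And>i. i \<le> n \<Longrightarrow> subspace (C i) \<and> L \<subseteq> C i \<and> C i \<subseteq> N" "\<And>i. i < n \<Longrightarrow> C i \<subset> C (Suc i)"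
      by (rule chain_length_geE[OF nk(1), of N]) (use assms in auto)
    obtain D where
      D: "\<And>i. i \<le> k \<Longrightarrow> subspace (D i) \<and> N \<subseteq> D i \<and> D i \<subseteq> Q" "\<And>i. i < k \<Longrightarrow> D i \<subset> D (Suc i)"
      by (rule chain_length_geE[OF nk(2), of N]) (use assms in auto)
    let ?E = "\<lambda>i. if i \<le> n then C i else D (i - n)"
    show "enat (n + k) \<le> len L Q" unfolding len_def
    proof (rule chain_length_geI[of _ _ ?E])
      fix i assume "i \<le> n + k"
      then show "subspace (?E i) \<and> L \<subseteq> ?E i \<and> ?E i \<subseteq> Q"
        using C(1)[of i] D(1)[of "i - n"] assms
        by (cases "i \<le> n") (force simp: le_diff_conv add.commute)+
    next
      fix i assume i: "i < n + k"
      consider "i < n" | "i = n" | "i > n" by linarith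
      then show "?E i \<subset> ?E (Suc i)"
      proof cases
        case 2
        then have "C n \<subseteq> N" "N \<subseteq> D 0" "D 0 \<subset> D (Suc 0)" using C(1)[of n] D(1)[of 0] D(2)[of 0] i by auto
        then show ?thesis using 2 by auto
      next
        case 3
        then show ?thesis using D(2)[of "i - n"] i by (auto simp: Suc_diff_le)
      qed (use C in auto)
    qed
  qed
next
  show "len L Q \<le> len L N + len N Q"
    unfolding len_def[of L Q]
  proof (rule chain_length_leI)
    fix n E
    assume E: "\<And>i. i \<le> n \<Longrightarrow> subspace (E i) \<and> L \<subseteq> E i \<and> E i \<subseteq> Q" "\<And>i. i < n \<Longrightarrow> E i \<subset> E (Suc i)"
    \<comment> \<open>Both traces of the chain may stall, so only their strict steps are counted; by
      \<open>modular_eq\<close> no index stalls in both.\<close>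
    let ?C = "\<lambda>i. E i \<inter> N" and ?D = "\<lambda>i. ssum (E i) N"
    let ?c = "{i. i < n \<and> ?C i \<noteq> ?C (Suc i)}" and ?d = "{i. i < n \<and> ?D i \<noteq> ?D (Suc i)}"
    have c: "enat (card ?c) \<le> len L N" unfolding len_def
      by (rule weak_chain_length) (use E assms in \<open>blast intro: subspace_inter\<close>)+
    have d: "enat (card ?d) \<le> len N Q" unfolding len_def
    proof (rule weak_chain_length)
      fix i assume "i \<le> n"
      then show "subspace (?D i) \<and> N \<subseteq> ?D i \<and> ?D i \<subseteq> Q"
        using E assms ssum_upper2[of "E i" N] ssum_least[of "E i" Q N] subspace_ssum by auto
    next
      fix i assume "i < n"
      then show "?D i \<subseteq> ?D (Suc i)" using E(2)[of i] ssum_mono[of "E i" "E (Suc i)" N N] by blast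
    qed
    have "{..<n} \<subseteq> ?c \<union> ?d"
    proof
      fix i assume i: "i \<in> {..<n}"
      then have "E i \<noteq> E (Suc i)" "subspace (E i)" "subspace (E (Suc i))" "E i \<subseteq> E (Suc i)"
        using E(1)[of i] E(1)[of "Suc i"] E(2)[of i] by auto
      then show "i \<in> ?c \<union> ?d"
        using modular_eq[of "E i" "E (Suc i)" N] assms i by auto
    qed
    then have "card {..<n} \<le> card (?c \<union> ?d)" by (intro card_mono) auto
    then have "n \<le> card ?c + card ?d" using card_Un_le[of ?c ?d] by simp
    then have "enat n \<le> enat (card ?c) + enat (card ?d)" by simp
    also have "\<dots> \<le> len L N + len N Q" by (rule add_mono[OF c d])
    finally show "enat n \<le> len L N + len N Q" .
  qed
qed

lemma len_refl [simp]: "len L L = 0"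
proof -
  have "len L L \<le> 0" unfolding len_def
  proof (rule chain_length_leI)
    fix n :: nat and C :: "nat \<Rightarrow> 'v set"
    assume *: "\<And>i. i \<le> n \<Longrightarrow> subspace (C i) \<and> L \<subseteq> C i \<and> C i \<subseteq> L" "\<And>i. i < n \<Longrightarrow> C i \<subset> C (Suc i)"
    show "enat n \<le> 0"
    proof (cases n)
      case (Suc k)
      then show ?thesis using *(1)[of 0] *(1)[of 1] *(2)[of 0] by auto
    qed (simp add: zero_enat_def)
  qed
  then show ?thesis by simp
qed

lemma len_mono:
  assumes "L \<subseteq> L'" "N' \<subseteq> N"
  shows "len L' N' \<le> len L N"
  unfolding len_def by (rule chain_length_le_map[of _ _ id]) (use assms in auto)

lemma len_ge_1: "subspace L \<Longrightarrow> subspace N \<Longrightarrow> L \<subset> N \<Longrightarrow> 1 \<le> len L N"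
  unfolding len_def one_enat_def
  by (rule chain_length_geI[of _ _ "\<lambda>i. if i = 0 then L else N"]) auto

end

section \<open>Lengths under homomorphisms\<close>

locale pmod_hom = V: pmod scale + W: pmod scale'
  for scale :: "'p::comm_ring_1 \<Rightarrow> 'v::ab_group_add \<Rightarrow> 'v" (infixr "*s" 75)
    and scale' :: "'p \<Rightarrow> 'w::ab_group_add \<Rightarrow> 'w" (infixr "*t" 75) +
  fixes f :: "'v \<Rightarrow> 'w"
  assumes hom_add: "f (x + y) = f x + f y" and hom_scale: "f (c *s x) = c *t f x"
begin

lemma hom_0: "f 0 = 0"
  using hom_scale[of 0 0] by simp

lemma hom_minus: "f (- x) = - f x"
  using hom_scale[of "-1" x] by simp

lemma hom_diff: "f (x - y) = f x - f y"
  using hom_add[of x "- y"] hom_minus by simp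

lemma subspace_image: "V.subspace C \<Longrightarrow> W.subspace (f ` C)"
  unfolding V.subspace_def W.subspace_def
  by (auto simp: image_iff) (metis hom_0, metis hom_add, metis hom_scale)

lemma subspace_vimage: "W.subspace C \<Longrightarrow> V.subspace (f -` C)"
  unfolding V.subspace_def W.subspace_def by (auto simp: hom_0 hom_add hom_scale)

text \<open>An intermediate module \<open>X\<close> is recovered from \<open>f X + L'\<close>:
  elements of \<open>N\<close> that \<open>f\<close> sends into \<open>L'\<close> lie in
  \<open>L\<close>, hence in \<open>X\<close>.\<close>

lemma len_hom_le:
  assumes "W.subspace L'" "L' \<subseteq> N'" "W.subspace N'" "f ` N \<subseteq> N'"
    and inj: "\<And>x. x \<in> N \<Longrightarrow> f x \<in> L' \<Longrightarrow> x \<in> L"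
  shows "V.len L N \<le> W.len L' N'"
  unfolding V.len_def W.len_def
proof (rule chain_length_le_map[of _ _ "\<lambda>C. ssum (f ` C) L'"])
  fix X assume X: "V.subspace X \<and> L \<subseteq> X \<and> X \<subseteq> N"
  then show "W.subspace (ssum (f ` X) L') \<and> L' \<subseteq> ssum (f ` X) L' \<and> ssum (f ` X) L' \<subseteq> N'"
    using assms subspace_image[of X] W.subspace_ssum[of "f ` X" L'] W.ssum_upper2[of "f ` X" L']
      W.ssum_least[of "f ` X" N' L'] by blast
next
  fix X Y assume X: "V.subspace X \<and> L \<subseteq> X \<and> X \<subseteq> N" and Y: "V.subspace Y \<and> L \<subseteq> Y \<and> Y \<subseteq> N" and XY: "X \<subset> Y"
  from XY obtain y where y: "y \<in> Y" "y \<notin> X" by blast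
  have "f y \<notin> ssum (f ` X) L'"
  proof
    assume "f y \<in> ssum (f ` X) L'"
    then obtain x l where xl: "x \<in> X" "l \<in> L'" "f y = f x + l" unfolding ssum_def by blast
    then have "f (y - x) \<in> L'" by (simp add: hom_diff)
    moreover have "y - x \<in> N" using X Y y xl XY V.subspace_diff[of Y y x] by blast
    ultimately have "y - x \<in> X" using inj X by blast
    then have "y - x + x \<in> X" using xl X V.subspace_add by blast
    then show False using y by simp
  qed
  moreover have "f y \<in> ssum (f ` Y) L'" using y assms W.ssum_upper1[of L' "f ` Y"] by auto
  ultimately show "ssum (f ` X) L' \<subset> ssum (f ` Y) L'"
    using ssum_mono[of "f ` X" "f ` Y" L' L'] XY by blast
qed

text \<open>Surjectivity is asked modulo \<open>L'\<close>, the form in which a presentation of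
  \<open>N' / L'\<close> supplies it; submodules of the target are then determined by their
  preimages.\<close>

lemma len_hom_ge:
  assumes "V.subspace L" "V.subspace N" "L \<subseteq> N" "f ` L \<subseteq> L'"
    and surj: "\<And>y. y \<in> N' \<Longrightarrow> \<exists>x\<in>N. y - f x \<in> L'"
  shows "W.len L' N' \<le> V.len L N"
  unfolding V.len_def W.len_def
proof (rule chain_length_le_map[of _ _ "\<lambda>C. f -` C \<inter> N"])
  fix X assume X: "W.subspace X \<and> L' \<subseteq> X \<and> X \<subseteq> N'"
  then show "V.subspace (f -` X \<inter> N) \<and> L \<subseteq> f -` X \<inter> N \<and> f -` X \<inter> N \<subseteq> N"
    using assms subspace_vimage[of X] V.subspace_inter[of "f -` X" N] by blast
next
  fix X Y assume X: "W.subspace X \<and> L' \<subseteq> X \<and> X \<subseteq> N'" and Y: "W.subspace Y \<and> L' \<subseteq> Y \<and> Y \<subseteq> N'" and XY: "X \<subset> Y"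
  from XY obtain y where y: "y \<in> Y" "y \<notin> X" by blast
  then obtain x where x: "x \<in> N" "y - f x \<in> L'" using Y surj by blast
  have "f x = y - (y - f x)" by simp
  then have "f x \<in> Y" using x y Y W.subspace_diff[of Y y "y - f x"] by auto
  moreover have "f x \<notin> X" using x y X W.subspace_add[of X "f x" "y - f x"] by auto
  ultimately show "f -` X \<inter> N \<subset> f -` Y \<inter> N"
    using x XY by blast
qed

lemma len_hom_eq:
  assumes "V.subspace L" "V.subspace N" "L \<subseteq> N" "W.subspace L'" "L' \<subseteq> N'" "W.subspace N'" "f ` N \<subseteq> N'"
    and "\<And>x. x \<in> N \<Longrightarrow> f x \<in> L' \<longleftrightarrow> x \<in> L"
    and "\<And>y. y \<in> N' \<Longrightarrow> \<exists>x\<in>N. y - f x \<in> L'"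
  shows "V.len L N = W.len L' N'"
  by (rule antisym, rule len_hom_le) (use assms len_hom_ge[of L N L' N'] in auto)

end


hide_const (open) up_ring.coeff up_ring.monom module.smult

section \<open>Finite powers of a module: length and chain condition\<close>

definition fscale :: "('p \<Rightarrow> 'v \<Rightarrow> 'v) \<Rightarrow> 'p \<Rightarrow> (nat \<Rightarrow> 'v) \<Rightarrow> nat \<Rightarrow> 'v"
  where "fscale s c f = (\<lambda>i. s c (f i))"

text \<open>Vectors are sequences, and the coordinates from \<open>r\<close> on are unconstrained.
  They are so in both \<open>prodn r L\<close> and \<open>prodn r N\<close>, hence the quotient is
  the \<open>r\<close>-fold power of \<open>N / L\<close>.\<close>

definition prodn :: "nat \<Rightarrow> 'v set \<Rightarrow> (nat \<Rightarrow> 'v) set"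
  where "prodn r N = {f. \<forall>i<r. f i \<in> N}"

lemma prodn_mono: "L \<subseteq> N \<Longrightarrow> prodn r L \<subseteq> prodn r N"
  unfolding prodn_def by auto

context pmod
begin

lemma pmod_fscale: "pmod (fscale scale)"
  unfolding pmod_def Modules.module_def fscale_def plus_fun_def by (auto simp: algebra_simps)

lemma subspace_prodn:
  assumes "subspace N"
  shows "Modules.module.subspace (fscale scale) (prodn r N)"
proof -
  interpret F: pmod "fscale scale" by (rule pmod_fscale)
  show ?thesis
    by (rule F.subspaceI)
      (auto simp: prodn_def fscale_def intro: assms subspace_0 subspace_add subspace_scale)
qed

lemma len_prodn:
  assumes "subspace L" "subspace N" "L \<subseteq> N"
  shows "pmod.len (fscale scale) (prodn r L) (prodn r N) = of_nat r * len L N"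
proof -
  interpret F: pmod "fscale scale" by (rule pmod_fscale)
  show ?thesis
  proof (induction r)
    case 0
    then show ?case by (simp add: prodn_def)
  next
    case (Suc r)
    \<comment> \<open>\<open>mid\<close> separates the last coordinate: below it lies the quotient
      in the first \<open>r\<close> coordinates, above it the quotient in coordinate
      \<open>r\<close>.\<close>
    define mid where "mid = {f \<in> prodn (Suc r) N. f r \<in> L}"
    have mid: "F.subspace mid"
      by (rule F.subspaceI)
        (auto simp: mid_def prodn_def fscale_def intro: assms(1,2) subspace_0 subspace_add subspace_scale)
    interpret id: pmod_hom "fscale scale" "fscale scale" "\<lambda>f. f"
      by unfold_locales auto
    interpret ev: pmod_hom "fscale scale" scale "\<lambda>f. f r"
      by unfold_locales (auto simp: fscale_def)
    have 1: "prodn (Suc r) L \<subseteq> mid" "mid \<subseteq> prodn (Suc r) N"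
      using assms by (auto simp: mid_def prodn_def)
    have "F.len (prodn (Suc r) L) mid = F.len (prodn r L) (prodn r N)"
    proof (rule id.len_hom_eq)
      fix y assume y: "y \<in> prodn r N"
      show "\<exists>x\<in>mid. y - x \<in> prodn r L"
        by (rule bexI[of _ "y(r := 0)"])
          (use y assms in \<open>auto simp: prodn_def mid_def subspace_0 less_Suc_eq\<close>)
    next
      show "(\<lambda>f. f) ` mid \<subseteq> prodn r N" by (auto simp: mid_def prodn_def)
    next
      show "prodn r L \<subseteq> prodn r N" by (rule prodn_mono) (rule assms)
    next
      fix x assume "x \<in> mid"
      then show "x \<in> prodn r L \<longleftrightarrow> x \<in> prodn (Suc r) L" by (auto simp: mid_def prodn_def less_Suc_eq)
    qed (use assms mid 1 in \<open>simp_all add: subspace_prodn\<close>)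
    moreover have "F.len mid (prodn (Suc r) N) = len L N"
    proof (rule ev.len_hom_eq)
      fix y assume y: "y \<in> N"
      show "\<exists>x\<in>prodn (Suc r) N. y - x r \<in> L"
        by (rule bexI[of _ "\<lambda>_. y"]) (use y assms in \<open>auto simp: prodn_def subspace_0\<close>)
    next
      show "(\<lambda>f. f r) ` prodn (Suc r) N \<subseteq> N" by (auto simp: prodn_def)
    next
      fix x assume "x \<in> prodn (Suc r) N"
      then show "x r \<in> L \<longleftrightarrow> x \<in> mid" by (simp add: mid_def)
    qed (use assms mid 1 in \<open>simp_all add: subspace_prodn\<close>)
    moreover have "F.len (prodn (Suc r) L) (prodn (Suc r) N) =
        F.len (prodn (Suc r) L) mid + F.len mid (prodn (Suc r) N)"
      by (rule F.len_add) (use assms mid 1 subspace_prodn in auto)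
    ultimately show ?case using Suc.IH by (simp add: algebra_simps)
  qed
qed

text \<open>Noetherianity of the quotient of the whole module by \<open>base\<close>; throughout,
  the base stands for the zero submodule.\<close>

definition acc :: "'v set \<Rightarrow> bool"
  where "acc base \<longleftrightarrow> (\<forall>N. (\<forall>k::nat. subspace (N k) \<and> base \<subseteq> N k \<and> N k \<subseteq> N (Suc k)) \<longrightarrow>
    (\<exists>k. \<forall>j\<ge>k. N j = N k))"

lemma accD:
  assumes "acc base" "\<And>k. subspace (N k) \<and> base \<subseteq> N k \<and> N k \<subseteq> N (Suc k)"
  shows "\<exists>k. \<forall>j\<ge>k. N j = N k"
  using assms unfolding acc_def by blast

lemma acc_maximal:
  assumes "acc base" "X \<in> \<F>" "\<And>Y. Y \<in> \<F> \<Longrightarrow> subspace Y \<and> base \<subseteq> Y"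
  obtains Y where "Y \<in> \<F>" "\<And>Y'. Y' \<in> \<F> \<Longrightarrow> Y \<subseteq> Y' \<Longrightarrow> Y' = Y"
proof (rule ccontr)
  assume "\<not> thesis"
  then have *: "\<forall>Y\<in>\<F>. \<exists>Y'. Y' \<in> \<F> \<and> Y \<subset> Y'" using that by blast
  define g where "g = (\<lambda>Y. SOME Y'. Y' \<in> \<F> \<and> Y \<subset> Y')"
  have g: "g Y \<in> \<F> \<and> Y \<subset> g Y" if "Y \<in> \<F>" for Y
    unfolding g_def using *[rule_format, OF that] by (rule someI_ex)
  define N where "N = (\<lambda>k. (g ^^ k) X)"
  have N: "N k \<in> \<F>" for k by (induction k) (auto simp: N_def g assms)
  have N': "N k \<subset> N (Suc k)" for k using g[OF N[of k]] by (auto simp: N_def)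
  have "\<exists>k. \<forall>j\<ge>k. N j = N k"
    by (rule accD[OF assms(1)]) (use N N' assms(3) in blast)
  then obtain k where "\<forall>j\<ge>k. N j = N k" by blast
  then have "N (Suc k) = N k" by (metis le_SucI order_refl)
  then show False using N'[of k] by simp
qed

lemma acc_finitely_generated:
  assumes "acc base" "subspace N" "base \<subseteq> N"
  obtains S where "finite S" "S \<subseteq> N" "N = span (base \<union> S)"
proof -
  let ?F = "{span (base \<union> S) | S. finite S \<and> S \<subseteq> N}"
  have "span (base \<union> {}) \<in> ?F" by blast
  then obtain Y where Y: "Y \<in> ?F" "\<And>Y'. Y' \<in> ?F \<Longrightarrow> Y \<subseteq> Y' \<Longrightarrow> Y' = Y"
    by (rule acc_maximal[OF assms(1), of _ ?F]) (auto intro: span_base)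
  then obtain S where S: "Y = span (base \<union> S)" "finite S" "S \<subseteq> N" by blast
  have "x \<in> Y" if x: "x \<in> N" for x
  proof -
    have "span (base \<union> insert x S) = Y"
    proof (rule Y(2))
      show "span (base \<union> insert x S) \<in> ?F" using x S by blast
      show "Y \<subseteq> span (base \<union> insert x S)" unfolding S(1) by (rule span_mono) blast
    qed
    then show ?thesis by (metis Un_insert_right insertI1 span_base)
  qed
  moreover have "Y \<subseteq> N" unfolding S(1) using S assms by (intro span_minimal) auto
  ultimately show thesis using that[of S] S by blast
qed

lemma acc_prodn:
  assumes "acc base" "subspace base"
  shows "pmod.acc (fscale scale) (prodn r base)"
proof -
  interpret F: pmod "fscale scale" by (rule pmod_fscale)
  have *: "F.subspace C \<Longrightarrow> subspace ((\<lambda>f. f r) ` C)" for C r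
  proof -
    interpret ev: pmod_hom "fscale scale" scale "\<lambda>f. f r"
      by unfold_locales (auto simp: fscale_def)
    show "F.subspace C \<Longrightarrow> subspace ((\<lambda>f. f r) ` C)" by (rule ev.subspace_image)
  qed
  have **: "F.subspace C \<Longrightarrow> F.subspace ((\<lambda>f. f(r := 0)) -` C)" for C r
  proof -
    interpret ev: pmod_hom "fscale scale" "fscale scale" "\<lambda>f. f(r := 0)"
      by unfold_locales (auto simp: fscale_def fun_eq_iff)
    show "F.subspace C \<Longrightarrow> F.subspace ((\<lambda>f. f(r := 0)) -` C)" by (rule ev.subspace_vimage)
  qed
  show ?thesis
  proof (induction r)
    case 0
    then show ?case unfolding F.acc_def prodn_def by auto
  next
    case (Suc r)
    show ?case unfolding F.acc_def
    proof (intro allI impI)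
      fix N :: "nat \<Rightarrow> (nat \<Rightarrow> 'v) set"
      assume N: "\<forall>k. F.subspace (N k) \<and> prodn (Suc r) base \<subseteq> N k \<and> N k \<subseteq> N (Suc k)"
      have mono: "N i \<subseteq> N j" if "i \<le> j" for i j
        using lift_Suc_mono_le[of N] N that by auto
      have "\<exists>k. \<forall>j\<ge>k. (\<lambda>f. f r) ` N j = (\<lambda>f. f r) ` N k"
      proof (rule accD[OF assms(1)])
        fix k
        have "base \<subseteq> (\<lambda>f. f r) ` N k"
        proof
          fix x assume "x \<in> base"
          then have "(\<lambda>_. x) \<in> N k" using N by (auto simp: prodn_def)
          then show "x \<in> (\<lambda>f. f r) ` N k" by force
        qed
        moreover have "(\<lambda>f. f r) ` N k \<subseteq> (\<lambda>f. f r) ` N (Suc k)" using N by (intro image_mono) blast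
        ultimately show "subspace ((\<lambda>f. f r) ` N k) \<and> base \<subseteq> (\<lambda>f. f r) ` N k \<and>
            (\<lambda>f. f r) ` N k \<subseteq> (\<lambda>f. f r) ` N (Suc k)"
          using N * by blast
      qed
      then obtain k1 where k1: "\<And>j. j \<ge> k1 \<Longrightarrow> (\<lambda>f. f r) ` N j = (\<lambda>f. f r) ` N k1" by blast
      have "\<exists>k. \<forall>j\<ge>k. (\<lambda>f. f(r := 0)) -` N j = (\<lambda>f. f(r := 0)) -` N k"
      proof (rule F.accD[OF Suc.IH])
        fix k
        have "prodn r base \<subseteq> (\<lambda>f. f(r := 0)) -` N k"
        proof
          fix f assume "f \<in> prodn r base"
          then have "f(r := 0) \<in> prodn (Suc r) base"
            using assms by (auto simp: prodn_def less_Suc_eq subspace_0)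
          then show "f \<in> (\<lambda>f. f(r := 0)) -` N k" using N by blast
        qed
        moreover have "(\<lambda>f. f(r := 0)) -` N k \<subseteq> (\<lambda>f. f(r := 0)) -` N (Suc k)"
          using N by (intro vimage_mono) blast
        ultimately show "F.subspace ((\<lambda>f. f(r := 0)) -` N k) \<and> prodn r base \<subseteq> (\<lambda>f. f(r := 0)) -` N k \<and>
            (\<lambda>f. f(r := 0)) -` N k \<subseteq> (\<lambda>f. f(r := 0)) -` N (Suc k)"
          using N ** by blast
      qed
      then obtain k2 where k2: "\<And>j. j \<ge> k2 \<Longrightarrow> (\<lambda>f. f(r := 0)) -` N j = (\<lambda>f. f(r := 0)) -` N k2" by blast
      \<comment> \<open>Beyond \<open>?k\<close> the projections to coordinate \<open>r\<close>
        agree, and so do the vectors that vanish there; the difference of two elements with the same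
        coordinate \<open>r\<close> settles the rest.\<close>
      let ?k = "max k1 k2"
      have "N j \<subseteq> N ?k" if j: "j \<ge> ?k" for j
      proof
        fix f assume f: "f \<in> N j"
        have "f r \<in> (\<lambda>f. f r) ` N ?k" using k1[of j] k1[of ?k] j f by auto
        then obtain g where g: "g \<in> N ?k" "g r = f r" by force
        have d: "(f - g)(r := 0) = f - g" using g by (auto simp: fun_eq_iff)
        have "f - g \<in> N j" using N f g mono[OF j] F.subspace_diff by blast
        then have "f - g \<in> N ?k" using k2[of j] k2[of ?k] j d by (metis max.bounded_iff max.cobounded2 vimage_eq)
        then have "f - g + g \<in> N ?k" using g N F.subspace_add by blast
        then show "f \<in> N ?k" by simp
      qed
      then show "\<exists>k. \<forall>j\<ge>k. N j = N k" using mono by (metis subset_antisym)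
    qed
  qed
qed

end

lemma pmod_times: "pmod ((*) :: 'p::comm_ring_1 \<Rightarrow> 'p \<Rightarrow> 'p)"
  by unfold_locales (auto simp: algebra_simps)

interpretation ring: pmod "(*) :: 'p::comm_ring_1 \<Rightarrow> 'p \<Rightarrow> 'p"
  by (rule pmod_times)

declare ring.scale_scale [simp del]

section \<open>Hilbert's basis theorem relative to a base ideal\<close>

definition polys :: "'p::zero set \<Rightarrow> 'p poly set"
  where "polys Z = {p. \<forall>j. coeff p j \<in> Z}"

lemma acc_polys:
  fixes Z :: "'p::comm_ring_1 set"
  assumes acc: "ring.acc Z" and Z: "ring.subspace Z"
  shows "ring.acc (polys Z)"
  unfolding ring.acc_def
proof (intro allI impI)
  fix N :: "nat \<Rightarrow> 'p poly set"
  assume N: "\<forall>k. ring.subspace (N k) \<and> polys Z \<subseteq> N k \<and> N k \<subseteq> N (Suc k)"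
  have mono: "N i \<subseteq> N j" if "i \<le> j" for i j
    using lift_Suc_mono_le[of N] N that by auto
  \<comment> \<open>Coefficients in degree \<open>d\<close> of elements of degree at most
    \<open>d\<close>, that is, the leading coefficients together with 0. Multiplication by the
    variable makes them grow with \<open>d\<close>.\<close>
  define C where "C = (\<lambda>k d. {coeff p d | p. p \<in> N k \<and> degree p \<le> d})"
  have C_sub: "ring.subspace (C k d)" for k d
  proof (rule ring.subspaceI)
    show "0 \<in> C k d" using N ring.subspace_0 unfolding C_def by force
  next
    fix x y assume "x \<in> C k d" "y \<in> C k d"
    then obtain p q where "p \<in> N k" "degree p \<le> d" "q \<in> N k" "degree q \<le> d" "x = coeff p d" "y = coeff q d"
      unfolding C_def by blast
    then show "x + y \<in> C k d"
      unfolding C_def using N by (auto intro!: exI[of _ "p + q"] degree_add_le ring.subspace_add)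
  next
    fix c x assume "x \<in> C k d"
    then obtain p where "p \<in> N k" "degree p \<le> d" "x = coeff p d" unfolding C_def by blast
    moreover have "smult c p \<in> N k" if "p \<in> N k" for p
      using N ring.subspace_scale[of "N k" p "[:c:]"] that by auto
    ultimately show "c * x \<in> C k d"
      unfolding C_def using degree_smult_le[of c p]
      by (intro CollectI exI[of _ "smult c p"]) (auto intro: order_trans)
  qed
  have C_Z: "Z \<subseteq> C k d" for k d
  proof
    fix z assume z: "z \<in> Z"
    then have "monom z d \<in> polys Z" using ring.subspace_0[OF Z] by (auto simp: polys_def)
    then have "monom z d \<in> N k" using N by blast
    then show "z \<in> C k d" unfolding C_def
      by (intro CollectI exI[of _ "monom z d"]) (auto simp: degree_monom_le)
  qed
  have C_k: "C k d \<subseteq> C k' d" if "k \<le> k'" for k k' d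
    using mono[OF that] unfolding C_def by blast
  have C_Suc: "C k d \<subseteq> C k (Suc d)" for k d
  proof
    fix x assume "x \<in> C k d"
    then obtain p where p: "p \<in> N k" "degree p \<le> d" "x = coeff p d" unfolding C_def by blast
    have "[:0, 1:] * p \<in> N k" using N p ring.subspace_scale by blast
    then have "pCons 0 p \<in> N k" by simp
    then show "x \<in> C k (Suc d)" unfolding C_def
      by (intro CollectI exI[of _ "pCons 0 p"]) (use p in \<open>auto simp: degree_pCons_le intro: order_trans[OF degree_pCons_le]\<close>)
  qed
  have C_d: "C k d \<subseteq> C k d'" if "d \<le> d'" for k d d'
    using lift_Suc_mono_le[of "C k", OF C_Suc that] .
  \<comment> \<open>The diagonal stabilises at \<open>k0\<close>, and with it all degrees from
    \<open>k0\<close> on at once; the finitely many smaller degrees are treated one by one and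
    merged in \<open>K\<close>.\<close>
  have "\<exists>k. \<forall>j\<ge>k. C j j = C k k"
    by (rule ring.accD[OF acc]) (meson C_sub C_Z C_k C_Suc lessI less_imp_le order_trans)
  then obtain k0 where k0: "\<And>j. j \<ge> k0 \<Longrightarrow> C j j = C k0 k0" by blast
  have "\<exists>k. \<forall>j\<ge>k. C j d = C k d" for d
    by (rule ring.accD[OF acc]) (meson C_sub C_Z C_k lessI less_imp_le)
  then obtain kk where kk: "\<And>d j. j \<ge> kk d \<Longrightarrow> C j d = C (kk d) d" by metis
  define K where "K = Max (insert k0 (kk ` {..<k0}))"
  have K: "K \<ge> k0" "\<And>d. d < k0 \<Longrightarrow> K \<ge> kk d" by (auto simp: K_def)
  have C_eq: "C j d \<subseteq> C K d" if j: "j \<ge> K" for j d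
  proof (cases "d < k0")
    case True
    then show ?thesis using kk[of d j] kk[of d K] K(2)[of d] j by simp
  next
    case False
    have "C j d \<subseteq> C (max j d) (max j d)" using C_k[of j "max j d" d] C_d[of d "max j d" "max j d"] by auto
    also have "\<dots> = C k0 k0" by (rule k0) (use False in \<open>simp add: le_max_iff_disj\<close>)
    also have "\<dots> \<subseteq> C K d" using C_k[of k0 K k0] C_d[of k0 d K] K False by auto
    finally show ?thesis .
  qed
  have "p \<in> N K" if j: "j \<ge> K" and p: "p \<in> N j" and d: "degree p \<le> d" for j p d
    using p d
  proof (induction d arbitrary: p)
    case (0 p)
    then have "coeff p 0 \<in> C K 0" using C_eq[OF j, of 0] unfolding C_def by blast
    then obtain q where q: "q \<in> N K" "degree q \<le> 0" "coeff p 0 = coeff q 0" unfolding C_def by auto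
    then have "p = q" using 0 by (metis degree_0_id le_zero_eq)
    then show ?case using q by simp
  next
    case (Suc d p)
    then have "coeff p (Suc d) \<in> C K (Suc d)" using C_eq[OF j, of "Suc d"] unfolding C_def by blast
    then obtain q where q: "q \<in> N K" "degree q \<le> Suc d" "coeff p (Suc d) = coeff q (Suc d)" unfolding C_def by auto
    have "p - q \<in> N j" using Suc.prems q mono[OF j] N ring.subspace_diff by blast
    moreover have "degree (p - q) \<le> d"
    proof (rule degree_le, intro allI impI)
      fix i assume i: "d < i"
      show "coeff (p - q) i = 0"
      proof (cases "i = Suc d")
        case False
        then have "degree p < i" "degree q < i" using i Suc.prems(2) q by linarith+
        then show ?thesis by (simp add: coeff_eq_0)
      qed (use q in simp)
    qed
    ultimately have "p - q \<in> N K" using Suc.IH by blast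
    then have "p - q + q \<in> N K" using q N ring.subspace_add by blast
    then show ?case by simp
  qed
  then have "N j = N K" if "j \<ge> K" for j using mono[OF that] that by blast
  then show "\<exists>k. \<forall>j\<ge>k. N j = N k" by blast
qed


section \<open>Monomials and the Rees algebra\<close>

abbreviation vle :: "nat list \<Rightarrow> nat list \<Rightarrow> bool"
  where "vle \<equiv> list_all2 (\<le>)"

abbreviation vadd :: "nat list \<Rightarrow> nat list \<Rightarrow> nat list"
  where "vadd \<equiv> map2 (+)"

lemma nat_seq_monotone_subseq:
  fixes s :: "nat \<Rightarrow> nat"
  shows "\<exists>f :: nat \<Rightarrow> nat. strict_mono f \<and> (\<forall>i j. i \<le> j \<longrightarrow> s (f i) \<le> s (f j))"
proof -
  obtain f :: "nat \<Rightarrow> nat" where f: "strict_mono f" "monoseq (\<lambda>n. s (f n))"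
    using seq_monosub by blast
  show ?thesis
  proof (cases "incseq (\<lambda>n. s (f n))")
    case True
    then show ?thesis using f by (auto simp: incseq_def)
  next
    case False
    then have dec: "decseq (\<lambda>n. s (f n))" using f(2) monoseq_iff by blast
    obtain k where k: "s (f k) = (LEAST v. \<exists>k. v = s (f k))"
      using LeastI_ex[of "\<lambda>v. \<exists>k. v = s (f k)"] by metis
    have k': "s (f j) = s (f k)" if "j \<ge> k" for j
    proof (rule antisym)
      show "s (f j) \<le> s (f k)" using dec that by (auto simp: decseq_def)
      show "s (f k) \<le> s (f j)" unfolding k by (rule Least_le) blast
    qed
    show ?thesis
    proof (intro exI[of _ "\<lambda>i. f (k + i)"] conjI allI impI)
      show "strict_mono (\<lambda>i. f (k + i))" using f(1) by (auto simp: strict_mono_def)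
      fix i j show "s (f (k + i)) \<le> s (f (k + j))" using k'[of "k + i"] k'[of "k + j"] by linarith
    qed
  qed
qed

text \<open>The conclusion is an ascending subsequence rather than a single comparable pair: the
  induction thins the tails first and then the heads along that subsequence, and the later chain
  arguments run along an infinite ascending sequence.\<close>

lemma dickson:
  assumes "\<And>k. length (\<alpha> k) = m"
  shows "\<exists>f :: nat \<Rightarrow> nat. strict_mono f \<and> (\<forall>i j. i \<le> j \<longrightarrow> vle (\<alpha> (f i)) (\<alpha> (f j)))"
  using assms
proof (induction m arbitrary: \<alpha>)
  case 0
  then show ?case by (intro exI[of _ id]) (auto simp: strict_mono_def)
next
  case (Suc m)
  have len: "length (tl (\<alpha> k)) = m" for k using Suc.prems[of k] by simp
  obtain f :: "nat \<Rightarrow> nat" where f: "strict_mono f" "\<And>i j. i \<le> j \<Longrightarrow> vle (tl (\<alpha> (f i))) (tl (\<alpha> (f j)))"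
    using Suc.IH[of "\<lambda>k. tl (\<alpha> k)", OF len] by blast
  obtain g :: "nat \<Rightarrow> nat" where g: "strict_mono g" "\<forall>i j. i \<le> j \<longrightarrow> hd (\<alpha> (f (g i))) \<le> hd (\<alpha> (f (g j)))"
    using nat_seq_monotone_subseq[of "\<lambda>k. hd (\<alpha> (f k))"] by blast
  have "vle (\<alpha> (f (g i))) (\<alpha> (f (g j)))" if ij: "i \<le> j" for i j
  proof -
    have "\<alpha> k = hd (\<alpha> k) # tl (\<alpha> k)" for k
      using Suc.prems[of k] by (metis length_Suc_conv list.sel(1,3))
    moreover have "vle (tl (\<alpha> (f (g i)))) (tl (\<alpha> (f (g j))))"
      using f(2) g(1) ij by (simp add: strict_mono_less_eq)
    ultimately show ?thesis using g(2) ij by (metis list_all2_Cons)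
  qed
  then show ?case using f(1) g(1) by (intro exI[of _ "f \<circ> g"]) (auto simp: strict_mono_def)
qed

lemma vle_vadd_ex:
  assumes "vle \<gamma> \<alpha>"
  shows "\<exists>\<delta>. length \<delta> = length \<gamma> \<and> \<alpha> = vadd \<gamma> \<delta> \<and> sum_list \<alpha> = sum_list \<gamma> + sum_list \<delta>"
  using assms
proof (induction rule: list_all2_induct)
  case (Cons x xs y ys)
  then obtain \<delta> where "length \<delta> = length xs \<and> ys = vadd xs \<delta> \<and> sum_list ys = sum_list xs + sum_list \<delta>"
    by blast
  then show ?case using Cons.hyps by (intro exI[of _ "(y - x) # \<delta>"]) auto
qed auto

lemma sum_list_vadd: "length \<alpha> = length \<delta> \<Longrightarrow> sum_list (vadd \<alpha> \<delta>) = sum_list \<alpha> + sum_list \<delta>"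
  by (induction rule: list_induct2) auto

fun lexless :: "nat list \<Rightarrow> nat list \<Rightarrow> bool" where
  "lexless (x # xs) (y # ys) \<longleftrightarrow> x < y \<or> x = y \<and> lexless xs ys"
| "lexless _ _ \<longleftrightarrow> False"

lemma lexless_irrefl: "\<not> lexless xs xs"
  by (induction xs) auto

lemma lexless_trans: "lexless xs ys \<Longrightarrow> lexless ys zs \<Longrightarrow> lexless xs zs"
  by (induction xs ys arbitrary: zs rule: lexless.induct) (case_tac zs; auto)+

lemma lexless_total: "length xs = length ys \<Longrightarrow> lexless xs ys \<or> xs = ys \<or> lexless ys xs"
  by (induction rule: list_induct2) auto

lemma lexless_vadd:
  "lexless \<beta> \<alpha> \<Longrightarrow> length \<beta> = length \<alpha> \<Longrightarrow> length \<delta> = length \<alpha> \<Longrightarrow> lexless (vadd \<beta> \<delta>) (vadd \<alpha> \<delta>)"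
proof (induction \<beta> \<alpha> arbitrary: \<delta> rule: lexless.induct)
  case (1 x xs y ys)
  then show ?case by (cases \<delta>) auto
qed auto

fun mon :: "'p::comm_ring_1 list \<Rightarrow> nat list \<Rightarrow> 'p" where
  "mon (a # as) (k # ks) = a ^ k * mon as ks"
| "mon _ _ = 1"

lemma mon_vadd: "length \<alpha> = length \<delta> \<Longrightarrow> mon as (vadd \<alpha> \<delta>) = mon as \<alpha> * mon as \<delta>"
proof (induction \<alpha> \<delta> arbitrary: as rule: list_induct2)
  case (Cons x xs y ys)
  note IH = Cons.IH
  show ?case
  proof (cases as)
    case (Cons b bs)
    have "mon as (vadd (x # xs) (y # ys)) = (b ^ x * b ^ y) * (mon bs xs * mon bs ys)"
      unfolding Cons by (simp add: IH[of bs] power_add)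
    also have "\<dots> = (b ^ x * mon bs xs) * (b ^ y * mon bs ys)" by (simp add: mult_ac)
    finally show ?thesis unfolding Cons by simp
  qed simp
next
  case Nil
  then show ?case by (cases as) auto
qed

lemma mon_split:
  assumes "length \<delta> = length as" "0 < sum_list \<delta>"
  shows "\<exists>a\<in>set as. \<exists>\<delta>'. length \<delta>' = length as \<and> sum_list \<delta> = Suc (sum_list \<delta>') \<and> mon as \<delta> = a * mon as \<delta>'"
  using assms
proof (induction \<delta> as rule: list_induct2)
  case (Cons k ks a as)
  show ?case
  proof (cases k)
    case 0
    then obtain b \<delta>' where "b \<in> set as" "length \<delta>' = length as" "sum_list ks = Suc (sum_list \<delta>')"
      "mon as ks = b * mon as \<delta>'" using Cons by auto
    then show ?thesis using 0 by (intro bexI[of _ b] exI[of _ "0 # \<delta>'"]) auto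
  next
    case (Suc k')
    then show ?thesis using Cons by (intro bexI[of _ a] exI[of _ "k' # ks"]) auto
  qed
qed auto

definition exps :: "nat \<Rightarrow> nat \<Rightarrow> nat list set"
  where "exps m s = {\<alpha>. length \<alpha> = m \<and> sum_list \<alpha> = s}"

definition below :: "nat list \<Rightarrow> nat list set"
  where "below \<alpha> = {\<beta> \<in> exps (length \<alpha>) (sum_list \<alpha>). lexless \<beta> \<alpha>}"

lemma finite_exps: "finite (exps m s)"
proof (rule finite_subset)
  show "exps m s \<subseteq> {\<alpha>. set \<alpha> \<subseteq> {..s} \<and> length \<alpha> = m}"
    using member_le_sum_list by (auto simp: exps_def)
qed (use finite_lists_length_eq in auto)

lemma lexless_max:
  assumes "\<Sigma> \<subseteq> exps m s" "\<Sigma> \<noteq> {}"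
  obtains \<alpha> where "\<alpha> \<in> \<Sigma>" "\<And>\<beta>. \<beta> \<in> \<Sigma> \<Longrightarrow> \<beta> \<noteq> \<alpha> \<Longrightarrow> lexless \<beta> \<alpha>"
proof -
  have fin: "finite \<Sigma>" using assms finite_exps finite_subset by blast
  have "asymp_on \<Sigma> lexless" "transp_on \<Sigma> lexless"
    by (auto intro!: asymp_onI transp_onI dest: lexless_trans simp: lexless_irrefl)
  then obtain \<alpha> where "\<alpha> \<in> \<Sigma>" "\<forall>x\<in>\<Sigma>. x \<noteq> \<alpha> \<longrightarrow> \<not> lexless \<alpha> x"
    using Finite_Set.bex_max_element[OF fin] assms(2) by blast
  then show ?thesis using that lexless_total assms(1) unfolding exps_def by (metis (mono_tags, lifting) mem_Collect_eq subset_iff)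
qed

section \<open>Leading terms in the Rees module\<close>

context pmod
begin

text \<open>For \<open>\<Sigma>\<close> all monomials of degree \<open>s\<close> this is the
  \<open>s\<close>-th power of the ideal generated by \<open>as\<close>, applied to the module, plus
  \<open>base\<close>. For \<open>\<Sigma> = below \<alpha>\<close> it collects the terms of the
  same degree that are lexicographically smaller than \<open>\<alpha>\<close>.\<close>

definition Dlex :: "'v set \<Rightarrow> 'p list \<Rightarrow> nat list set \<Rightarrow> 'v set"
  where "Dlex base as \<Sigma> = span (base \<union> {mon as \<beta> *s x | \<beta> x. \<beta> \<in> \<Sigma>})"

lemma span_image_scale:
  assumes "x \<in> span S" "\<And>y. y \<in> S \<Longrightarrow> c *s y \<in> T" "subspace T"
  shows "c *s x \<in> T"
proof -
  have "subspace {x. c *s x \<in> T}"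
    using assms(3) unfolding subspace_def
    by (auto simp: scale_right_distrib) (metis mult.commute scale_scale)
  then show ?thesis using span_minimal[of S "{x. c *s x \<in> T}"] assms by blast
qed

lemma Dlex_base: "base \<subseteq> Dlex base as \<Sigma>"
  unfolding Dlex_def by (auto intro: span_base)

lemma Dlex_vadd:
  assumes "x \<in> Dlex base as (below \<alpha>)" "length \<alpha> = length \<delta>" "subspace base"
  shows "mon as \<delta> *s x \<in> Dlex base as (below (vadd \<alpha> \<delta>))"
  using assms(1) unfolding Dlex_def
proof (rule span_image_scale)
  fix y assume "y \<in> base \<union> {mon as \<beta> *s x |\<beta> x. \<beta> \<in> below \<alpha>}"
  then consider "y \<in> base" | \<beta> x where "y = mon as \<beta> *s x" "\<beta> \<in> below \<alpha>" by blast
  then show "mon as \<delta> *s y \<in> span (base \<union> {mon as \<beta> *s x |\<beta> x. \<beta> \<in> below (vadd \<alpha> \<delta>)})"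
  proof cases
    case 1
    then show ?thesis using assms(3) subspace_scale by (auto intro: span_base)
  next
    case 2
    then have "vadd \<beta> \<delta> \<in> below (vadd \<alpha> \<delta>)"
      using assms(2) by (auto simp: below_def exps_def sum_list_vadd lexless_vadd)
    moreover have "mon as \<delta> *s y = mon as (vadd \<beta> \<delta>) *s x"
      using 2 assms(2) by (auto simp: below_def exps_def mon_vadd mult_ac)
    ultimately show ?thesis by (intro span_base) blast
  qed
qed auto

text \<open>Splits off the leading term: in an initial segment, what remains beside the term at the
  largest monomial is a combination of exactly the smaller ones.\<close>

lemma Dlex_remove_max:
  assumes "\<Sigma> \<subseteq> exps (length as) s" "\<alpha> \<in> \<Sigma>" "\<And>\<beta>. \<beta> \<in> \<Sigma> \<Longrightarrow> \<beta> \<noteq> \<alpha> \<Longrightarrow> lexless \<beta> \<alpha>"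
    and down: "\<And>\<beta>. \<beta> \<in> exps (length as) s \<Longrightarrow> lexless \<beta> \<alpha> \<Longrightarrow> \<beta> \<in> \<Sigma>"
  shows "\<Sigma> - {\<alpha>} = below \<alpha>"
    and "g \<in> Dlex base as \<Sigma> \<Longrightarrow> \<exists>c. \<exists>d\<in>Dlex base as (below \<alpha>). g = mon as \<alpha> *s c + d"
proof -
  show b: "\<Sigma> - {\<alpha>} = below \<alpha>"
  proof (rule Set.set_eqI)
    fix \<beta>
    have "\<alpha> \<in> exps (length as) s" using assms by blast
    then have "exps (length \<alpha>) (sum_list \<alpha>) = exps (length as) s" by (simp add: exps_def)
    then show "\<beta> \<in> \<Sigma> - {\<alpha>} \<longleftrightarrow> \<beta> \<in> below \<alpha>"
      unfolding below_def using assms lexless_irrefl by blast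
  qed
  assume "g \<in> Dlex base as \<Sigma>"
  moreover have "Dlex base as \<Sigma> \<subseteq> ssum ((\<lambda>c. mon as \<alpha> *s c) ` UNIV) (Dlex base as (below \<alpha>))"
    unfolding Dlex_def[of base as \<Sigma>]
  proof (rule span_minimal)
    interpret sc: pmod_hom scale scale "\<lambda>c. mon as \<alpha> *s c"
      by unfold_locales (auto simp: algebra_simps)
    have im: "subspace ((\<lambda>c. mon as \<alpha> *s c) ` UNIV)" by (rule sc.subspace_image) simp
    then show "subspace (ssum ((\<lambda>c. mon as \<alpha> *s c) ` UNIV) (Dlex base as (below \<alpha>)))"
      by (rule subspace_ssum) (simp add: Dlex_def)
    have "y \<in> ssum ((\<lambda>c. mon as \<alpha> *s c) ` UNIV) (Dlex base as (below \<alpha>))"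
      if y: "y \<in> base \<union> {mon as \<beta> *s x |\<beta> x. \<beta> \<in> \<Sigma>}" for y
    proof -
      have "y \<in> Dlex base as (below \<alpha>) \<or> y \<in> (\<lambda>c. mon as \<alpha> *s c) ` UNIV"
        using y unfolding Dlex_def b[symmetric] by (auto intro: span_base)
      moreover have "subspace (Dlex base as (below \<alpha>))" by (simp add: Dlex_def)
      ultimately show ?thesis using ssum_upper1 ssum_upper2[OF im] by blast
    qed
    then show "base \<union> {mon as \<beta> *s x |\<beta> x. \<beta> \<in> \<Sigma>} \<subseteq> ssum ((\<lambda>c. mon as \<alpha> *s c) ` UNIV) (Dlex base as (below \<alpha>))"
      by blast
  qed
  ultimately show "\<exists>c. \<exists>d\<in>Dlex base as (below \<alpha>). g = mon as \<alpha> *s c + d"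
    unfolding ssum_def by blast
qed

text \<open>Dickson's lemma for exponents and the chain condition for modules combine:
  counterexamples to all bounds \<open>N\<close> contain a subsequence with ascending exponents,
  along which \<open>C\<close> becomes constant. Later this bounds the degrees in which new leading
  coefficients appear.\<close>

lemma acc_corner:
  assumes "acc base" "\<And>\<alpha>. length \<alpha> = m \<Longrightarrow> subspace (C \<alpha>) \<and> base \<subseteq> C \<alpha>"
    and mono: "\<And>\<alpha> \<beta>. length \<alpha> = m \<Longrightarrow> length \<beta> = m \<Longrightarrow> vle \<alpha> \<beta> \<Longrightarrow> C \<alpha> \<subseteq> C \<beta>"
  shows "\<exists>N. \<forall>\<alpha>. length \<alpha> = m \<longrightarrow> (\<exists>\<gamma>. vle \<gamma> \<alpha> \<and> sum_list \<gamma> \<le> N \<and> C \<alpha> \<subseteq> C \<gamma>)"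
proof (rule ccontr)
  assume "\<not> ?thesis"
  then have "\<forall>N. \<exists>\<alpha>. length \<alpha> = m \<and> (\<forall>\<gamma>. vle \<gamma> \<alpha> \<longrightarrow> sum_list \<gamma> \<le> N \<longrightarrow> \<not> C \<alpha> \<subseteq> C \<gamma>)"
    by blast
  then obtain \<alpha> where \<alpha>: "\<And>N. length (\<alpha> N) = m"
    "\<And>N \<gamma>. vle \<gamma> (\<alpha> N) \<Longrightarrow> sum_list \<gamma> \<le> N \<Longrightarrow> \<not> C (\<alpha> N) \<subseteq> C \<gamma>" by metis
  obtain f :: "nat \<Rightarrow> nat" where f: "strict_mono f" "\<And>i j. i \<le> j \<Longrightarrow> vle (\<alpha> (f i)) (\<alpha> (f j))"
    using dickson[of \<alpha> m, OF \<alpha>(1)] by blast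
  have "\<exists>k. \<forall>j\<ge>k. C (\<alpha> (f j)) = C (\<alpha> (f k))"
    by (rule accD[OF assms(1)]) (use assms(2) \<alpha>(1) mono f(2) in auto)
  then obtain k where k: "\<forall>j\<ge>k. C (\<alpha> (f j)) = C (\<alpha> (f k))" by blast
  \<comment> \<open>\<open>l\<close> lies beyond the point of stabilisation, and
    \<open>f l \<ge> l\<close> reaches the degree of \<open>\<alpha> (f k)\<close>, which thereby is
    an admissible \<open>\<gamma>\<close> for the index \<open>f l\<close>.\<close>
  define l where "l = max k (sum_list (\<alpha> (f k)))"
  have "sum_list (\<alpha> (f k)) \<le> f l"
    using seq_suble[OF f(1), of l] by (simp add: l_def)
  moreover have "vle (\<alpha> (f k)) (\<alpha> (f l))" by (rule f(2)) (simp add: l_def)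
  ultimately have "\<not> C (\<alpha> (f l)) \<subseteq> C (\<alpha> (f k))" by (intro \<alpha>(2))
  moreover have "C (\<alpha> (f l)) = C (\<alpha> (f k))" using k[rule_format, of l] unfolding l_def by simp
  ultimately show False by blast
qed

lemma family_mon:
  assumes "\<And>s a x. a \<in> G \<Longrightarrow> x \<in> J s \<Longrightarrow> a *s x \<in> J (Suc s)"
    and "set as \<subseteq> G" "length \<delta> = length as" "x \<in> J s"
  shows "mon as \<delta> *s x \<in> J (s + sum_list \<delta>)"
  using assms(3,2,4)
proof (induction \<delta> as arbitrary: x s rule: list_induct2)
  case (Cons k ks a as)
  have pow: "a ^ k *s x \<in> J (s + k)" if "x \<in> J s" for x s
    using that
  proof (induction k)
    case (Suc k)
    then show ?case using assms(1)[of a "a ^ k *s x" "s + k"] Cons.prems by auto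
  qed auto
  have "mon as ks *s (a ^ k *s x) \<in> J (s + k + sum_list ks)"
    using Cons.IH[OF _ pow[OF Cons.prems(2)]] Cons.prems by simp
  then show ?case by (simp add: add.assoc mult.commute)
qed auto

text \<open>This is the Noetherianity of the Rees module: the graded submodules of
  \<open>\<Oplus>\<^sub>s \<aa>\<^sup>s E\<close> for the ideal \<open>\<aa>\<close> generated by \<open>as\<close> are finitely generated.  The proof is
  Hilbert's, with leading coefficients taken with respect to the lexicographic order.\<close>

lemma rees_noetherian:
  assumes acc: "acc base" and base: "subspace base"
    and J: "\<And>s. subspace (J s)" "\<And>s. base \<subseteq> J s"
    and J_Fil: "\<And>s. J s \<subseteq> Dlex base as (exps (length as) s)"
    and J_mult: "\<And>s a x. a \<in> set as \<Longrightarrow> x \<in> J s \<Longrightarrow> a *s x \<in> J (Suc s)"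
  shows "\<exists>s0. \<forall>s\<ge>s0. J (Suc s) \<subseteq> span (base \<union> {a *s x | a x. a \<in> set as \<and> x \<in> J s})"
proof -
  define m where "m = length as"
  \<comment> \<open>Leading coefficients at the monomial \<open>\<alpha>\<close>, up to
    lexicographically smaller monomials of the same degree. They grow along divisibility of
    monomials, so \<open>acc_corner\<close> applies.\<close>
  define C where "C = (\<lambda>\<alpha>. {c. mon as \<alpha> *s c \<in> ssum (J (sum_list \<alpha>)) (Dlex base as (below \<alpha>))})"
  have Dsub: "subspace (Dlex base as X)" for X by (simp add: Dlex_def)
  have C_sub: "subspace (C \<alpha>) \<and> base \<subseteq> C \<alpha>" for \<alpha>
  proof -
    interpret sc: pmod_hom scale scale "\<lambda>c. mon as \<alpha> *s c"
      by unfold_locales (auto simp: algebra_simps)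
    have "subspace (C \<alpha>)" unfolding C_def
      using sc.subspace_vimage[OF subspace_ssum[OF J(1) Dsub], of "sum_list \<alpha>" "below \<alpha>"]
      by (simp add: vimage_def)
    moreover have "base \<subseteq> C \<alpha>"
      unfolding C_def using ssum_upper1[OF Dsub, of "J (sum_list \<alpha>)"] J(2) base subspace_scale by blast
    ultimately show ?thesis ..
  qed
  have C_mono: "C \<alpha> \<subseteq> C \<beta>" if ab: "length \<alpha> = m" "length \<beta> = m" "vle \<alpha> \<beta>" for \<alpha> \<beta>
  proof
    fix c assume c: "c \<in> C \<alpha>"
    obtain \<delta> where \<delta>: "length \<delta> = m" "\<beta> = vadd \<alpha> \<delta>" "sum_list \<beta> = sum_list \<alpha> + sum_list \<delta>"
      using vle_vadd_ex[OF ab(3)] ab(1) by auto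
    obtain j d where jd: "mon as \<alpha> *s c = j + d" "j \<in> J (sum_list \<alpha>)" "d \<in> Dlex base as (below \<alpha>)"
      using c unfolding C_def ssum_def by blast
    have "mon as \<beta> *s c = mon as \<delta> *s j + mon as \<delta> *s d"
      using \<delta> that jd(1) mon_vadd[of \<alpha> \<delta> as]
      by (metis mult.commute scale_right_distrib scale_scale)
    moreover have "mon as \<delta> *s j \<in> J (sum_list \<beta>)"
      using family_mon[of "set as" J as \<delta> j] J_mult jd(2) \<delta> by (simp add: m_def)
    moreover have "mon as \<delta> *s d \<in> Dlex base as (below \<beta>)"
      unfolding \<delta>(2) by (rule Dlex_vadd[OF jd(3) _ base]) (use that \<delta> in simp)
    ultimately show "c \<in> C \<beta>" unfolding C_def ssum_def by blast
  qed
  obtain N where N: "\<And>\<alpha>. length \<alpha> = m \<Longrightarrow> \<exists>\<gamma>. vle \<gamma> \<alpha> \<and> sum_list \<gamma> \<le> N \<and> C \<alpha> \<subseteq> C \<gamma>"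
    using acc_corner[OF acc, of m C] C_sub C_mono by blast
  have "J (Suc s) \<subseteq> span (base \<union> {a *s x | a x. a \<in> set as \<and> x \<in> J s})" if s: "s \<ge> N" for s
  proof -
    define T where "T = span (base \<union> {a *s x | a x. a \<in> set as \<and> x \<in> J s})"
    have T_J: "T \<subseteq> J (Suc s)" unfolding T_def
      by (rule span_minimal) (use J J_mult in auto)
    \<comment> \<open>Induction over the lexicographic initial segments of degree
      \<open>Suc s\<close>: the leading term is cancelled by an element of \<open>T\<close>, and the
      rest lives in a shorter segment.\<close>
    have *: "J (Suc s) \<inter> Dlex base as \<Sigma> \<subseteq> T"
      if "\<Sigma> \<subseteq> exps m (Suc s)" "\<And>\<alpha> \<beta>. \<alpha> \<in> \<Sigma> \<Longrightarrow> \<beta> \<in> exps m (Suc s) \<Longrightarrow> lexless \<beta> \<alpha> \<Longrightarrow> \<beta> \<in> \<Sigma>" for \<Sigma>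
      using that
    proof (induction "card \<Sigma>" arbitrary: \<Sigma>)
      case 0
      then have "\<Sigma> = {}" using finite_subset[OF 0(2) finite_exps] by simp
      then have "Dlex base as \<Sigma> = span base" by (simp add: Dlex_def)
      then show ?case unfolding T_def using span_mono[of base] by blast
    next
      case (Suc n)
      then obtain \<alpha> where \<alpha>: "\<alpha> \<in> \<Sigma>" "\<And>\<beta>. \<beta> \<in> \<Sigma> \<Longrightarrow> \<beta> \<noteq> \<alpha> \<Longrightarrow> lexless \<beta> \<alpha>"
        using lexless_max[of \<Sigma> m "Suc s"] by (metis card.empty nat.simps(3))
      have sub: "\<Sigma> \<subseteq> exps (length as) (Suc s)" using Suc.prems m_def by simp
      have down: "\<And>\<beta>. \<beta> \<in> exps (length as) (Suc s) \<Longrightarrow> lexless \<beta> \<alpha> \<Longrightarrow> \<beta> \<in> \<Sigma>"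
        using Suc.prems(2)[OF \<alpha>(1)] m_def by simp
      note rem = Dlex_remove_max[OF sub \<alpha> down]
      have "J (Suc s) \<inter> Dlex base as (\<Sigma> - {\<alpha>}) \<subseteq> T"
      proof (rule Suc.hyps(1))
        show "n = card (\<Sigma> - {\<alpha>})" using Suc.hyps(2) \<alpha>(1) by simp
        show "\<Sigma> - {\<alpha>} \<subseteq> exps m (Suc s)" using Suc.prems by blast
        fix \<gamma> \<beta> assume "\<gamma> \<in> \<Sigma> - {\<alpha>}" "\<beta> \<in> exps m (Suc s)" "lexless \<beta> \<gamma>"
        then show "\<beta> \<in> \<Sigma> - {\<alpha>}"
          using Suc.prems(2) \<alpha>(2)[of \<gamma>] lexless_irrefl lexless_trans by blast
      qed
      then have IH: "J (Suc s) \<inter> Dlex base as (below \<alpha>) \<subseteq> T" using rem(1) by simp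
      show ?case
      proof
        fix g assume g: "g \<in> J (Suc s) \<inter> Dlex base as \<Sigma>"
        obtain c d where cd: "g = mon as \<alpha> *s c + d" "d \<in> Dlex base as (below \<alpha>)"
          using rem(2)[of g base] g by blast
        have \<alpha>l: "length \<alpha> = m" "sum_list \<alpha> = Suc s" using \<alpha>(1) Suc.prems(1) by (auto simp: exps_def)
        have "mon as \<alpha> *s c = g + (- d)" using cd by simp
        moreover have "- d \<in> Dlex base as (below \<alpha>)" using cd(2) Dsub subspace_neg by blast
        ultimately have "c \<in> C \<alpha>" unfolding C_def \<alpha>l using g ssumI[of g _ "- d"] by auto
        then obtain \<gamma> where \<gamma>: "vle \<gamma> \<alpha>" "sum_list \<gamma> \<le> N" "c \<in> C \<gamma>" using N[OF \<alpha>l(1)] by blast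
        then have \<gamma>l: "length \<gamma> = m" using \<alpha>l list_all2_lengthD by metis
        obtain \<delta> where \<delta>: "length \<delta> = m" "\<alpha> = vadd \<gamma> \<delta>" "sum_list \<alpha> = sum_list \<gamma> + sum_list \<delta>"
          using vle_vadd_ex[OF \<gamma>(1)] \<gamma>l by auto
        obtain j d' where jd: "mon as \<gamma> *s c = j + d'" "j \<in> J (sum_list \<gamma>)" "d' \<in> Dlex base as (below \<gamma>)"
          using \<gamma>(3) unfolding C_def ssum_def by blast
        have eq: "mon as \<alpha> *s c = mon as \<delta> *s j + mon as \<delta> *s d'"
          using \<delta> \<gamma>l jd(1) mon_vadd[of \<gamma> \<delta> as]
          by (metis mult.commute scale_right_distrib scale_scale)
        have d': "mon as \<delta> *s d' \<in> Dlex base as (below \<alpha>)"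
          unfolding \<delta>(2) by (rule Dlex_vadd[OF jd(3) _ base]) (use \<gamma>l \<delta> in simp)
        \<comment> \<open>As \<open>\<gamma>\<close> has degree at most \<open>N \<le> s\<close>, a
          generator \<open>a\<close> can be split off, and the rest of \<open>\<delta>\<close>
          carries \<open>j\<close> exactly into \<open>J s\<close>.\<close>
        have "0 < sum_list \<delta>" using \<delta>(3) \<alpha>l(2) \<gamma>(2) s by linarith
        then obtain a \<delta>' where a: "a \<in> set as" "length \<delta>' = length as" "sum_list \<delta> = Suc (sum_list \<delta>')"
            "mon as \<delta> = a * mon as \<delta>'"
          using mon_split[of \<delta> as] \<delta>(1) m_def by auto
        have "mon as \<delta>' *s j \<in> J (sum_list \<gamma> + sum_list \<delta>')"
          using family_mon[of "set as" J as \<delta>' j] J_mult jd(2) a by auto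
        moreover have "sum_list \<gamma> + sum_list \<delta>' = s" using \<delta>(3) \<alpha>l(2) a(3) by simp
        ultimately have "a *s (mon as \<delta>' *s j) \<in> T" unfolding T_def using a(1) by (intro span_base) auto
        then have j: "mon as \<delta> *s j \<in> T" using a(4) by simp
        have "g - mon as \<delta> *s j \<in> J (Suc s)" using g j T_J J(1) subspace_diff by blast
        moreover have "g - mon as \<delta> *s j = mon as \<delta> *s d' + d" using cd(1) eq by simp
        moreover have "mon as \<delta> *s d' + d \<in> Dlex base as (below \<alpha>)" using d' cd(2) Dsub subspace_add by blast
        ultimately have "g - mon as \<delta> *s j \<in> T" using IH by auto
        then have "g - mon as \<delta> *s j + mon as \<delta> *s j \<in> T" using j unfolding T_def by (intro span_add)
        then show "g \<in> T" by simp
      qed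
    qed
    have "J (Suc s) \<inter> Dlex base as (exps m (Suc s)) \<subseteq> T" by (rule *) auto
    then show ?thesis using J_Fil[of "Suc s"] unfolding T_def m_def by blast
  qed
  then show ?thesis by blast
qed

end


section \<open>Artin--Rees and McCoy\<close>

text \<open>Removes the factor \<open>(E + m) / E\<close> that multiplication by a generic element
  costs.\<close>

lemma enat_le_of_asymptotic:
  assumes "\<And>E::nat. of_nat E * a \<le> of_nat (E + m) * (b::enat)" and "b \<noteq> \<infinity>"
  shows "a \<le> b"
proof -
  obtain b' where b: "b = enat b'" using assms(2) by auto
  show ?thesis
  proof (cases a)
    case (enat a')
    have *: "E * a' \<le> (E + m) * b'" for E
      using assms(1)[of E] unfolding enat b of_nat_eq_enat by simp
    have "a' \<le> b'"
    proof (rule ccontr)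
      assume "\<not> a' \<le> b'"
      \<comment> \<open>If \<open>a' \<ge> b' + 1\<close>, the hypothesis gives
        \<open>E \<le> m b'\<close>; hence the choice \<open>E = m b' + 1\<close>.\<close>
      then have "(m * b' + 1) * Suc b' \<le> (m * b' + 1) * a'" by (intro mult_left_mono) auto
      also have "\<dots> \<le> (m * b' + 1 + m) * b'" by (rule *)
      finally show False by (simp add: algebra_simps)
    qed
    then show ?thesis using enat b by simp
  next
    case infinity
    have "of_nat 1 * a \<le> of_nat (1 + m) * b" by (rule assms(1))
    then show ?thesis unfolding infinity b of_nat_eq_enat by simp
  qed
qed

context pmod
begin

lemma prodn_Dlex:
  assumes "subspace base"
  shows "prodn r (Dlex base as X) \<subseteq> pmod.Dlex (fscale scale) (prodn r base) as X"
proof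
  interpret F: pmod "fscale scale" by (rule pmod_fscale)
  fix f assume f: "f \<in> prodn r (Dlex base as X)"
  define \<delta> where "\<delta> = (\<lambda>(i::nat) x j. if j = i then x else (0::'v))"
  have \<delta>: "\<delta> i x \<in> F.Dlex (prodn r base) as X" if x: "x \<in> Dlex base as X" for i :: nat and x
  proof -
    interpret \<delta>: pmod_hom scale "fscale scale" "\<delta> i"
      by unfold_locales (auto simp: \<delta>_def fscale_def fun_eq_iff)
    have "subspace (\<delta> i -` F.Dlex (prodn r base) as X)"
      by (rule \<delta>.subspace_vimage) (simp add: F.Dlex_def)
    moreover have "\<delta> i y \<in> F.Dlex (prodn r base) as X"
      if y: "y \<in> base \<union> {mon as \<beta> *s x | \<beta> x. \<beta> \<in> X}" for y
    proof -
      consider "y \<in> base" | \<beta> x where "y = mon as \<beta> *s x" "\<beta> \<in> X" using y by blast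
      then show ?thesis
      proof cases
        case 1
        then have "\<delta> i y \<in> prodn r base" using assms subspace_0 by (auto simp: \<delta>_def prodn_def)
        then show ?thesis using F.Dlex_base by blast
      next
        case 2
        then show ?thesis unfolding F.Dlex_def using \<delta>.hom_scale by (intro F.span_base) blast
      qed
    qed
    ultimately show ?thesis
      using x span_minimal[of "base \<union> {mon as \<beta> *s x | \<beta> x. \<beta> \<in> X}" "\<delta> i -` F.Dlex (prodn r base) as X"]
      unfolding Dlex_def by blast
  qed
  \<comment> \<open>The coordinates from \<open>r\<close> on are in general no finite sum of unit
    vectors; together they form a single element of the base.\<close>
  have "(\<lambda>j. if j < r then 0 else f j) \<in> prodn r base"
    using assms subspace_0 by (auto simp: prodn_def)
  then have "(\<lambda>j. if j < r then 0 else f j) \<in> F.Dlex (prodn r base) as X"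
    using F.Dlex_base by blast
  moreover have "(\<Sum>i<r. \<delta> i (f i)) \<in> F.Dlex (prodn r base) as X"
    using f \<delta> by (auto intro!: F.subspace_sum simp: prodn_def F.Dlex_def)
  ultimately have "(\<Sum>i<r. \<delta> i (f i)) + (\<lambda>j. if j < r then 0 else f j) \<in> F.Dlex (prodn r base) as X"
    unfolding F.Dlex_def by (intro F.span_add)
  moreover have "(\<Sum>i<r. \<delta> i (f i)) + (\<lambda>j. if j < r then 0 else f j) = f"
  proof
    fix j
    have "(\<Sum>i<r. \<delta> i (f i)) j = (\<Sum>i<r. \<delta> i (f i) j)"
      by (induction r) (auto simp: zero_fun_def)
    also have "\<dots> = (if j < r then f j else 0)"
      by (auto simp: \<delta>_def)
    finally show "((\<Sum>i<r. \<delta> i (f i)) + (\<lambda>j. if j < r then 0 else f j)) j = f j" by simp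
  qed
  ultimately show "f \<in> F.Dlex (prodn r base) as X" by simp
qed

text \<open>An Artin--Rees argument for the map \<open>g \<mapsto> (a g)\<^sub>a\<close> modulo \<open>Q\<close> together with the
  vanishing of the \<open>\<aa>\<close>-socle of the associated graded module in high degrees.\<close>

lemma colon_eventually:
  assumes acc: "acc base" and base: "subspace base"
    and Q: "subspace Q" "base \<subseteq> Q" "Q \<subseteq> K" and K: "subspace K" "K \<subseteq> Kf 0"
    and Kf: "\<And>s. subspace (Kf s)" "\<And>s. base \<subseteq> Kf s" "\<And>s. Kf s \<subseteq> K" "\<And>s. Kf (Suc s) \<subseteq> Kf s"
    and Kf_Fil: "\<And>s. Kf s \<subseteq> Dlex base as (exps (length as) s)"
    and Kf_mult: "\<And>s a x. a \<in> set as \<Longrightarrow> x \<in> Kf s \<Longrightarrow> a *s x \<in> Kf (Suc s)"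
    and reg: "\<And>g. g \<in> K \<Longrightarrow> (\<And>a. a \<in> set as \<Longrightarrow> a *s g \<in> Q) \<Longrightarrow> g \<in> Q"
  shows "\<exists>s2. \<forall>s\<ge>s2. \<forall>g\<in>K. (\<forall>a\<in>set as. a *s g \<in> ssum Q (Kf (Suc s))) \<longrightarrow> g \<in> ssum Q (Kf s)"
proof -
  interpret F: pmod "fscale scale" by (rule pmod_fscale)
  define m where "m = length as"
  have anti: "Kf t \<subseteq> Kf s" if "s \<le> t" for s t
    using lift_Suc_antimono_le[of Kf, OF Kf(4) that] .
  \<comment> \<open>For \<open>x\<close> in the \<open>J s\<close> below, all products
    \<open>a x\<close> lie in \<open>Q + Kf (s + 2)\<close> by definition, and by Noetherianity such
    products generate \<open>J (Suc s)\<close> modulo the base for large \<open>s\<close>. So a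
    socle element of the associated graded module drops one step.\<close>
  have socle: "\<exists>s1. \<forall>s\<ge>s1. \<forall>g\<in>Kf s. (\<forall>a\<in>set as. a *s g \<in> ssum Q (Kf (s + 2))) \<longrightarrow> g \<in> ssum Q (Kf (Suc s))"
  proof -
    define J where "J = (\<lambda>s. {g \<in> Kf s. \<forall>a\<in>set as. a *s g \<in> ssum Q (Kf (s + 2))})"
    have ss: "subspace (ssum Q (Kf t))" for t using subspace_ssum Q Kf by blast
    have "\<exists>s0. \<forall>s\<ge>s0. J (Suc s) \<subseteq> span (base \<union> {a *s x | a x. a \<in> set as \<and> x \<in> J s})"
    proof (rule rees_noetherian[OF acc base])
      fix s
      show "subspace (J s)" unfolding J_def
        by (rule subspaceI)
          (auto simp: scale_right_distrib scale_left_commute[of _ "c::'p" for c]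
            intro: Kf(1) subspace_0 subspace_add subspace_scale ss simp del: scale_scale)
      show "base \<subseteq> J s" unfolding J_def
        using Kf(2) base Q(2) ssum_upper1[OF Kf(1)] subspace_scale by blast
      show "J s \<subseteq> Dlex base as (exps (length as) s)" using Kf_Fil unfolding J_def by blast
      fix a x assume a: "a \<in> set as" and x: "x \<in> J s"
      have "b *s (a *s x) \<in> ssum Q (Kf (Suc s + 2))" if b: "b \<in> set as" for b
      proof -
        obtain q k where qk: "b *s x = q + k" "q \<in> Q" "k \<in> Kf (s + 2)"
          using x b unfolding J_def ssum_def by blast
        have "b *s (a *s x) = a *s q + a *s k"
          using qk(1) by (metis scale_left_commute scale_right_distrib)
        then show ?thesis using qk Kf_mult[OF a qk(3)] subspace_scale[OF Q(1)] unfolding ssum_def by auto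
      qed
      then show "a *s x \<in> J (Suc s)" using x Kf_mult[OF a] unfolding J_def by auto
    qed
    then obtain s0 where s0: "\<And>s. s \<ge> s0 \<Longrightarrow> J (Suc s) \<subseteq> span (base \<union> {a *s x | a x. a \<in> set as \<and> x \<in> J s})"
      by blast
    have J_small: "J (Suc s) \<subseteq> ssum Q (Kf (s + 2))" if "s \<ge> s0" for s
    proof -
      have "span (base \<union> {a *s x | a x. a \<in> set as \<and> x \<in> J s}) \<subseteq> ssum Q (Kf (s + 2))"
        by (rule span_minimal[OF _ ss]) (use Q(2) ssum_upper1[OF Kf(1), of Q] in \<open>auto simp: J_def\<close>)
      then show ?thesis using s0[OF that] by blast
    qed
    have "g \<in> ssum Q (Kf (Suc s))"
      if "s \<ge> Suc s0" "g \<in> Kf s" "\<forall>a\<in>set as. a *s g \<in> ssum Q (Kf (s + 2))" for s g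
    proof -
      obtain t where t: "s = Suc t" "t \<ge> s0" using \<open>s \<ge> Suc s0\<close> Suc_le_D by auto
      then have "g \<in> J (Suc t)" using that unfolding J_def by simp
      then show ?thesis using J_small[OF t(2)] t(1) by auto
    qed
    then show ?thesis by blast
  qed
  then obtain s1 where s1: "\<And>s g. s \<ge> s1 \<Longrightarrow> g \<in> Kf s \<Longrightarrow> \<forall>a\<in>set as. a *s g \<in> ssum Q (Kf (s + 2)) \<Longrightarrow>
      g \<in> ssum Q (Kf (Suc s))" by blast
  \<comment> \<open>The Artin-Rees part, with a loss of a constant \<open>c\<close> in the
    filtration index, which the socle statement recovers afterwards.\<close>
  have "\<exists>c. \<forall>t. \<forall>g\<in>K. (\<forall>a\<in>set as. a *s g \<in> ssum Q (Kf (c + t))) \<longrightarrow> g \<in> ssum Q (Kf t)"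
  proof -
    \<comment> \<open>Tuples of elements of \<open>Kf s\<close> that are congruent modulo
      \<open>Q\<close> to the image of some \<open>g\<close> in \<open>K\<close> under
      multiplication by all generators; for \<open>U\<close> the element \<open>g\<close> itself
      comes from \<open>Kf t\<close>. Finite generation moves powers of the ideal across the map, so
      that \<open>J (c + t)\<close> lies in \<open>U t\<close>.\<close>
    define J where "J = (\<lambda>s. {G. (\<forall>i<m. G i \<in> Kf s) \<and> (\<exists>g\<in>K. \<forall>i<m. (as ! i) *s g - G i \<in> Q)})"
    define U where "U = (\<lambda>t. {G. \<exists>g\<in>Kf t. \<forall>i<m. (as ! i) *s g - G i \<in> Q})"
    have sub: "F.subspace {G. \<exists>g\<in>X. \<forall>i<m. (as ! i) *s g - G i \<in> Q}" if X: "subspace X" for X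
    proof (rule F.subspaceI)
      show "0 \<in> {G. \<exists>g\<in>X. \<forall>i<m. (as ! i) *s g - G i \<in> Q}"
        using subspace_0[OF X] subspace_0[OF Q(1)] by force
    next
      fix G H assume "G \<in> {G. \<exists>g\<in>X. \<forall>i<m. (as ! i) *s g - G i \<in> Q}" "H \<in> {G. \<exists>g\<in>X. \<forall>i<m. (as ! i) *s g - G i \<in> Q}"
      then obtain g h where gh: "g \<in> X" "h \<in> X" "\<And>i. i < m \<Longrightarrow> (as ! i) *s g - G i \<in> Q" "\<And>i. i < m \<Longrightarrow> (as ! i) *s h - H i \<in> Q"
        by blast
      have "(as ! i) *s (g + h) - (G + H) i \<in> Q" if "i < m" for i
      proof -
        have "(as ! i) *s (g + h) - (G + H) i = ((as ! i) *s g - G i) + ((as ! i) *s h - H i)"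
          by (simp add: scale_right_distrib)
        also have "\<dots> \<in> Q" by (rule subspace_add[OF Q(1) gh(3)[OF that] gh(4)[OF that]])
        finally show ?thesis .
      qed
      then show "G + H \<in> {G. \<exists>g\<in>X. \<forall>i<m. (as ! i) *s g - G i \<in> Q}"
        using subspace_add[OF X gh(1,2)] by blast
    next
      fix c G assume "G \<in> {G. \<exists>g\<in>X. \<forall>i<m. (as ! i) *s g - G i \<in> Q}"
      then obtain g where g: "g \<in> X" "\<And>i. i < m \<Longrightarrow> (as ! i) *s g - G i \<in> Q" by blast
      have "(as ! i) *s (c *s g) - fscale scale c G i \<in> Q" if "i < m" for i
      proof -
        have "(as ! i) *s (c *s g) - fscale scale c G i = c *s ((as ! i) *s g - G i)"
          by (simp add: fscale_def scale_right_diff_distrib mult.commute)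
        then show ?thesis using g(2)[OF that] subspace_scale[OF Q(1)] by simp
      qed
      then show "fscale scale c G \<in> {G. \<exists>g\<in>X. \<forall>i<m. (as ! i) *s g - G i \<in> Q}"
        using subspace_scale[OF X g(1)] by blast
    qed
    have U_base: "prodn m base \<subseteq> {G. \<exists>g\<in>X. \<forall>i<m. (as ! i) *s g - G i \<in> Q}" if X: "subspace X" for X
      using subspace_0[OF X] Q(1,2) subspace_neg[of Q] by (force simp: prodn_def)
    have mult: "fscale scale a G \<in> {G. \<exists>g\<in>Y. \<forall>i<m. (as ! i) *s g - G i \<in> Q}"
      if GX: "G \<in> {G. \<exists>g\<in>X. \<forall>i<m. (as ! i) *s g - G i \<in> Q}" and XY: "\<And>g. g \<in> X \<Longrightarrow> a *s g \<in> Y" for a G X Y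
    proof -
      obtain g where g: "g \<in> X" "\<And>i. i < m \<Longrightarrow> (as ! i) *s g - G i \<in> Q" using GX by blast
      have "(as ! i) *s (a *s g) - fscale scale a G i \<in> Q" if "i < m" for i
      proof -
        have "(as ! i) *s (a *s g) - fscale scale a G i = a *s ((as ! i) *s g - G i)"
          by (simp add: fscale_def scale_right_diff_distrib mult.commute)
        then show ?thesis using g(2)[OF that] subspace_scale[OF Q(1)] by simp
      qed
      then show ?thesis using XY[OF g(1)] by blast
    qed
    have J_eq: "J s = prodn m (Kf s) \<inter> {G. \<exists>g\<in>K. \<forall>i<m. (as ! i) *s g - G i \<in> Q}" for s
      by (auto simp: J_def prodn_def)
    have "\<exists>s0. \<forall>s\<ge>s0. J (Suc s) \<subseteq> F.span (prodn m base \<union> {fscale scale a x | a x. a \<in> set as \<and> x \<in> J s})"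
    proof (rule F.rees_noetherian[OF acc_prodn[OF acc base] subspace_prodn[OF base]])
      fix s
      show "F.subspace (J s)" unfolding J_eq
        by (intro F.subspace_inter subspace_prodn sub Kf K)
      show "prodn m base \<subseteq> J s" unfolding J_eq
        using U_base[OF K(1)] prodn_mono[OF Kf(2)] by blast
      show "J s \<subseteq> F.Dlex (prodn m base) as (exps (length as) s)"
        unfolding J_eq using prodn_Dlex[OF base, of m as "exps (length as) s"] prodn_mono[OF Kf_Fil, of m s] by blast
      fix a x assume a: "a \<in> set as" and x: "x \<in> J s"
      then have "fscale scale a x \<in> prodn m (Kf (Suc s))" unfolding J_eq
        using Kf_mult by (auto simp: prodn_def fscale_def)
      moreover have "fscale scale a x \<in> {G. \<exists>g\<in>K. \<forall>i<m. (as ! i) *s g - G i \<in> Q}"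
        by (rule mult[of x K]) (use x subspace_scale[OF K(1)] in \<open>auto simp: J_eq\<close>)
      ultimately show "fscale scale a x \<in> J (Suc s)" unfolding J_eq by blast
    qed
    then obtain c where c: "\<And>s. s \<ge> c \<Longrightarrow> J (Suc s) \<subseteq> F.span (prodn m base \<union> {fscale scale a x | a x. a \<in> set as \<and> x \<in> J s})"
      by blast
    have J_U: "J (c + t) \<subseteq> U t" for t
    proof (induction t)
      case 0
      then show ?case using K(2) unfolding J_def U_def by auto
    next
      case (Suc t)
      have "F.span (prodn m base \<union> {fscale scale a x | a x. a \<in> set as \<and> x \<in> J (c + t)}) \<subseteq> U (Suc t)"
      proof (rule F.span_minimal)
        show "F.subspace (U (Suc t))" unfolding U_def by (rule sub) (rule Kf)
        have "fscale scale a x \<in> U (Suc t)" if "a \<in> set as" "x \<in> J (c + t)" for a x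
          unfolding U_def by (rule mult[of x "Kf t"]) (use that Suc Kf_mult in \<open>auto simp: U_def\<close>)
        then show "prodn m base \<union> {fscale scale a x | a x. a \<in> set as \<and> x \<in> J (c + t)} \<subseteq> U (Suc t)"
          using U_base[OF Kf(1)] unfolding U_def by blast
      qed
      then show ?case using c[of "c + t"] by auto
    qed
    have "g \<in> ssum Q (Kf t)" if g: "g \<in> K" "\<forall>a\<in>set as. a *s g \<in> ssum Q (Kf (c + t))" for g t
    proof -
      have "\<forall>i. \<exists>k. i < m \<longrightarrow> k \<in> Kf (c + t) \<and> (as ! i) *s g - k \<in> Q"
      proof
        fix i
        show "\<exists>k. i < m \<longrightarrow> k \<in> Kf (c + t) \<and> (as ! i) *s g - k \<in> Q"
        proof (cases "i < m")
          case True
          then have "(as ! i) *s g \<in> ssum Q (Kf (c + t))" using g(2) by (simp add: m_def)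
          then obtain q k where "(as ! i) *s g = q + k" "q \<in> Q" "k \<in> Kf (c + t)" unfolding ssum_def by blast
          then show ?thesis by (intro exI[of _ k]) auto
        qed auto
      qed
      then obtain G where G: "\<And>i. i < m \<Longrightarrow> G i \<in> Kf (c + t) \<and> (as ! i) *s g - G i \<in> Q" by metis
      then have "G \<in> U t" using J_U[of t] g(1) unfolding J_def by blast
      then obtain g' where g': "g' \<in> Kf t" "\<And>i. i < m \<Longrightarrow> (as ! i) *s g' - G i \<in> Q" unfolding U_def by blast
      \<comment> \<open>\<open>g\<close> and \<open>g'\<close> have the same image modulo
        \<open>Q\<close>, so all generators send their difference into \<open>Q\<close>.\<close>
      have "g - g' \<in> Q"
      proof (rule reg)
        show "g - g' \<in> K" using g(1) g'(1) Kf(3) subspace_diff[OF K(1)] by blast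
        fix a assume "a \<in> set as"
        then obtain i where i: "i < m" "a = as ! i" by (metis in_set_conv_nth m_def)
        have "a *s (g - g') = ((as ! i) *s g - G i) - ((as ! i) *s g' - G i)"
          unfolding i(2) by (simp add: scale_right_diff_distrib)
        also have "\<dots> \<in> Q" using G[OF i(1)] g'(2)[OF i(1)] by (blast intro: subspace_diff[OF Q(1)])
        finally show "a *s (g - g') \<in> Q" .
      qed
      then have "(g - g') + g' \<in> ssum Q (Kf t)" using g'(1) by (rule ssumI)
      then show ?thesis by simp
    qed
    then show ?thesis by blast
  qed
  then obtain c where c: "\<And>t g. g \<in> K \<Longrightarrow> \<forall>a\<in>set as. a *s g \<in> ssum Q (Kf (c + t)) \<Longrightarrow> g \<in> ssum Q (Kf t)"
    by blast
  have "g \<in> ssum Q (Kf s)"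
    if s: "s \<ge> c + s1" and g: "g \<in> K" "\<forall>a\<in>set as. a *s g \<in> ssum Q (Kf (Suc s))" for s g
  proof -
    \<comment> \<open>The climb starts at level \<open>s1\<close>, reached by Artin-Rees because
      \<open>s \<ge> c + s1\<close>, and rises one level at a time by the socle statement, up to
      \<open>s\<close>.\<close>
    have raise: "g \<in> ssum Q (Kf (s1 + i))" if "s1 + i \<le> s" for i
      using that
    proof (induction i)
      case 0
      have "ssum Q (Kf (Suc s)) \<subseteq> ssum Q (Kf (c + s1))"
        by (rule ssum_mono) (use anti[of "c + s1" "Suc s"] s in auto)
      then show ?case using c[of g s1] g by auto
    next
      case (Suc i)
      then obtain q k where qk: "g = q + k" "q \<in> Q" "k \<in> Kf (s1 + i)" unfolding ssum_def by auto
      have "a *s k \<in> ssum Q (Kf (s1 + i + 2))" if a: "a \<in> set as" for a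
      proof -
        obtain q' k' where qk': "a *s g = q' + k'" "q' \<in> Q" "k' \<in> Kf (Suc s)" using g(2) a unfolding ssum_def by blast
        have "a *s k = (q' - a *s q) + k'" using qk(1) qk'(1) by (simp add: scale_right_distrib algebra_simps)
        moreover have "q' - a *s q \<in> Q" using qk(2) qk'(2) Q(1) subspace_diff subspace_scale by blast
        moreover have "k' \<in> Kf (s1 + i + 2)" using qk'(3) anti[of "s1 + i + 2" "Suc s"] Suc.prems by auto
        ultimately show ?thesis using ssumI by metis
      qed
      then have "k \<in> ssum Q (Kf (Suc (s1 + i)))" using s1[of "s1 + i" k] qk(3) by simp
      then have "q + k \<in> ssum Q (Kf (Suc (s1 + i)))"
        using qk(2) ssum_upper1[OF Kf(1)] subspace_add[OF subspace_ssum[OF Q(1) Kf(1)]] by blast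
      then show ?case using qk(1) by simp
    qed
    have "s = s1 + (s - s1)" using s by simp
    then show ?thesis using raise[of "s - s1"] by simp
  qed
  then show ?thesis by blast
qed


text \<open>Coefficient of degree \<open>k\<close> in the product of two polynomials: the generic
  element, with coefficients \<open>as\<close>, and the polynomial with coefficients
  \<open>g 0\<close>, ..., \<open>g (E - 1)\<close>. The cut at \<open>E\<close> turns the sequence
  \<open>g\<close> into a polynomial.\<close>

definition conv :: "'p list \<Rightarrow> nat \<Rightarrow> (nat \<Rightarrow> 'v) \<Rightarrow> nat \<Rightarrow> 'v"
  where "conv as E g k = (\<Sum>i<length as. if i \<le> k \<and> k - i < E then (as ! i) *s g (k - i) else 0)"

text \<open>McCoy's theorem: a polynomial is a nonzerodivisor on a module of polynomials if its
  coefficients have no common annihilator, here for a filtered module whose associated graded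
  module has no socle.\<close>

lemma mccoy:
  assumes L: "\<And>t. subspace (L t)" and L_mult: "\<And>t a x. a \<in> set as \<Longrightarrow> x \<in> L t \<Longrightarrow> a *s x \<in> L (Suc t)"
    and N: "subspace N"
    and colon: "\<And>t x. t \<ge> w \<Longrightarrow> x \<in> N \<Longrightarrow> (\<And>a. a \<in> set as \<Longrightarrow> a *s x \<in> L (Suc t)) \<Longrightarrow> x \<in> L t"
    and "s \<ge> w" "\<And>j. j < E \<Longrightarrow> g j \<in> N" "\<And>k. k < E + length as \<Longrightarrow> conv as E g k \<in> L (Suc s)"
    and "j < E"
  shows "g j \<in> L s"
  using assms(5-)
proof (induction E arbitrary: s g j)
  case (Suc E)
  define m where "m = length as"
  \<comment> \<open>Descending induction on \<open>i\<close>, inside the induction on the number of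
    coefficients of \<open>g\<close>. The outer hypothesis is used for the polynomial
    \<open>(as ! i) g\<close>, with the filtration index raised by one.\<close>
  have "\<forall>j<Suc E. (as ! i) *s g j \<in> L (Suc s)" if "i < m" for i
    using that
  proof (induction "m - i" arbitrary: i rule: less_induct)
    case (less i)
    have later: "(as ! i') *s g j \<in> L (Suc s)" if "i < i'" "i' < m" "j < Suc E" for i' j
      using less.hyps[of i'] that by auto
    \<comment> \<open>In degree \<open>i + E\<close> the indices below \<open>i\<close> would need a
      coefficient of \<open>g\<close> beyond \<open>E\<close>, and those above \<open>i\<close> are
      settled by the inner hypothesis; only \<open>(as ! i) g E\<close> remains.\<close>
    have "conv as (Suc E) g (i + E) = (as ! i) *s g E +
        (\<Sum>i'\<in>{..<m} - {i}. if i' \<le> i + E \<and> i + E - i' < Suc E then (as ! i') *s g (i + E - i') else 0)"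
      unfolding conv_def m_def[symmetric] using less.prems
      by (subst sum.remove[of _ i]) auto
    moreover have "(\<Sum>i'\<in>{..<m} - {i}. if i' \<le> i + E \<and> i + E - i' < Suc E then (as ! i') *s g (i + E - i') else 0) \<in> L (Suc s)"
    proof (rule subspace_sum[OF L])
      fix i' assume i': "i' \<in> {..<m} - {i}"
      show "(if i' \<le> i + E \<and> i + E - i' < Suc E then (as ! i') *s g (i + E - i') else 0) \<in> L (Suc s)"
        using later[of i'] i' subspace_0[OF L] by auto
    qed
    moreover have "conv as (Suc E) g (i + E) \<in> L (Suc s)"
      by (rule Suc.prems(3)) (use less.prems in \<open>simp add: m_def\<close>)
    ultimately have top: "(as ! i) *s g E \<in> L (Suc s)"
      using subspace_diff[OF L, of "conv as (Suc E) g (i + E)" "Suc s"] by force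
    have "(as ! i) *s g j \<in> L (Suc s)" if j: "j < E" for j
    proof (rule Suc.IH[where g = "\<lambda>j. (as ! i) *s g j"])
      fix k assume k: "k < E + length as"
      \<comment> \<open>The top coefficient of \<open>(as ! i) g\<close> is in
        \<open>L (Suc s)\<close>, so its products with generators are in
        \<open>L (Suc (Suc s))\<close>, and dropping it preserves the hypothesis on the
        product.\<close>
      have "conv as E (\<lambda>j. (as ! i) *s g j) k = (as ! i) *s conv as (Suc E) g k -
          (\<Sum>i'<m. if i' \<le> k \<and> k - i' = E then (as ! i') *s ((as ! i) *s g E) else 0)"
        unfolding conv_def m_def[symmetric] scale_sum_right sum_subtractf[symmetric]
        by (rule sum.cong) (auto simp: mult.commute less_Suc_eq)
      moreover have "(as ! i) *s conv as (Suc E) g k \<in> L (Suc (Suc s))"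
        using L_mult[OF _ Suc.prems(3)[of k]] k less.prems by (simp add: m_def)
      moreover have "(\<Sum>i'<m. if i' \<le> k \<and> k - i' = E then (as ! i') *s ((as ! i) *s g E) else 0) \<in> L (Suc (Suc s))"
        using L_mult[OF _ top] subspace_0[OF L]
        by (intro subspace_sum[OF L]) (auto simp: m_def simp del: scale_scale)
      ultimately show "conv as E (\<lambda>j. (as ! i) *s g j) k \<in> L (Suc (Suc s))"
        using subspace_diff[OF L] by simp
    qed (use Suc.prems(1,2) subspace_scale[OF N] j in simp_all)
    then show ?case using top by (auto simp: less_Suc_eq)
  qed
  then have "a *s g j \<in> L (Suc s)" if "a \<in> set as" for a
    using that Suc.prems(4) by (metis in_set_conv_nth m_def)
  then show ?case using colon[of s "g j"] Suc.prems by simp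
qed simp

text \<open>McCoy's theorem as an inequality of lengths: it makes multiplication by the generic
  element injective on polynomials of degree less than \<open>E\<close> over \<open>N / L s\<close>.
  The target is left open, since it is a full power in \<open>filtration_increment\<close> and a
  submodule of one in \<open>Ks_growth\<close>.\<close>

lemma conv_len:
  assumes L: "\<And>t. subspace (L t)" and L_mult: "\<And>t a x. a \<in> set as \<Longrightarrow> x \<in> L t \<Longrightarrow> a *s x \<in> L (Suc t)"
    and N: "subspace N" "L s \<subseteq> N"
    and colon: "\<And>t x. t \<ge> w \<Longrightarrow> x \<in> N \<Longrightarrow> (\<And>a. a \<in> set as \<Longrightarrow> a *s x \<in> L (Suc t)) \<Longrightarrow> x \<in> L t"
    and s: "s \<ge> w"
    and X: "Modules.module.subspace (fscale scale) X" "Modules.module.subspace (fscale scale) Y" "X \<subseteq> Y"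
      "X \<subseteq> prodn (E + length as) (L (Suc s))" "conv as E ` prodn E N \<subseteq> Y"
  shows "of_nat E * len (L s) N \<le> pmod.len (fscale scale) X Y"
proof -
  interpret F: pmod "fscale scale" by (rule pmod_fscale)
  interpret c: pmod_hom "fscale scale" "fscale scale" "conv as E"
  proof unfold_locales
    fix x y :: "nat \<Rightarrow> 'v" and c :: 'p
    show "conv as E (x + y) = conv as E x + conv as E y"
      by (auto simp: conv_def fun_eq_iff scale_right_distrib sum.distrib[symmetric] intro!: sum.cong)
    show "conv as E (fscale scale c x) = fscale scale c (conv as E x)"
      by (auto simp: conv_def fun_eq_iff fscale_def scale_sum_right mult.commute intro!: sum.cong)
  qed
  have inj: "g \<in> prodn E (L s)" if g: "g \<in> prodn E N" "conv as E g \<in> X" for g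
  proof -
    have gN: "g j \<in> N" if "j < E" for j using g(1) that by (simp add: prodn_def)
    have gL: "conv as E g k \<in> L (Suc s)" if "k < E + length as" for k
      using g(2) X(4) that by (auto simp: prodn_def)
    have "g j \<in> L s" if "j < E" for j
      by (rule mccoy[where L = L and N = N and w = w and as = as and E = E and g = g])
        (fact L L_mult N(1) colon s gN gL that)+
    then show ?thesis by (simp add: prodn_def)
  qed
  have "F.len (prodn E (L s)) (prodn E N) \<le> F.len X Y"
    by (rule c.len_hom_le[OF X(1,3,2,5) inj])
  then show ?thesis using len_prodn[OF L N, of E] by simp
qed

text \<open>The generic element in the role of the second superficial element: it maps
  \<open>N\<close> into \<open>N0\<close>, so the length of \<open>N / L s\<close> is at most that
  of the part \<open>N0 / L (Suc s)\<close> of the next quotient.\<close>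

lemma filtration_increment:
  assumes L: "\<And>t. subspace (L t)" and L_mult: "\<And>t a x. a \<in> set as \<Longrightarrow> x \<in> L t \<Longrightarrow> a *s x \<in> L (Suc t)"
    and N: "subspace N" "L s \<subseteq> N"
    and colon: "\<And>t x. t \<ge> w \<Longrightarrow> x \<in> N \<Longrightarrow> (\<And>a. a \<in> set as \<Longrightarrow> a *s x \<in> L (Suc t)) \<Longrightarrow> x \<in> L t"
    and s: "s \<ge> w"
    and N0: "subspace N0" "L (Suc s) \<subseteq> N0" "\<And>a x. a \<in> set as \<Longrightarrow> x \<in> N \<Longrightarrow> a *s x \<in> N0"
    and fin: "len (L (Suc s)) N0 \<noteq> \<infinity>"
  shows "len (L s) N \<le> len (L (Suc s)) N0"
proof (rule enat_le_of_asymptotic[OF _ fin])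
  fix E
  interpret F: pmod "fscale scale" by (rule pmod_fscale)
  have img: "conv as E ` prodn E N \<subseteq> prodn (E + length as) N0"
    using N0(3) subspace_0[OF N0(1)]
    by (auto simp: prodn_def conv_def intro!: subspace_sum[OF N0(1)])
  have sub: "F.subspace (prodn (E + length as) (L (Suc s)))" "F.subspace (prodn (E + length as) N0)"
    using subspace_prodn L N0(1) by blast+
  have "of_nat E * len (L s) N \<le> F.len (prodn (E + length as) (L (Suc s))) (prodn (E + length as) N0)"
    by (rule conv_len[where L = L and N = N and w = w and as = as and s = s])
      (fact L L_mult N colon s img sub prodn_mono[OF N0(2)] subset_refl)+
  then show "of_nat E * len (L s) N \<le> of_nat (E + length as) * len (L (Suc s)) N0"
    using len_prodn[OF L N0(1,2)] by simp
qed

end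


section \<open>Growth of the submodules with depth two\<close>

lemma mon_mult_ex:
  assumes "length \<delta> = length as" "a \<in> set as"
  shows "\<exists>\<delta>'. length \<delta>' = length as \<and> sum_list \<delta>' = Suc (sum_list \<delta>) \<and> mon as \<delta>' = a * mon as \<delta>"
  using assms
proof (induction \<delta> as rule: list_induct2)
  case (Cons k ks b as)
  show ?case
  proof (cases "a = b")
    case True
    then show ?thesis using Cons.hyps by (intro exI[of _ "Suc k # ks"]) (simp add: mult_ac)
  next
    case False
    then obtain \<delta>' where "length \<delta>' = length as" "sum_list \<delta>' = Suc (sum_list ks)" "mon as \<delta>' = a * mon as ks"
      using Cons by auto
    then show ?thesis by (intro exI[of _ "k # \<delta>'"]) (simp add: mult_ac)
  qed
qed simp

lemma mon_replicate_0: "mon as (replicate (length as) 0) = 1"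
  by (induction as) auto

section \<open>The powers of an ideal as a filtration\<close>

context pmod
begin

text \<open>For the ring itself and \<open>base = Z\<close> this is the preimage in \<open>P\<close>
  of the \<open>s\<close>-th power of the ideal of \<open>P / Z\<close> generated by
  \<open>as\<close>.\<close>

definition Fil :: "'v set \<Rightarrow> 'p list \<Rightarrow> nat \<Rightarrow> 'v set"
  where "Fil base as s = Dlex base as (exps (length as) s)"

lemma subspace_Fil: "subspace (Fil base as s)"
  by (simp add: Fil_def Dlex_def)

lemma Fil_base: "base \<subseteq> Fil base as s"
  unfolding Fil_def by (rule Dlex_base)

lemma Fil_0: "Fil base as 0 = UNIV"
proof -
  have "x \<in> Fil base as 0" for x
  proof -
    have "replicate (length as) 0 \<in> exps (length as) 0" by (simp add: exps_def sum_list_replicate)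
    then have "mon as (replicate (length as) 0) *s x \<in> Fil base as 0"
      unfolding Fil_def Dlex_def by (intro span_base) blast
    then show ?thesis by (simp add: mon_replicate_0)
  qed
  then show ?thesis by blast
qed

lemma Fil_mult:
  assumes "subspace base" "a \<in> set as" "x \<in> Fil base as s"
  shows "a *s x \<in> Fil base as (Suc s)"
  using assms(3) unfolding Fil_def Dlex_def
proof (rule span_image_scale)
  fix y assume "y \<in> base \<union> {mon as \<beta> *s x |\<beta> x. \<beta> \<in> exps (length as) s}"
  then consider "y \<in> base" | \<beta> x where "y = mon as \<beta> *s x" "\<beta> \<in> exps (length as) s" by blast
  then show "a *s y \<in> span (base \<union> {mon as \<beta> *s x |\<beta> x. \<beta> \<in> exps (length as) (Suc s)})"
  proof cases
    case 1
    then show ?thesis using assms(1) subspace_scale by (auto intro: span_base)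
  next
    case 2
    then obtain \<delta> where "\<delta> \<in> exps (length as) (Suc s)" "mon as \<delta> = a * mon as \<beta>"
      using mon_mult_ex[of \<beta> as a] assms(2) by (auto simp: exps_def)
    then show ?thesis using 2 by (intro span_base) (auto intro!: exI[of _ \<delta>])
  qed
qed simp

lemma Fil_Suc:
  assumes "subspace base"
  shows "Fil base as (Suc s) = span (base \<union> {a *s x | a x. a \<in> set as \<and> x \<in> Fil base as s})"
proof
  show "span (base \<union> {a *s x | a x. a \<in> set as \<and> x \<in> Fil base as s}) \<subseteq> Fil base as (Suc s)"
    using Fil_mult[OF assms] Fil_base by (intro span_minimal subspace_Fil) blast
  have "mon as \<beta> *s x \<in> span (base \<union> {a *s x | a x. a \<in> set as \<and> x \<in> Fil base as s})"
    if \<beta>: "\<beta> \<in> exps (length as) (Suc s)" for \<beta> x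
  proof -
    obtain a \<delta> where a: "a \<in> set as" "length \<delta> = length as" "sum_list \<beta> = Suc (sum_list \<delta>)" "mon as \<beta> = a * mon as \<delta>"
      using mon_split[of \<beta> as] \<beta> by (auto simp: exps_def)
    then have "mon as \<delta> *s x \<in> Fil base as s"
      unfolding Fil_def Dlex_def using \<beta> by (intro span_base) (auto simp: exps_def)
    then have "a *s (mon as \<delta> *s x) \<in> span (base \<union> {a *s x | a x. a \<in> set as \<and> x \<in> Fil base as s})"
      using a(1) by (intro span_base) blast
    then show ?thesis using a(4) by simp
  qed
  then show "Fil base as (Suc s) \<subseteq> span (base \<union> {a *s x | a x. a \<in> set as \<and> x \<in> Fil base as s})"
    unfolding Fil_def[of _ _ "Suc s"] Dlex_def[of _ _ "exps (length as) (Suc s)"]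
    by (intro span_minimal) (auto intro: span_base)
qed

lemma Fil_antimono_Suc:
  assumes "subspace base"
  shows "Fil base as (Suc s) \<subseteq> Fil base as s"
  unfolding Fil_Suc[OF assms] using Fil_base subspace_scale[OF subspace_Fil]
  by (intro span_minimal subspace_Fil) blast

lemma Fil_antimono: "subspace base \<Longrightarrow> s \<le> t \<Longrightarrow> Fil base as t \<subseteq> Fil base as s"
  using lift_Suc_antimono_le[of "Fil base as"] Fil_antimono_Suc by blast

end

section \<open>Vectors, sequences of vectors and vectors of polynomials\<close>

interpretation free: pmod "fscale ((*) :: 'p::comm_ring_1 \<Rightarrow> 'p \<Rightarrow> 'p)"
  by (rule ring.pmod_fscale)

interpretation free2: pmod "fscale (fscale ((*) :: 'p::comm_ring_1 \<Rightarrow> 'p \<Rightarrow> 'p))"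
  by (rule free.pmod_fscale)

text \<open>Properties known for the generators \<open>as\<close> are used for \<open>x\<close>,
  \<open>y\<close> or a member of a regular sequence; this carries them over to every element of the
  ideal.\<close>

lemma ideal_mult_mem:
  assumes "ring.subspace Z" "x \<in> ring.Fil Z as 1"
    and T: "\<And>c d. c \<in> T \<Longrightarrow> d \<in> T \<Longrightarrow> c + d \<in> T" "\<And>c d. d \<in> T \<Longrightarrow> c * d \<in> T" "Z \<subseteq> T" "set as \<subseteq> T"
  shows "x \<in> (T :: 'p::comm_ring_1 set)"
proof -
  have "0 \<in> T" using T(3) ring.subspace_0[OF assms(1)] by blast
  then have "ring.subspace T" using T(1,2) by (intro ring.subspaceI) auto
  moreover have "Z \<union> {a * x | a x. a \<in> set as \<and> x \<in> ring.Fil Z as 0} \<subseteq> T"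
    using T(2,3,4) by (auto simp: mult.commute)
  ultimately have "ring.Fil Z as (Suc 0) \<subseteq> T"
    unfolding ring.Fil_Suc[OF assms(1)] by (intro ring.span_minimal)
  then show ?thesis using assms(2) by auto
qed

definition cf :: "(nat \<Rightarrow> 'p::zero poly) \<Rightarrow> nat \<Rightarrow> nat \<Rightarrow> 'p"
  where "cf v j = (\<lambda>i. coeff (v i) j)"

definition polyset :: "(nat \<Rightarrow> 'p) set \<Rightarrow> (nat \<Rightarrow> 'p::zero poly) set"
  where "polyset N = {v. \<forall>j. cf v j \<in> N}"

text \<open>Polynomial vectors occur in two forms. As elements of a module over \<open>P[X]\<close>
  they have the chain condition and admit the colon arguments; as sequences of vectors cut at
  \<open>D\<close> they have lengths over \<open>P\<close>. \<open>toP\<close> passes from the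
  second form to the first.\<close>

definition toP :: "nat \<Rightarrow> (nat \<Rightarrow> nat \<Rightarrow> 'p) \<Rightarrow> nat \<Rightarrow> 'p::comm_ring_1 poly"
  where "toP D g = (\<lambda>i. \<Sum>j<D. monom (g j i) j)"

lemma coeff_toP: "coeff (toP D g i) j = (if j < D then g j i else 0)"
  by (simp add: toP_def coeff_sum)

lemma cf_toP: "cf (toP D g) j = (if j < D then g j else 0)"
  by (auto simp: cf_def coeff_toP)

lemma vec_poly_eqI: "(\<And>j. cf v j = cf w j) \<Longrightarrow> v = w"
  by (auto simp: cf_def fun_eq_iff poly_eq_iff)

lemma cf_add: "cf (v + w) j = cf v j + cf w j"
  by (auto simp: cf_def)

lemma cf_0: "cf 0 j = 0"
  by (auto simp: cf_def)

lemma cf_const: "cf (fscale (*) [:c:] v) j = fscale (*) c (cf v j)"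
  by (auto simp: cf_def fscale_def)

lemma sum_fun_apply: "(\<Sum>x\<in>A. f x) i = (\<Sum>x\<in>A. (f x :: 'i \<Rightarrow> 'p::comm_monoid_add) i)"
  by (induction A rule: infinite_finite_induct) auto

lemma cf_Poly: "k < E \<Longrightarrow> cf (fscale (*) (Poly as) v) k = free.conv as E (cf v) k"
proof
  fix i assume k: "k < E"
  have "cf (fscale (*) (Poly as) v) k i = (\<Sum>l\<le>k. nth_default 0 as l * coeff (v i) (k - l))"
    by (simp add: cf_def fscale_def coeff_mult)
  also have "\<dots> = (\<Sum>l<length as. if l \<le> k then as ! l * coeff (v i) (k - l) else 0)"
    by (rule sum.mono_neutral_cong) (auto simp: nth_default_def)
  also have "\<dots> = free.conv as E (cf v) k i"
    using k unfolding free.conv_def sum_fun_apply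
    by (intro sum.cong) (auto simp: fscale_def cf_def)
  finally show "cf (fscale (*) (Poly as) v) k i = free.conv as E (cf v) k i" .
qed

text \<open>With \<open>B = P / Z\<close>, the submodule \<open>K\<close> stands for the kernel of a minimal presentation
  \<open>B\<^sup>r \<rightarrow> N\<close>; the assumption \<open>K_colon\<close> says that \<open>N\<close> has positive depth.\<close>

locale depth_two_kernel =
  fixes Z :: "'p::comm_ring_1 set" and as :: "'p list" and r :: nat and K :: "(nat \<Rightarrow> 'p) set" and x y :: 'p
  assumes Z: "ring.subspace Z" and acc: "ring.acc Z"
    and K: "free.subspace K" and ZK: "prodn r Z \<subseteq> K" and K1: "K \<subseteq> prodn r (ring.Fil Z as 1)"
    and K_colon: "\<And>g. (\<And>a. a \<in> set as \<Longrightarrow> fscale (*) a g \<in> K) \<Longrightarrow> g \<in> K"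
    and x: "x \<in> ring.Fil Z as 1" and y: "y \<in> ring.Fil Z as 1"
    and x_reg: "\<And>b. x * b \<in> Z \<Longrightarrow> b \<in> Z"
    and y_reg: "\<And>b c. y * b - x * c \<in> Z \<Longrightarrow> \<exists>d. b - x * d \<in> Z"
    and fin: "\<And>s. ring.len (ring.Fil Z as s) UNIV \<noteq> \<infinity>"
begin

abbreviation "I s \<equiv> ring.Fil Z as s"

definition Ks :: "nat \<Rightarrow> (nat \<Rightarrow> 'p) set"
  where "Ks s = K \<inter> prodn r (I s)"

abbreviation "Z0 \<equiv> prodn r Z"

lemma Z0: "free.subspace Z0"
  by (rule ring.subspace_prodn[OF Z])

lemma Ks_sub: "free.subspace (Ks s)"
  unfolding Ks_def by (intro free.subspace_inter K ring.subspace_prodn ring.subspace_Fil)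

lemma Z0_Ks: "Z0 \<subseteq> Ks s"
  unfolding Ks_def using ZK prodn_mono[OF ring.Fil_base] by blast

lemma Ks_K: "Ks s \<subseteq> K"
  by (simp add: Ks_def)

lemma Ks_0: "Ks 0 = K"
  by (auto simp: Ks_def ring.Fil_0 prodn_def)

lemma Ks_1: "Ks 1 = K"
  using K1 by (auto simp: Ks_def)

lemma Ks_Suc: "Ks (Suc s) \<subseteq> Ks s"
  unfolding Ks_def using prodn_mono[OF ring.Fil_antimono_Suc[OF Z]] by blast

lemma Ks_antimono: "s \<le> t \<Longrightarrow> Ks t \<subseteq> Ks s"
  using lift_Suc_antimono_le[of Ks, OF Ks_Suc] .

lemma Ks_mult: "a \<in> set as \<Longrightarrow> g \<in> Ks s \<Longrightarrow> fscale (*) a g \<in> Ks (Suc s)"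
  unfolding Ks_def using free.subspace_scale[OF K] ring.Fil_mult[OF Z]
  by (auto simp: prodn_def fscale_def)

lemma Ks_Fil: "Ks s \<subseteq> free.Dlex Z0 as (exps (length as) s)"
  unfolding Ks_def using ring.prodn_Dlex[OF Z, of r as "exps (length as) s"] by (auto simp: ring.Fil_def)

lemma Z0_colon:
  assumes "\<And>a. a \<in> set as \<Longrightarrow> fscale (*) a g \<in> Z0"
  shows "g \<in> Z0"
proof -
  have "x \<in> {c. fscale (*) c g \<in> Z0}"
  proof (rule ideal_mult_mem[OF Z x])
    show "Z \<subseteq> {c. fscale (*) c g \<in> Z0}"
      using ring.subspace_scale[OF Z] by (auto simp: prodn_def fscale_def mult.commute)
    show "set as \<subseteq> {c. fscale (*) c g \<in> Z0}" using assms by blast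
    fix c d assume d: "d \<in> {c. fscale (*) c g \<in> Z0}"
    show "c * d \<in> {c. fscale (*) c g \<in> Z0}"
      using d free.subspace_scale[OF Z0, of "fscale (*) d g" c] by simp
    assume "c \<in> {c. fscale (*) c g \<in> Z0}"
    then show "c + d \<in> {c. fscale (*) c g \<in> Z0}"
      using d free.subspace_add[OF Z0] by (simp add: free.scale_left_distrib)
  qed
  then show ?thesis using x_reg by (auto simp: prodn_def fscale_def)
qed

text \<open>The case \<open>Q = Z0\<close> of \<open>colon_eventually\<close>. Through McCoy's
  theorem it makes the generic element act injectively from \<open>K / Ks s\<close> to
  \<open>K / Ks (Suc s)\<close> for large \<open>s\<close>.\<close>

lemma Ks_colon:
  "\<exists>s1. \<forall>s\<ge>s1. \<forall>g\<in>K. (\<forall>a\<in>set as. fscale (*) a g \<in> Ks (Suc s)) \<longrightarrow> g \<in> Ks s"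
proof -
  have "\<exists>s1. \<forall>s\<ge>s1. \<forall>g\<in>K. (\<forall>a\<in>set as. fscale (*) a g \<in> ssum Z0 (Ks (Suc s))) \<longrightarrow> g \<in> ssum Z0 (Ks s)"
    by (rule free.colon_eventually[OF ring.acc_prodn[OF acc Z] Z0 Z0 subset_refl ZK K _ Ks_sub Z0_Ks Ks_K Ks_Suc Ks_Fil])
      (use Ks_mult Z0_colon in \<open>auto simp: Ks_0\<close>)
  moreover have "ssum Z0 (Ks s) = Ks s" for s
    using free.ssum_least[OF Z0_Ks subset_refl Ks_sub] free.ssum_upper2[OF Z0] by blast
  ultimately show ?thesis by simp
qed

abbreviation "as2 \<equiv> map (\<lambda>a. [:a:]) as"

text \<open>The generic element of the maximal ideal, which replaces a superficial element.  Polynomials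
  of degree less than \<open>D\<close> then take the place of an infinite residue field.\<close>

abbreviation "\<xi> \<equiv> Poly as"

lemma polyset_sub:
  assumes N: "free.subspace N"
  shows "free.subspace (polyset N :: (nat \<Rightarrow> 'p poly) set)"
proof (rule free.subspaceI)
  show "0 \<in> polyset N" using free.subspace_0[OF N] by (simp add: polyset_def cf_0)
next
  fix v w :: "nat \<Rightarrow> 'p poly" assume "v \<in> polyset N" "w \<in> polyset N"
  then show "v + w \<in> polyset N" using free.subspace_add[OF N] by (simp add: polyset_def cf_add)
next
  fix c :: "'p poly" and v :: "nat \<Rightarrow> 'p poly" assume v: "v \<in> polyset N"
  show "fscale (*) c v \<in> polyset N"
  proof -
    have "cf (fscale (*) c v) j \<in> N" for j
    proof -
      have "cf (fscale (*) c v) j = (\<Sum>l\<le>j. fscale (*) (coeff c l) (cf v (j - l)))"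
        by (auto simp: cf_def fscale_def coeff_mult fun_eq_iff sum_fun_apply)
      then show ?thesis using v free.subspace_scale[OF N]
        by (auto simp: polyset_def intro!: free.subspace_sum[OF N])
    qed
    then show ?thesis by (simp add: polyset_def)
  qed
qed

lemma polyset_mono: "N \<subseteq> N' \<Longrightarrow> polyset N \<subseteq> polyset N'"
  by (auto simp: polyset_def)

lemma polyset_prodn: "polyset (prodn r N) = prodn r (polys N)"
  by (auto simp: polyset_def prodn_def polys_def cf_def)

lemma polys_sub: "ring.subspace (polys Z)"
  using ring.subspace_0[OF Z] ring.subspace_add[OF Z] ring.subspace_scale[OF Z]
  by (intro ring.subspaceI) (auto simp: polys_def coeff_mult intro!: ring.subspace_sum[OF Z])

abbreviation "Z2 \<equiv> polyset Z0"

lemma Z2: "free.subspace Z2"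
  by (rule polyset_sub[OF Z0])

lemma mon_as2: "mon as2 \<beta> = [:mon as \<beta>:]"
proof (induction as \<beta> rule: mon.induct)
  case (1 a as k ks)
  have "[:a:] ^ k = [:a ^ k:]" by (induction k) auto
  then show ?case using 1 by simp
qed (auto simp: one_pCons)

lemma polys_Fil: "polys (I s) \<subseteq> ring.Fil (polys Z) as2 s"
proof
  fix p assume p: "p \<in> polys (I s)"
  have const: "[:c:] \<in> ring.Fil (polys Z) as2 s" if c: "c \<in> I s" for c
  proof -
    have sub: "ring.subspace {c. [:c:] \<in> ring.Fil (polys Z) as2 s}"
    proof (rule ring.subspaceI)
      show "0 \<in> {c. [:c:] \<in> ring.Fil (polys Z) as2 s}" using ring.subspace_0[OF ring.subspace_Fil] by simp
    next
      fix c d assume "c \<in> {c. [:c:] \<in> ring.Fil (polys Z) as2 s}" "d \<in> {c. [:c:] \<in> ring.Fil (polys Z) as2 s}"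
      then show "c + d \<in> {c. [:c:] \<in> ring.Fil (polys Z) as2 s}"
        using ring.subspace_add[OF ring.subspace_Fil, of "[:c:]" _ _ _ "[:d:]"] by simp
    next
      fix c d assume "d \<in> {c. [:c:] \<in> ring.Fil (polys Z) as2 s}"
      then show "c * d \<in> {c. [:c:] \<in> ring.Fil (polys Z) as2 s}"
        using ring.subspace_scale[OF ring.subspace_Fil, of "[:d:]" _ _ _ "[:c:]"] by (simp add: mult.commute)
    qed
    have "Z \<union> {mon as \<beta> * x |\<beta> x. \<beta> \<in> exps (length as) s} \<subseteq> {c. [:c:] \<in> ring.Fil (polys Z) as2 s}"
    proof
      fix c assume "c \<in> Z \<union> {mon as \<beta> * x |\<beta> x. \<beta> \<in> exps (length as) s}"
      then consider "c \<in> Z" | \<beta> x where "c = mon as \<beta> * x" "\<beta> \<in> exps (length as) s" by blast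
      then show "c \<in> {c. [:c:] \<in> ring.Fil (polys Z) as2 s}"
      proof cases
        case 1
        then have "[:c:] \<in> polys Z" using ring.subspace_0[OF Z] by (auto simp: polys_def coeff_pCons split: nat.split)
        then show ?thesis using ring.Fil_base by blast
      next
        case 2
        have "mon as2 \<beta> * [:x:] \<in> ring.Fil (polys Z) as2 s"
          unfolding ring.Fil_def ring.Dlex_def 
          by (rule ring.span_base, rule UnI2, rule CollectI, rule exI[of _ \<beta>], rule exI[of _ "[:x:]"])
            (use 2(2) in simp)
        then show ?thesis using 2 by (simp add: mon_as2 mult.commute)
      qed
    qed
    then show ?thesis using c sub ring.span_minimal unfolding ring.Fil_def ring.Dlex_def by blast
  qed
  have "(\<Sum>j\<le>degree p. monom (coeff p j) j) \<in> ring.Fil (polys Z) as2 s"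
  proof (rule ring.subspace_sum[OF ring.subspace_Fil])
    fix j
    have "monom 1 j * [:coeff p j:] \<in> ring.Fil (polys Z) as2 s"
      using const p by (intro ring.subspace_scale[OF ring.subspace_Fil]) (auto simp: polys_def)
    then show "monom (coeff p j) j \<in> ring.Fil (polys Z) as2 s"
      by (simp add: smult_monom mult.commute[of "monom 1 j"])
  qed
  then show "p \<in> ring.Fil (polys Z) as2 s" using poly_as_sum_of_monoms[of p] by simp
qed

lemma poly_mccoy:
  assumes L: "\<And>t. free.subspace (L t)" "\<And>t. Z0 \<subseteq> L t"
    and L_mult: "\<And>t a g. a \<in> set as \<Longrightarrow> g \<in> L t \<Longrightarrow> fscale (*) a g \<in> L (Suc t)"
    and N: "free.subspace N"
    and colon: "\<And>t g. g \<in> N \<Longrightarrow> (\<And>a. a \<in> set as \<Longrightarrow> fscale (*) a g \<in> L (Suc t)) \<Longrightarrow> g \<in> L t"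
    and v: "v \<in> polyset N" "fscale (*) \<xi> v \<in> polyset (L (Suc s))"
  shows "v \<in> polyset (L s)"
proof -
  have "cf v j \<in> L s" for j
  proof -
    \<comment> \<open>\<open>E\<close> exceeds the degrees of the first \<open>r\<close>
      coordinates, so the cut in \<open>conv\<close> changes nothing there. The degrees of the other
      coordinates may be unbounded, but differences there lie in \<open>Z0\<close>.\<close>
    define E where "E = Suc j + (\<Sum>i<r. Suc (degree (v i)))"
    have small: "coeff (v i) k = 0" if "i < r" "E \<le> k" for i k
    proof (rule coeff_eq_0)
      have "Suc (degree (v i)) \<le> (\<Sum>i<r. Suc (degree (v i)))"
        using that(1) by (intro member_le_sum) auto
      then show "degree (v i) < k" using that(2) by (simp add: E_def)
    qed
    show ?thesis
    proof (rule free.mccoy[where L = L and N = N and w = 0 and as = as and E = E and g = "cf v"])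
      fix k assume k: "k < E + length as"
      have "free.conv as E (cf v) k - cf (fscale (*) \<xi> v) k \<in> Z0"
      proof -
        have "free.conv as E (cf v) k i = cf (fscale (*) \<xi> v) k i" if i: "i < r" for i
        proof -
          have "free.conv as (Suc k) (cf v) k i = free.conv as E (cf v) k i"
            unfolding free.conv_def sum_fun_apply
            by (rule sum.cong) (use small[OF i] in \<open>auto simp: fscale_def cf_def\<close>)
          then show ?thesis using cf_Poly[of k "Suc k" as v] by simp
        qed
        then show ?thesis using ring.subspace_0[OF Z] by (simp add: prodn_def)
      qed
      then have "free.conv as E (cf v) k - cf (fscale (*) \<xi> v) k \<in> L (Suc s)" using L(2) by blast
      moreover have "cf (fscale (*) \<xi> v) k \<in> L (Suc s)" using v(2) by (simp add: polyset_def)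
      ultimately have "free.conv as E (cf v) k - cf (fscale (*) \<xi> v) k + cf (fscale (*) \<xi> v) k \<in> L (Suc s)"
        by (rule free.subspace_add[OF L(1)])
      then show "free.conv as E (cf v) k \<in> L (Suc s)" by simp
    next
      show "cf v j \<in> N" for j using v(1) by (simp add: polyset_def)
      show "j < E" by (simp add: E_def)
      show "\<And>t g. g \<in> N \<Longrightarrow> (\<And>a. a \<in> set as \<Longrightarrow> fscale (*) a g \<in> L (Suc t)) \<Longrightarrow> g \<in> L t"
        by (fact colon)
    qed (fact L L_mult N le0)+
  qed
  then show ?thesis by (simp add: polyset_def)
qed

text \<open>McCoy's theorem for the constant filtration \<open>Z0\<close>: the generic element is
  regular on the free module over \<open>(P / Z)[X]\<close> because \<open>Z0_colon\<close> excludes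
  elements killed by all of \<open>as\<close>.\<close>

lemma xi_reg:
  assumes "fscale (*) \<xi> v \<in> Z2"
  shows "v \<in> Z2"
proof (rule poly_mccoy[where L = "\<lambda>_. Z0" and N = UNIV])
  show "v \<in> polyset UNIV" by (simp add: polyset_def)
next
  show "g \<in> Z0" if "\<And>a. a \<in> set as \<Longrightarrow> fscale (*) a g \<in> Z0" for g using that by (rule Z0_colon)
qed (use Z0 free.subspace_scale[OF Z0] assms in simp_all)

section \<open>The quotient of K[X] by the generic element\<close>

definition XK :: "(nat \<Rightarrow> 'p poly) set"
  where "XK = (\<lambda>v. fscale (*) \<xi> v) ` polyset K"

definition Q :: "(nat \<Rightarrow> 'p poly) set"
  where "Q = ssum XK Z2"

lemma XK_sub: "free.subspace XK"
proof -
  interpret h: pmod_hom "fscale (*)" "fscale (*)" "\<lambda>v. fscale (*) \<xi> v :: nat \<Rightarrow> 'p poly"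
    by unfold_locales (auto simp: free.scale_right_distrib mult.commute)
  show ?thesis unfolding XK_def by (rule h.subspace_image[OF polyset_sub[OF K]])
qed

lemma Q_sub: "free.subspace Q"
  unfolding Q_def by (rule free.subspace_ssum[OF XK_sub Z2])

lemma Z2_Q: "Z2 \<subseteq> Q"
  unfolding Q_def by (rule free.ssum_upper2[OF XK_sub])

lemma XK_Q: "XK \<subseteq> Q"
  unfolding Q_def by (rule free.ssum_upper1[OF Z2])

lemma Q_K: "Q \<subseteq> polyset K"
  unfolding Q_def XK_def using free.subspace_scale[OF polyset_sub[OF K]] polyset_mono[OF ZK]
  by (intro free.ssum_least polyset_sub[OF K]) auto

lemma Z2_x_reg: "fscale (*) [:x:] v \<in> Z2 \<Longrightarrow> v \<in> Z2"
  using x_reg by (simp add: polyset_def cf_const) (auto simp: prodn_def fscale_def)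

text \<open>Depth two of \<open>K\<close>, expressed by elements. Modulo \<open>Z\<close>, write
  \<open>x g = \<xi> h\<close> and \<open>y g = \<xi> h'\<close>. Cancelling \<open>\<xi>\<close>
  gives \<open>y h = x h'\<close>, so \<open>h = x k\<close> as \<open>y\<close> is regular modulo
  \<open>x\<close>, and cancelling \<open>x\<close> gives \<open>g = \<xi> k\<close>. Each
  \<open>a k\<close> has coefficients in \<open>K\<close> because \<open>a g\<close> lies in
  \<open>\<xi> K[X]\<close>, and then so has \<open>k\<close> by \<open>K_colon\<close>, the
  positive depth of \<open>N\<close>.\<close>

lemma Q_reg:
  assumes g: "g \<in> polyset K" and ag: "\<And>a. a \<in> set as \<Longrightarrow> fscale (*) [:a:] g \<in> Q"
  shows "g \<in> Q"
proof -
  have I1: "fscale (*) [:c:] g \<in> Q" if c: "c \<in> I 1" for c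
  proof -
    have "c \<in> {c. fscale (*) [:c:] g \<in> Q}"
    proof (rule ideal_mult_mem[OF Z c])
      have "fscale (*) [:z:] g \<in> Z2" if "z \<in> Z" for z
        using that ring.subspace_scale[OF Z]
        by (simp add: polyset_def cf_const) (auto simp: prodn_def fscale_def mult.commute)
      then show "Z \<subseteq> {c. fscale (*) [:c:] g \<in> Q}" using Z2_Q by blast
      show "set as \<subseteq> {c. fscale (*) [:c:] g \<in> Q}" using ag by blast
      fix c d assume d: "d \<in> {c. fscale (*) [:c:] g \<in> Q}"
      have "fscale (*) [:c * d:] g = fscale (*) [:c:] (fscale (*) [:d:] g)" by (simp add: mult.commute)
      then show "c * d \<in> {c. fscale (*) [:c:] g \<in> Q}"
        using d free.subspace_scale[OF Q_sub, of "fscale (*) [:d:] g" "[:c:]"] by (simp only: mem_Collect_eq)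
      assume "c \<in> {c. fscale (*) [:c:] g \<in> Q}"
      moreover have "fscale (*) [:c + d:] g = fscale (*) [:c:] g + fscale (*) [:d:] g"
        by (simp add: free.scale_left_distrib[symmetric])
      ultimately show "c + d \<in> {c. fscale (*) [:c:] g \<in> Q}"
        using d free.subspace_add[OF Q_sub] by simp
    qed
    then show ?thesis by simp
  qed
  obtain h b where h: "h \<in> polyset K" "b \<in> Z2" "fscale (*) [:x:] g = fscale (*) \<xi> h + b"
    using I1[OF x] unfolding Q_def XK_def ssum_def by blast
  obtain h' b' where h': "h' \<in> polyset K" "b' \<in> Z2" "fscale (*) [:y:] g = fscale (*) \<xi> h' + b'"
    using I1[OF y] unfolding Q_def XK_def ssum_def by blast
  have "fscale (*) \<xi> (fscale (*) [:x:] h' - fscale (*) [:y:] h) = fscale (*) [:y:] b - fscale (*) [:x:] b'"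
  proof
    fix i
    have 1: "[:x:] * g i = \<xi> * h i + b i" "[:y:] * g i = \<xi> * h' i + b' i"
      using h(3) h'(3) by (auto simp: fscale_def fun_eq_iff)
    have "\<xi> * ([:x:] * h' i - [:y:] * h i) = [:x:] * ([:y:] * g i - b' i) - [:y:] * ([:x:] * g i - b i)"
      unfolding 1 by (simp add: algebra_simps)
    also have "\<dots> = [:y:] * b i - [:x:] * b' i" by (simp only: algebra_simps)
    finally show "fscale (*) \<xi> (fscale (*) [:x:] h' - fscale (*) [:y:] h) i = (fscale (*) [:y:] b - fscale (*) [:x:] b') i"
      by (simp only: fscale_def fun_diff_def)
  qed
  also have "\<dots> \<in> Z2" using h(2) h'(2) by (intro free.subspace_diff[OF Z2] free.subspace_scale[OF Z2])
  finally have w: "fscale (*) [:x:] h' - fscale (*) [:y:] h \<in> Z2" by (rule xi_reg)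
  have "\<exists>d. i < r \<longrightarrow> coeff (h i) j - x * d \<in> Z" for i j
  proof (cases "i < r")
    case True
    then have "x * coeff (h' i) j - y * coeff (h i) j \<in> Z"
      using w by (auto simp: polyset_def cf_def prodn_def fscale_def)
    then have "y * coeff (h i) j - x * coeff (h' i) j \<in> Z"
      using ring.subspace_neg[OF Z] by fastforce
    then show ?thesis using y_reg by blast
  qed auto
  then obtain d where d: "\<And>i j. i < r \<Longrightarrow> coeff (h i) j - x * d i j \<in> Z" by metis
  \<comment> \<open>The quotients \<open>d i j\<close> were chosen coefficient by coefficient;
    beyond the degree of \<open>h i\<close> they are replaced by 0, so that a polynomial
    results.\<close>
  define k where "k = (\<lambda>i. \<Sum>j\<le>degree (h i). monom (d i j) j)"
  have coeff_k: "coeff (k i) j = (if j \<le> degree (h i) then d i j else 0)" for i j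
    by (simp add: k_def coeff_sum)
  have hk: "h - fscale (*) [:x:] k \<in> Z2"
  proof -
    have "coeff (h i) j - x * coeff (k i) j \<in> Z" if "i < r" for i j
      using d[OF that, of j] ring.subspace_0[OF Z] by (auto simp: coeff_k coeff_eq_0)
    then show ?thesis by (auto simp: polyset_def cf_def prodn_def fscale_def)
  qed
  have "fscale (*) [:x:] (g - fscale (*) \<xi> k) = fscale (*) \<xi> (h - fscale (*) [:x:] k) + b"
  proof
    fix i
    have 1: "[:x:] * g i = \<xi> * h i + b i" using h(3) by (auto simp: fscale_def fun_eq_iff)
    have "[:x:] * (g i - \<xi> * k i) = \<xi> * (h i - [:x:] * k i) + b i"
      unfolding right_diff_distrib 1 by (simp add: mult.left_commute)
    then show "fscale (*) [:x:] (g - fscale (*) \<xi> k) i = (fscale (*) \<xi> (h - fscale (*) [:x:] k) + b) i"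
      by (simp only: fscale_def fun_diff_def plus_fun_def)
  qed
  also have "\<dots> \<in> Z2" using hk h(2) by (intro free.subspace_add[OF Z2] free.subspace_scale[OF Z2])
  finally have gk: "g - fscale (*) \<xi> k \<in> Z2" by (rule Z2_x_reg)
  have ak: "fscale (*) [:a:] k \<in> polyset K" if a: "a \<in> set as" for a
  proof -
    obtain l b'' where l: "l \<in> polyset K" "b'' \<in> Z2" "fscale (*) [:a:] g = fscale (*) \<xi> l + b''"
      using ag[OF a] unfolding Q_def XK_def ssum_def by blast
    have "fscale (*) \<xi> (fscale (*) [:a:] k - l) = b'' - fscale (*) [:a:] (g - fscale (*) \<xi> k)"
    proof
      fix i
      have 1: "[:a:] * g i = \<xi> * l i + b'' i" using l(3) by (auto simp: fscale_def fun_eq_iff)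
      have "b'' i - [:a:] * (g i - \<xi> * k i) = \<xi> * ([:a:] * k i - l i)"
        unfolding right_diff_distrib 1 by (simp add: mult.left_commute)
      then show "fscale (*) \<xi> (fscale (*) [:a:] k - l) i = (b'' - fscale (*) [:a:] (g - fscale (*) \<xi> k)) i"
        by (simp only: fscale_def fun_diff_def)
    qed
    also have "\<dots> \<in> Z2" by (rule free.subspace_diff[OF Z2 l(2) free.subspace_scale[OF Z2 gk]])
    finally have "fscale (*) [:a:] k - l \<in> Z2" by (rule xi_reg)
    then have "fscale (*) [:a:] k - l + l \<in> polyset K"
      using l(1) polyset_mono[OF ZK] by (intro free.subspace_add[OF polyset_sub[OF K]]) auto
    then show ?thesis by simp
  qed
  have "cf k j \<in> K" for j
    by (rule K_colon) (use ak in \<open>simp add: polyset_def cf_const\<close>)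
  then have "fscale (*) \<xi> k \<in> XK" unfolding XK_def by (simp add: polyset_def)
  then have "fscale (*) \<xi> k + (g - fscale (*) \<xi> k) \<in> Q" unfolding Q_def using gk by (rule ssumI)
  then show ?thesis by simp
qed


abbreviation "K2 s \<equiv> polyset (Ks s)"

lemma K2_sub: "free.subspace (K2 s)"
  by (rule polyset_sub[OF Ks_sub])

text \<open>The eventual colon statement for \<open>K[X] / \<xi> K[X]\<close>, where
  \<open>Q_reg\<close> supplies the regularity. It lives over \<open>P[X]\<close>, so its chain
  condition comes from the basis theorem \<open>acc_polys\<close>.\<close>

lemma poly_colon:
  "\<exists>s2. \<forall>s\<ge>s2. \<forall>g\<in>polyset K. (\<forall>a\<in>set as. fscale (*) [:a:] g \<in> ssum Q (K2 (Suc s))) \<longrightarrow> g \<in> ssum Q (K2 s)"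
proof -
  have "\<exists>s2. \<forall>s\<ge>s2. \<forall>g\<in>polyset K. (\<forall>a\<in>set as2. fscale (*) a g \<in> ssum Q (K2 (Suc s))) \<longrightarrow> g \<in> ssum Q (K2 s)"
  proof (rule free.colon_eventually[OF _ Z2 Q_sub Z2_Q Q_K polyset_sub[OF K] _ K2_sub])
    show "free.acc Z2" unfolding polyset_prodn
      by (rule ring.acc_prodn[OF acc_polys[OF acc Z] polys_sub])
    show "polyset K \<subseteq> K2 0" by (simp add: Ks_0)
    fix s
    show "Z2 \<subseteq> K2 s" by (rule polyset_mono[OF Z0_Ks])
    show "K2 s \<subseteq> polyset K" by (rule polyset_mono[OF Ks_K])
    show "K2 (Suc s) \<subseteq> K2 s" by (rule polyset_mono[OF Ks_Suc])
    have "K2 s \<subseteq> polyset (prodn r (I s))" by (rule polyset_mono) (simp add: Ks_def)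
    also have "\<dots> \<subseteq> prodn r (ring.Fil (polys Z) as2 s)" unfolding polyset_prodn by (rule prodn_mono[OF polys_Fil])
    also have "\<dots> \<subseteq> free.Dlex Z2 as2 (exps (length as2) s)"
      unfolding ring.Fil_def polyset_prodn by (rule ring.prodn_Dlex[OF polys_sub])
    finally show "K2 s \<subseteq> free.Dlex Z2 as2 (exps (length as2) s)" .
  next
    fix s a and g :: "nat \<Rightarrow> 'p poly" assume "a \<in> set as2" "g \<in> K2 s"
    then show "fscale (*) a g \<in> K2 (Suc s)"
      using Ks_mult by (auto simp: polyset_def cf_const simp del: mult_pCons_left)
  next
    fix g assume g: "g \<in> polyset K" and ag: "\<And>a. a \<in> set as2 \<Longrightarrow> fscale (*) a g \<in> Q"
    have "fscale (*) [:a:] g \<in> Q" if "a \<in> set as" for a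
      by (rule ag) (use that in simp)
    then show "g \<in> Q" by (rule Q_reg[OF g])
  qed
  then show ?thesis by simp
qed

text \<open>\<open>prodn D K / LD D s\<close> is the part of degree less than \<open>D\<close> of
  \<open>K[X]\<close> modulo \<open>\<xi> K[X]\<close> and the polynomials over \<open>Ks s\<close>,
  a cokernel of multiplication by the generic element. Its length divided by \<open>D\<close> stands
  for the length of the cokernel of a superficial element.\<close>

definition LD :: "nat \<Rightarrow> nat \<Rightarrow> (nat \<Rightarrow> nat \<Rightarrow> 'p) set"
  where "LD D s = {g \<in> prodn D K. toP D g \<in> ssum Q (K2 s)}"

lemma QK2_sub: "free.subspace (ssum Q (K2 s))"
  by (rule free.subspace_ssum[OF Q_sub K2_sub])

lemma toP_add: "toP D (g + h) = toP D g + toP D h"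
  by (rule vec_poly_eqI) (simp add: cf_toP cf_add)

lemma toP_scale: "toP D (fscale (fscale (*)) c g) = fscale (*) [:c:] (toP D g)"
  by (rule vec_poly_eqI) (auto simp: cf_toP cf_const, auto simp: fscale_def)

lemma toP_polyset:
  assumes "free.subspace N"
  shows "toP D g \<in> polyset N \<longleftrightarrow> g \<in> prodn D N"
  using free.subspace_0[OF assms] by (auto simp: polyset_def cf_toP prodn_def)

lemma LD_sub: "free2.subspace (LD D s)"
proof (rule free2.subspaceI)
  have "toP D (0 :: nat \<Rightarrow> nat \<Rightarrow> 'p) = 0" by (rule vec_poly_eqI) (simp add: cf_toP cf_0)
  then show "0 \<in> LD D s" unfolding LD_def
    using free2.subspace_0[OF free.subspace_prodn[OF K]] free.subspace_0[OF QK2_sub] by simp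
next
  fix g h assume "g \<in> LD D s" "h \<in> LD D s"
  then show "g + h \<in> LD D s" unfolding LD_def
    using free2.subspace_add[OF free.subspace_prodn[OF K]] free.subspace_add[OF QK2_sub]
    by (simp add: toP_add)
next
  fix c g assume "g \<in> LD D s"
  then show "fscale (fscale (*)) c g \<in> LD D s" unfolding LD_def
    using free2.subspace_scale[OF free.subspace_prodn[OF K]] free.subspace_scale[OF QK2_sub]
    by (simp add: toP_scale)
qed

lemma LD_ND: "LD D s \<subseteq> prodn D K"
  by (simp add: LD_def)

lemma LD_mult:
  assumes a: "a \<in> set as" and g: "g \<in> LD D s"
  shows "fscale (fscale (*)) a g \<in> LD D (Suc s)"
proof -
  obtain q k where qk: "toP D g = q + k" "q \<in> Q" "k \<in> K2 s" using g unfolding LD_def ssum_def by blast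
  have "toP D (fscale (fscale (*)) a g) = fscale (*) [:a:] q + fscale (*) [:a:] k"
    unfolding toP_scale qk(1) by (rule free.scale_right_distrib)
  moreover have "fscale (*) [:a:] q \<in> Q" by (rule free.subspace_scale[OF Q_sub qk(2)])
  moreover have "fscale (*) [:a:] k \<in> K2 (Suc s)"
    using qk(3) Ks_mult[OF a] by (auto simp: polyset_def cf_const simp del: mult_pCons_left)
  ultimately have "toP D (fscale (fscale (*)) a g) \<in> ssum Q (K2 (Suc s))" by (simp add: ssumI)
  then show ?thesis
    using g free2.subspace_scale[OF free.subspace_prodn[OF K]] by (simp add: LD_def)
qed

lemma LD_Ks: "prodn D (Ks s) \<subseteq> LD D s"
proof
  fix g assume g: "g \<in> prodn D (Ks s)"
  then have "toP D g \<in> K2 s" by (simp add: toP_polyset[OF Ks_sub])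
  then show "g \<in> LD D s" unfolding LD_def
    using g prodn_mono[OF Ks_K] free.ssum_upper2[OF Q_sub] by blast
qed

lemma K_mult_Ks_2: "a \<in> set as \<Longrightarrow> g \<in> K \<Longrightarrow> fscale (*) a g \<in> Ks 2"
  using Ks_mult[of a g 1] Ks_1 by (simp add: numeral_2_eq_2)

text \<open>The relations have coefficients in the maximal ideal, so \<open>K = Ks 1\<close> and the
  generic element moves \<open>K\<close> into \<open>Ks 2\<close>. Hence the later cokernels keep
  \<open>K / Ks 2\<close> as a quotient, and this is how \<open>\<mu>\<close> enters.\<close>

lemma XK_K2: "XK \<subseteq> K2 2"
proof
  fix w assume "w \<in> XK"
  then obtain v where v: "v \<in> polyset K" "w = fscale (*) \<xi> v" unfolding XK_def by blast
  have "cf w k \<in> Ks 2" for k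
  proof -
    have "free.conv as (Suc k) (cf v) k \<in> Ks 2"
      unfolding free.conv_def using v(1) free.subspace_0[OF Ks_sub] K_mult_Ks_2
      by (intro free.subspace_sum[OF Ks_sub]) (auto simp: polyset_def)
    then show ?thesis unfolding v(2) using cf_Poly[of k "Suc k" as v] by simp
  qed
  then show "w \<in> K2 2" by (simp add: polyset_def)
qed

lemma LD_K2: "LD D (Suc (Suc s)) \<subseteq> prodn D (Ks 2)"
proof
  fix g assume g: "g \<in> LD D (Suc (Suc s))"
  have "K2 (Suc (Suc s)) \<subseteq> K2 2" by (rule polyset_mono[OF Ks_antimono]) simp
  then have "ssum Q (K2 (Suc (Suc s))) \<subseteq> K2 2"
    unfolding Q_def by (intro free.ssum_least K2_sub XK_K2 polyset_mono[OF Z0_Ks])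
  then have "toP D g \<in> K2 2" using g unfolding LD_def by blast
  then show "g \<in> prodn D (Ks 2)" by (simp add: toP_polyset[OF Ks_sub])
qed

lemma len_Ks_le: "free.len (Ks s) K \<le> of_nat r * ring.len (I s) UNIV"
proof -
  interpret id: pmod_hom "fscale (*)" "fscale (*)" "\<lambda>g :: nat \<Rightarrow> 'p. g"
    by unfold_locales auto
  have "free.len (Ks s) K \<le> free.len (prodn r (I s)) (prodn r UNIV)"
  proof (rule id.len_hom_le)
    show "free.subspace (prodn r (I s))" by (rule ring.subspace_prodn[OF ring.subspace_Fil])
    show "prodn r (I s) \<subseteq> prodn r UNIV" by (rule prodn_mono) simp
    show "free.subspace (prodn r (UNIV :: 'p set))" by (rule ring.subspace_prodn) simp
    show "(\<lambda>g. g) ` K \<subseteq> prodn r UNIV" by (auto simp: prodn_def)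
    show "g \<in> Ks s" if "g \<in> K" "g \<in> prodn r (I s)" for g using that by (simp add: Ks_def)
  qed
  also have "\<dots> = of_nat r * ring.len (I s) UNIV"
    by (rule ring.len_prodn) (auto simp: ring.subspace_Fil)
  finally show ?thesis .
qed

lemma len_Ks_fin: "free.len (Ks s) K \<noteq> \<infinity>"
  using len_Ks_le[of s] fin[of s] by (auto simp: of_nat_eq_enat dest: enat_ile)

lemma toP_conv: "toP (E + length as) (free.conv as E g) = fscale (*) \<xi> (toP E g)"
proof (rule vec_poly_eqI)
  fix k
  have "cf (fscale (*) \<xi> (toP E g)) k = free.conv as (Suc k) (cf (toP E g)) k"
    by (rule cf_Poly) simp
  also have "\<dots> = (if k < E + length as then free.conv as E g k else 0)"
    unfolding free.conv_def by (auto simp: cf_toP intro!: sum.cong sum.neutral)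
  also have "\<dots> = cf (toP (E + length as) (free.conv as E g)) k" by (simp add: cf_toP)
  finally show "cf (toP (E + length as) (free.conv as E g)) k = cf (fscale (*) \<xi> (toP E g)) k" ..
qed

text \<open>A generic element in a further variable bounds the length of one cokernel by that of the
  part of the next one coming from \<open>Ks 2\<close>; on top of this part sits a power of
  \<open>K / Ks 2\<close>. So each step adds at least \<open>D \<mu>\<close>.\<close>

lemma LD_lower:
  assumes s2: "\<And>s g. s \<ge> s2 \<Longrightarrow> g \<in> polyset K \<Longrightarrow>
      (\<And>a. a \<in> set as \<Longrightarrow> fscale (*) [:a:] g \<in> ssum Q (K2 (Suc s))) \<Longrightarrow> g \<in> ssum Q (K2 s)"
  shows "of_nat n * (of_nat D * free.len (Ks 2) K) \<le> free2.len (LD D (Suc s2 + n)) (prodn D K)"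
proof (induction n)
  case (Suc n)
  \<comment> \<open>The extra \<open>Suc\<close> makes \<open>Suc ?s\<close> at least 2, as
    \<open>LD_K2\<close> requires.\<close>
  let ?s = "Suc s2 + n"
  have ND: "free2.subspace (prodn D K)" by (rule free.subspace_prodn[OF K])
  have N0: "free2.subspace (prodn D (Ks 2))" by (rule free.subspace_prodn[OF Ks_sub])
  have LD_N0: "LD D (Suc ?s) \<subseteq> prodn D (Ks 2)" using LD_K2[of D "s2 + n"] by simp
  have "free2.len (LD D (Suc ?s)) (prodn D (Ks 2)) \<le> free2.len (prodn D (Ks (Suc ?s))) (prodn D K)"
    by (rule free2.len_mono[OF LD_Ks prodn_mono[OF Ks_K]])
  also have "\<dots> = of_nat D * free.len (Ks (Suc ?s)) K"
    by (rule free.len_prodn[OF Ks_sub K Ks_K])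
  finally have fin0: "free2.len (LD D (Suc ?s)) (prodn D (Ks 2)) \<noteq> \<infinity>"
    using len_Ks_fin[of "Suc ?s"] by (auto simp: of_nat_eq_enat dest: enat_ile)
  have "free2.len (LD D ?s) (prodn D K) \<le> free2.len (LD D (Suc ?s)) (prodn D (Ks 2))"
  proof (rule free2.filtration_increment[where L = "LD D" and as = as and w = s2])
    fix t g assume t: "s2 \<le> t" and g: "g \<in> prodn D K"
      and ag: "\<And>a. a \<in> set as \<Longrightarrow> fscale (fscale (*)) a g \<in> LD D (Suc t)"
    have "toP D g \<in> ssum Q (K2 t)"
      by (rule s2[OF t]) (use g ag in \<open>simp_all add: toP_polyset[OF K] LD_def toP_scale\<close>)
    then show "g \<in> LD D t" using g by (simp add: LD_def)
  next
    fix a g assume "a \<in> set as" "g \<in> prodn D K"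
    then show "fscale (fscale (*)) a g \<in> prodn D (Ks 2)"
      using K_mult_Ks_2 by (auto simp: prodn_def fscale_def[of "fscale (*)"])
  qed (fact LD_sub LD_mult ND LD_ND N0 LD_N0 fin0 | simp)+
  moreover have "free2.len (LD D (Suc ?s)) (prodn D K) =
      free2.len (LD D (Suc ?s)) (prodn D (Ks 2)) + free2.len (prodn D (Ks 2)) (prodn D K)"
    by (rule free2.len_add[OF LD_sub N0 ND LD_N0 prodn_mono[OF Ks_K]])
  moreover have "free2.len (prodn D (Ks 2)) (prodn D K) = of_nat D * free.len (Ks 2) K"
    by (rule free.len_prodn[OF Ks_sub K Ks_K])
  moreover have "of_nat (Suc n) * (of_nat D * free.len (Ks 2) K) =
      of_nat n * (of_nat D * free.len (Ks 2) K) + of_nat D * free.len (Ks 2) K"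
    by (simp add: distrib_right add.commute)
  ultimately show ?case using Suc.IH by (simp add: add_mono)
qed simp

text \<open>For large \<open>s\<close> the generic element embeds \<open>K / Ks s\<close> into
  \<open>K / Ks (Suc s)\<close>, up to the degree factor, and by \<open>LD_lower\<close> the
  cokernel has length at least \<open>n \<mu>\<close>. Summed over \<open>n\<close> this is
  quadratic growth with leading term \<open>\<mu> n^2 / 2\<close>.\<close>

theorem Ks_growth:
  "\<exists>s0. \<forall>n. free.len (Ks (s0 + n)) K + of_nat n * free.len (Ks 2) K \<le> free.len (Ks (Suc (s0 + n))) K"
proof -
  obtain s1 where s1: "\<And>s g. s \<ge> s1 \<Longrightarrow> g \<in> K \<Longrightarrow>
      (\<And>a. a \<in> set as \<Longrightarrow> fscale (*) a g \<in> Ks (Suc s)) \<Longrightarrow> g \<in> Ks s" using Ks_colon by blast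
  obtain s2 where s2: "\<And>s g. s \<ge> s2 \<Longrightarrow> g \<in> polyset K \<Longrightarrow>
      (\<And>a. a \<in> set as \<Longrightarrow> fscale (*) [:a:] g \<in> ssum Q (K2 (Suc s))) \<Longrightarrow> g \<in> ssum Q (K2 s)"
    using poly_colon by blast
  define s0 where "s0 = s1 + s2"
  have "free.len (Ks (s0 + n)) K + of_nat n * free.len (Ks 2) K \<le> free.len (Ks (Suc (s0 + n))) K" for n
  proof -
    let ?s = "s0 + n"
    obtain a b c where abc: "free.len (Ks ?s) K = enat a" "free.len (Ks (Suc ?s)) K = enat b" "free.len (Ks 2) K = enat c"
      using len_Ks_fin by (metis not_enat_eq)
    \<comment> \<open>Two contributions to the polynomials of degree less than
      \<open>E + length as\<close>: the image of those of degree less than \<open>E\<close>, and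
      above it the cokernel.\<close>
    have main: "E * a + n * ((E + length as) * c) \<le> (E + length as) * b" for E
    proof -
      let ?D = "E + length as"
      have ND: "free2.subspace (prodn ?D K)" by (rule free.subspace_prodn[OF K])
      have X: "free2.subspace (prodn ?D (Ks (Suc ?s)))" by (rule free.subspace_prodn[OF Ks_sub])
      have img: "free.conv as E ` prodn E K \<subseteq> LD ?D (Suc ?s)"
      proof
        fix g' assume "g' \<in> free.conv as E ` prodn E K"
        then obtain g where g: "g \<in> prodn E K" "g' = free.conv as E g" by blast
        have "g' \<in> prodn ?D K" unfolding g(2) free.conv_def
          using g(1) free.subspace_scale[OF K] free.subspace_0[OF K]
          by (auto simp: prodn_def intro!: free.subspace_sum[OF K])
        moreover have "toP ?D g' \<in> XK" unfolding g(2) toP_conv XK_def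
          using g(1) by (simp add: toP_polyset[OF K])
        moreover have "XK \<subseteq> ssum Q (K2 (Suc ?s))" using XK_Q free.ssum_upper1[OF K2_sub] by blast
        ultimately show "g' \<in> LD ?D (Suc ?s)" by (auto simp: LD_def)
      qed
      have "of_nat E * free.len (Ks ?s) K \<le> free2.len (prodn ?D (Ks (Suc ?s))) (LD ?D (Suc ?s))"
      proof (rule free.conv_len[where L = Ks and as = as and N = K and w = s1 and s = ?s and E = E])
        show "s1 \<le> ?s" by (simp add: s0_def)
      qed (fact Ks_sub Ks_mult K Ks_K s1 X LD_sub LD_Ks subset_refl img)+
      moreover have "of_nat n * (of_nat ?D * free.len (Ks 2) K) \<le> free2.len (LD ?D (Suc ?s)) (prodn ?D K)"
      proof -
        have "of_nat n * (of_nat ?D * free.len (Ks 2) K) \<le> of_nat (s1 + n) * (of_nat ?D * free.len (Ks 2) K)"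
          by (rule mult_right_mono) (auto simp: of_nat_eq_enat)
        also have "\<dots> \<le> free2.len (LD ?D (Suc s2 + (s1 + n))) (prodn ?D K)"
          by (rule LD_lower[OF s2])
        finally show ?thesis by (simp add: s0_def ac_simps)
      qed
      ultimately have "of_nat E * free.len (Ks ?s) K + of_nat n * (of_nat ?D * free.len (Ks 2) K)
          \<le> free2.len (prodn ?D (Ks (Suc ?s))) (LD ?D (Suc ?s)) + free2.len (LD ?D (Suc ?s)) (prodn ?D K)"
        by (rule add_mono)
      also have "\<dots> = free2.len (prodn ?D (Ks (Suc ?s))) (prodn ?D K)"
        by (rule free2.len_add[OF X LD_sub ND LD_Ks LD_ND, symmetric])
      also have "\<dots> = of_nat ?D * free.len (Ks (Suc ?s)) K"
        by (rule free.len_prodn[OF Ks_sub K Ks_K])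
      finally show ?thesis unfolding abc of_nat_eq_enat by simp
    qed
    \<comment> \<open>This makes the subtraction of natural numbers in \<open>b - n * c\<close>
      exact.\<close>
    have "n * c \<le> b"
      using main[of 1] by (metis (no_types, lifting) add_leE mult.left_commute mult_le_cancel1 add_is_0 zero_neq_one neq0_conv)
    have "enat a \<le> enat (b - n * c)"
    proof (rule enat_le_of_asymptotic[of _ "length as"])
      fix E
      have "E * a \<le> (E + length as) * (b - n * c)"
        using main[of E] by (simp add: diff_mult_distrib2 mult.left_commute)
      then show "of_nat E * enat a \<le> of_nat (E + length as) * enat (b - n * c)"
        by (simp add: of_nat_eq_enat)
    qed simp
    then show ?thesis unfolding abc of_nat_eq_enat using \<open>n * c \<le> b\<close> by simp
  qed
  then show ?thesis by blast
qed

end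


section \<open>Rational power series\<close>

definition mon_series :: "nat \<Rightarrow> nat list set \<Rightarrow> int fps"
  where "mon_series m \<Delta> = Abs_fps (\<lambda>s. int (card (\<Delta> \<inter> exps m s)))"

text \<open>The slices by the first exponent decrease. If they never became stationary, each would
  have an element missing from a later one, and Dickson's lemma for these elements gives a
  contradiction.\<close>

lemma order_ideal_slices_stable:
  assumes down: "\<And>\<alpha> \<beta>. \<beta> \<in> \<Delta> \<Longrightarrow> length \<beta> = Suc m \<Longrightarrow> vle \<alpha> \<beta> \<Longrightarrow> \<alpha> \<in> \<Delta>"
  shows "\<exists>k. \<forall>i\<ge>k. {\<beta>. length \<beta> = m \<and> i # \<beta> \<in> \<Delta>} = {\<beta>. length \<beta> = m \<and> k # \<beta> \<in> \<Delta>}"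
proof (rule ccontr)
  let ?S = "\<lambda>i. {\<beta>. length \<beta> = m \<and> i # \<beta> \<in> \<Delta>}"
  have anti: "?S j \<subseteq> ?S i" if "i \<le> j" for i j
  proof
    fix \<beta> assume "\<beta> \<in> ?S j"
    moreover have "vle \<beta> \<beta>" by (simp add: list.rel_refl)
    ultimately show "\<beta> \<in> ?S i" using down[of "j # \<beta>" "i # \<beta>"] that by simp
  qed
  assume "\<not> ?thesis"
  then have "\<forall>k. \<exists>i\<ge>k. ?S i \<noteq> ?S k" by blast
  have "\<exists>i \<beta>. length \<beta> = m \<and> k # \<beta> \<in> \<Delta> \<and> i # \<beta> \<notin> \<Delta>" for k
  proof -
    obtain i where "i \<ge> k" "?S i \<noteq> ?S k" using \<open>\<forall>k. \<exists>i\<ge>k. ?S i \<noteq> ?S k\<close> by blast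
    then obtain \<beta> where "\<beta> \<in> ?S k" "\<beta> \<notin> ?S i" using anti[of k i] by blast
    then show ?thesis by auto
  qed
  then obtain g \<beta> where g': "\<And>k. length (\<beta> k) = m" "\<And>k. k # \<beta> k \<in> \<Delta>" "\<And>k. g k # \<beta> k \<notin> \<Delta>" by metis
  then have g: "\<beta> k \<in> ?S k" "\<beta> k \<notin> ?S (g k)" for k by auto
  have "length (\<beta> k) = m" for k by (rule g')
  from dickson[of \<beta>, OF this] obtain f :: "nat \<Rightarrow> nat" where f: "strict_mono f" "\<forall>i j. i \<le> j \<longrightarrow> vle (\<beta> (f i)) (\<beta> (f j))"
    by blast
  \<comment> \<open>Slice \<open>j\<close> misses \<open>\<beta> (f 0)\<close>. But
    \<open>\<beta> (f j)\<close> lies in slice \<open>f j\<close>, hence in slice \<open>j\<close>,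
    and \<open>\<beta> (f 0)\<close> is below it.\<close>
  define j where "j = g (f 0)"
  have "\<beta> (f j) \<in> ?S (f j)" by (rule g(1))
  then have "\<beta> (f j) \<in> ?S j" using anti[OF seq_suble[OF f(1), of j]] by blast
  moreover have "vle (\<beta> (f 0)) (\<beta> (f j))" using f(2) by blast
  ultimately have "\<beta> (f 0) \<in> ?S j"
    using down[of "j # \<beta> (f j)" "j # \<beta> (f 0)"] list_all2_lengthD by fastforce
  then show False using g(2)[of "f 0"] unfolding j_def by blast
qed

text \<open>The series is the Hilbert series of a monomial quotient of a polynomial ring. Slicing by
  the first exponent lowers the number of variables by one.\<close>

lemma mon_series_rational:
  assumes "\<And>\<alpha> \<beta>. \<beta> \<in> \<Delta> \<Longrightarrow> length \<beta> = m \<Longrightarrow> vle \<alpha> \<beta> \<Longrightarrow> \<alpha> \<in> \<Delta>"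
  shows "\<exists>p. mon_series m \<Delta> * (1 - fps_X) ^ m = fps_of_poly p"
  using assms
proof (induction m arbitrary: \<Delta>)
  case 0
  have "exps 0 s = (if s = 0 then {[]} else {})" for s by (auto simp: exps_def)
  then have "mon_series 0 \<Delta> = fps_const (int (card (\<Delta> \<inter> {[]})))"
    by (auto simp: mon_series_def fps_eq_iff)
  then show ?case using fps_of_poly_const[of "int (card (\<Delta> \<inter> {[]}))"] by (metis mult_1_right power_0)
next
  case (Suc m)
  define S where "S = (\<lambda>i. {\<beta>. length \<beta> = m \<and> i # \<beta> \<in> \<Delta>})"
  obtain k where k: "\<And>i. i \<ge> k \<Longrightarrow> S i = S k"
    using order_ideal_slices_stable[of \<Delta> m] Suc.prems unfolding S_def by blast
  have "\<exists>p. mon_series m (S i) * (1 - fps_X) ^ m = fps_of_poly p" for i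
  proof (rule Suc.IH)
    fix \<alpha> \<beta> assume "\<beta> \<in> S i" "length \<beta> = m" "vle \<alpha> \<beta>"
    then show "\<alpha> \<in> S i" using Suc.prems[of "i # \<beta>" "i # \<alpha>"] list_all2_lengthD
      by (fastforce simp: S_def)
  qed
  then obtain p where p: "\<And>i. mon_series m (S i) * (1 - fps_X) ^ m = fps_of_poly (p i)" by metis
  have card_eq: "card (\<Delta> \<inter> exps (Suc m) s) = (\<Sum>i\<le>s. card (S i \<inter> exps m (s - i)))" for s
  proof -
    have "\<Delta> \<inter> exps (Suc m) s = (\<Union>i\<in>{..s}. (#) i ` (S i \<inter> exps m (s - i)))"
    proof (rule Set.set_eqI)
      fix \<alpha>
      show "\<alpha> \<in> \<Delta> \<inter> exps (Suc m) s \<longleftrightarrow> \<alpha> \<in> (\<Union>i\<in>{..s}. (#) i ` (S i \<inter> exps m (s - i)))"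
        by (cases \<alpha>) (auto simp: S_def exps_def image_iff)
    qed
    also have "card \<dots> = (\<Sum>i\<le>s. card ((#) i ` (S i \<inter> exps m (s - i))))"
      by (rule card_UN_disjoint) (auto simp: finite_exps)
    also have "\<dots> = (\<Sum>i\<le>s. card (S i \<inter> exps m (s - i)))"
      by (intro sum.cong card_image) (auto simp: inj_on_def)
    finally show ?thesis .
  qed
  \<comment> \<open>Multiplication by \<open>1 - fps_X\<close> telescopes the sum over the slices.
    As they are constant from \<open>k\<close> on, only finitely many differences survive.\<close>
  have series: "mon_series (Suc m) \<Delta> * (1 - fps_X) =
      mon_series m (S 0) + (\<Sum>i=1..k. fps_X ^ i * (mon_series m (S i) - mon_series m (S (i - 1))))"
  proof (rule fps_ext)
    fix s
    define c where "c = (\<lambda>i s. int (card (S i \<inter> exps m s)))"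
    have "fps_nth (mon_series (Suc m) \<Delta> * (1 - fps_X)) s = (\<Sum>i\<le>s. c i (s - i)) - (if s = 0 then 0 else (\<Sum>i\<le>s - 1. c i (s - 1 - i)))"
      by (simp add: algebra_simps mon_series_def card_eq c_def)
    also have "\<dots> = c 0 s + (\<Sum>i=1..s. c i (s - i) - c (i - 1) (s - i))"
    proof (cases s)
      case (Suc t)
      have shift: "(\<Sum>i=1..Suc t. g i) = (\<Sum>i\<le>t. g (Suc i))" for g :: "nat \<Rightarrow> int"
        by (simp only: One_nat_def sum.atLeast_Suc_atMost_Suc_shift atMost_atLeast0 comp_def)
      have "(\<Sum>i\<le>Suc t. c i (Suc t - i)) = c 0 (Suc t) + (\<Sum>i=1..Suc t. c i (Suc t - i))"
        unfolding shift by (subst sum.atMost_Suc_shift) simp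
      moreover have "(\<Sum>i\<le>t. c i (t - i)) = (\<Sum>i=1..Suc t. c (i - 1) (Suc t - i))"
        unfolding shift by simp
      ultimately show ?thesis using Suc by (simp add: sum_subtractf)
    qed (simp add: c_def)
    also have "(\<Sum>i=1..s. c i (s - i) - c (i - 1) (s - i)) =
        (\<Sum>i=1..k. if i \<le> s then c i (s - i) - c (i - 1) (s - i) else 0)"
    proof -
      have "c i (s - i) - c (i - 1) (s - i) = 0" if "i > k" for i
      proof -
        have "S i = S k" "S (i - 1) = S k" using k[of i] k[of "i - 1"] that by auto
        then show ?thesis by (simp only: c_def diff_self)
      qed
      then have "(\<Sum>i=1..s. c i (s - i) - c (i - 1) (s - i)) = (\<Sum>i\<in>{1..s} \<inter> {1..k}. c i (s - i) - c (i - 1) (s - i))"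
        by (intro sum.mono_neutral_right) auto
      also have "\<dots> = (\<Sum>i=1..k. if i \<le> s then c i (s - i) - c (i - 1) (s - i) else 0)"
      proof -
        have "{1..s} \<inter> {1..k} = {1..k} \<inter> {..s}" by auto
        then show ?thesis by (simp only: sum.inter_restrict[OF finite_atLeastAtMost] atMost_iff)
      qed
      finally show ?thesis .
    qed
    also have "c 0 s + \<dots> = fps_nth (mon_series m (S 0) + (\<Sum>i=1..k. fps_X ^ i * (mon_series m (S i) - mon_series m (S (i - 1))))) s"
      by (auto simp: fps_sum_nth fps_X_power_mult_nth mon_series_def c_def not_less intro!: sum.cong)
    finally show "fps_nth (mon_series (Suc m) \<Delta> * (1 - fps_X)) s = \<dots>" .
  qed
  have "mon_series (Suc m) \<Delta> * (1 - fps_X) ^ Suc m = (mon_series (Suc m) \<Delta> * (1 - fps_X)) * (1 - fps_X) ^ m"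
    by (simp add: mult_ac)
  also have "\<dots> = fps_of_poly (p 0) + (\<Sum>i=1..k. fps_X ^ i * (fps_of_poly (p i) - fps_of_poly (p (i - 1))))"
    unfolding series p[symmetric] distrib_right sum_distrib_right
    by (intro arg_cong2[where f = "(+)"] refl sum.cong) (simp only: left_diff_distrib right_diff_distrib mult.assoc)
  also have "\<dots> = fps_of_poly (p 0 + (\<Sum>i=1..k. monom 1 i * (p i - p (i - 1))))"
    by (simp add: fps_of_poly_add fps_of_poly_sum fps_of_poly_mult fps_of_poly_diff fps_of_poly_monom)
  finally show ?case by blast
qed

section \<open>Growth of coefficients and the order of the pole at 1\<close>

definition psum :: "(nat \<Rightarrow> int) \<Rightarrow> nat \<Rightarrow> int"
  where "psum f s = (\<Sum>t\<le>s. f t)"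

lemma psum_growth:
  assumes "a > 0" "\<And>t. t \<ge> N \<Longrightarrow> a * real t ^ k \<le> real_of_int (f t)"
  shows "\<exists>b>0. \<exists>N'. \<forall>t\<ge>N'. b * real t ^ Suc k \<le> real_of_int (psum f t)"
proof -
  define B where "B = \<bar>real_of_int (psum f N)\<bar>"
  \<comment> \<open>The terms from \<open>s / 2\<close> to \<open>s\<close> alone contribute at
    least \<open>(s / 2) a (s / 2)^k = 2 b s^(k + 1)\<close>; one half of this absorbs the initial
    sum \<open>psum f N\<close>.\<close>
  define b where "b = a / 2 ^ (k + 2)"
  have b: "b > 0" using assms(1) by (simp add: b_def)
  have "b * real s ^ Suc k \<le> real_of_int (psum f s)" if s: "s \<ge> 2 * N + 2" "b * real s \<ge> B" for s
  proof -
    let ?h = "Suc (s div 2)"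
    have hN: "N < ?h" using s by linarith
    have "psum f s = psum f N + (\<Sum>t\<in>{N<..s}. f t)"
      unfolding psum_def using s
      by (subst sum.union_disjoint[symmetric]) (auto intro!: sum.cong)
    then have eq: "real_of_int (psum f s) = real_of_int (psum f N) + (\<Sum>t\<in>{N<..s}. real_of_int (f t))" by simp
    have pos: "0 \<le> real_of_int (f t)" if "t \<ge> N" for t
      using assms(2)[OF that] assms(1) by (smt (verit) mult_nonneg_nonneg of_nat_0_le_iff zero_le_power)
    have "2 * b * real s ^ Suc k = (real s / 2) * (a * (real s / 2) ^ k)"
      by (simp add: b_def power_divide field_simps)
    also have "\<dots> \<le> real (s - s div 2) * (a * (real s / 2) ^ k)"
      using assms(1) by (intro mult_right_mono) auto
    also have "\<dots> = (\<Sum>t\<in>{?h..s}. a * (real s / 2) ^ k)" by simp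
    also have "\<dots> \<le> (\<Sum>t\<in>{?h..s}. real_of_int (f t))"
    proof (rule sum_mono)
      fix t assume t: "t \<in> {?h..s}"
      then have "real s / 2 \<le> real t" by auto
      then have "a * (real s / 2) ^ k \<le> a * real t ^ k"
        using assms(1) by (intro mult_left_mono power_mono) auto
      also have "\<dots> \<le> real_of_int (f t)" by (rule assms(2)) (use t hN in auto)
      finally show "a * (real s / 2) ^ k \<le> real_of_int (f t)" .
    qed
    also have "\<dots> \<le> (\<Sum>t\<in>{N<..s}. real_of_int (f t))"
      by (rule sum_mono2) (use hN pos in auto)
    finally have "(\<Sum>t\<in>{N<..s}. real_of_int (f t)) \<ge> 2 * b * real s ^ Suc k" .
    moreover have "b * real s ^ Suc k \<ge> B"
    proof -
      have "real s ^ 1 \<le> real s ^ Suc k" using s by (intro power_increasing) auto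
      then have "b * real s \<le> b * real s ^ Suc k" using b by (intro mult_left_mono) auto
      then show ?thesis using s by simp
    qed
    ultimately show ?thesis unfolding eq B_def by linarith
  qed
  moreover have "b * real s \<ge> B" if "s \<ge> nat \<lceil>B / b\<rceil>" for s
  proof -
    have "B / b \<le> real s" using that by linarith
    then show ?thesis using b by (simp add: field_simps)
  qed
  ultimately show ?thesis using b by (intro exI[of _ b] conjI exI[of _ "max (2 * N + 2) (nat \<lceil>B / b\<rceil>)"]) auto
qed

lemma psum_mult_one_minus_X:
  "psum (fps_nth (F * (1 - fps_X))) s = fps_nth (F :: int fps) s"
proof (induction s)
  case 0
  then show ?case by (simp add: psum_def algebra_simps)
next
  case (Suc s)
  then show ?case by (simp add: psum_def algebra_simps)
qed

lemma fps_eq_poly_iff: "(\<exists>p. F = fps_of_poly p) \<longleftrightarrow> (\<exists>N. \<forall>s\<ge>N. fps_nth F s = (0 :: int))"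
proof
  assume "\<exists>N. \<forall>s\<ge>N. fps_nth F s = 0"
  then obtain N where N: "\<And>s. s \<ge> N \<Longrightarrow> fps_nth F s = 0" by blast
  have "F = fps_of_poly (\<Sum>i<N. monom (fps_nth F i) i)"
    by (rule fps_ext) (use N in \<open>auto simp: coeff_sum\<close>)
  then show "\<exists>p. F = fps_of_poly p" by blast
next
  assume "\<exists>p. F = fps_of_poly p"
  then show "\<exists>N. \<forall>s\<ge>N. fps_nth F s = 0" by (metis Suc_le_eq coeff_eq_0 fps_of_poly_nth)
qed

text \<open>If \<open>(1 - fps_X)^j\<close> did not clear the denominator, the coefficients of
  \<open>F (1 - fps_X)^j\<close> would end in a nonzero constant. Summing \<open>j + 1\<close> times
  then makes the partial sums of \<open>F\<close> grow like \<open>s^(j + 1)\<close>, at least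
  cubically, against the quadratic bound.\<close>

lemma fps_descent:
  fixes F :: "int fps"
  assumes bound: "\<And>s. \<bar>psum (fps_nth F) s\<bar> \<le> C * (int s + 1) ^ 2"
    and "j \<ge> 2" "\<exists>p. F * (1 - fps_X) ^ Suc j = fps_of_poly p"
  shows "\<exists>p. F * (1 - fps_X) ^ j = fps_of_poly p"
proof -
  define v where "v = (\<lambda>i. fps_nth (F * (1 - fps_X) ^ i))"
  have psum_v: "psum (v (Suc i)) = v i" for i
    unfolding v_def using psum_mult_one_minus_X[of "F * (1 - fps_X) ^ i"]
    by (auto simp: mult.assoc mult.commute[of "(1 - fps_X) ^ i"])
  obtain N where N: "\<And>s. s \<ge> N \<Longrightarrow> v (Suc j) s = 0"
    using assms(3) unfolding fps_eq_poly_iff v_def by blast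
  define c where "c = v j N"
  have const: "v j s = c" if "s \<ge> N" for s
    using that
  proof (induction s rule: dec_induct)
    case (step s)
    have "v j (Suc s) = v j s + v (Suc j) (Suc s)"
      unfolding psum_v[of j, symmetric] by (simp add: psum_def)
    then show ?case using step N by simp
  qed (simp add: c_def)
  \<comment> \<open>\<open>\<epsilon>\<close> is the sign of \<open>c\<close>; with it the growth
    can be stated as a lower bound in both cases.\<close>
  have no: False
    if \<epsilon>: "\<epsilon> = 1 \<or> \<epsilon> = (-1::int)" and c: "\<epsilon> * c > 0" for \<epsilon>
  proof -
    have psum_eps: "psum (\<lambda>t. \<epsilon> * f t) s = \<epsilon> * psum f s" for f s by (simp add: psum_def sum_distrib_left)
    have lower: "\<exists>a>0. \<exists>N. \<forall>t\<ge>N. a * real t ^ i \<le> real_of_int (\<epsilon> * v (j - i) t)" if "i \<le> j" for i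
      using that
    proof (induction i)
      case 0
      have "real_of_int (\<epsilon> * c) \<ge> 1" using c by linarith
      then show ?case using const by (intro exI[of _ 1] conjI exI[of _ N]) auto
    next
      case (Suc i)
      then obtain a N where "a > 0" "\<And>t. t \<ge> N \<Longrightarrow> a * real t ^ i \<le> real_of_int (\<epsilon> * v (j - i) t)" by auto
      from psum_growth[OF this] have "\<exists>b>0. \<exists>N'. \<forall>t\<ge>N'. b * real t ^ Suc i \<le> real_of_int (psum (\<lambda>t. \<epsilon> * v (j - i) t) t)" .
      moreover have "j - i = Suc (j - Suc i)" using Suc.prems by simp
      ultimately show ?case using psum_v[of "j - Suc i"] by (simp add: psum_eps)
    qed
    obtain a N where "a > 0" "\<And>t. t \<ge> N \<Longrightarrow> a * real t ^ j \<le> real_of_int (\<epsilon> * v 0 t)"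
      using lower[of j] by auto
    from psum_growth[OF this] have "\<exists>b>0. \<exists>N'. \<forall>t\<ge>N'. b * real t ^ Suc j \<le> real_of_int (psum (\<lambda>t. \<epsilon> * v 0 t) t)" .
    then obtain b N' where b: "b > 0" "\<And>t. t \<ge> N' \<Longrightarrow> b * real t ^ Suc j \<le> real_of_int (\<epsilon> * psum (v 0) t)"
      unfolding psum_eps by blast
    have "v 0 = fps_nth F" by (simp add: v_def)
    define t where "t = max (max N' 1) (nat \<lceil>(4 * \<bar>real_of_int C\<bar> + 1) / b\<rceil>)"
    have t: "t \<ge> N'" "t \<ge> 1" "real t \<ge> (4 * \<bar>real_of_int C\<bar> + 1) / b" unfolding t_def by linarith+
    have "b * real t ^ 3 \<le> b * real t ^ Suc j"
      using b(1) t(2) assms(2) by (intro mult_left_mono power_increasing) auto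
    also have "\<dots> \<le> real_of_int (\<epsilon> * psum (v 0) t)" by (rule b(2)[OF t(1)])
    also have "\<dots> \<le> real_of_int \<bar>psum (fps_nth F) t\<bar>" using \<epsilon> \<open>v 0 = fps_nth F\<close> by auto
    also have "\<dots> \<le> real_of_int (C * (int t + 1) ^ 2)" using bound[of t] by linarith
    also have "\<dots> \<le> \<bar>real_of_int C\<bar> * (2 * real t) ^ 2"
    proof -
      have "(real t + 1) ^ 2 \<le> (2 * real t) ^ 2" using t(2) by (intro power_mono) auto
      then have "\<bar>real_of_int C\<bar> * (real t + 1) ^ 2 \<le> \<bar>real_of_int C\<bar> * (2 * real t) ^ 2"
        by (rule mult_left_mono) simp
      moreover have "real_of_int C * (real t + 1) ^ 2 \<le> \<bar>real_of_int C\<bar> * (real t + 1) ^ 2"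
        by (rule mult_right_mono) auto
      ultimately have "real_of_int C * (real t + 1) ^ 2 \<le> \<bar>real_of_int C\<bar> * (2 * real t) ^ 2" by linarith
      then show ?thesis by (simp only: of_int_mult of_int_power of_int_add of_int_of_nat_eq of_int_1)
    qed
    finally have "b * real t * real t ^ 2 \<le> 4 * \<bar>real_of_int C\<bar> * real t ^ 2"
      by (simp add: power2_eq_square power3_eq_cube mult_ac)
    then have "b * real t \<le> 4 * \<bar>real_of_int C\<bar>" using t(2) by simp
    moreover have "b * real t \<ge> 4 * \<bar>real_of_int C\<bar> + 1" using t(3) b(1) by (simp add: field_simps)
    ultimately show False by linarith
  qed
  have "c = 0"
  proof (rule ccontr)
    assume "c \<noteq> 0"
    then have "1 * c > 0 \<or> -1 * c > 0" by linarith
    then show False using no[of 1] no[of "-1"] by blast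
  qed
  then show ?thesis unfolding fps_eq_poly_iff using const unfolding v_def by blast
qed

lemma fps_pole_order_2:
  fixes F :: "int fps"
  assumes bound: "\<And>s. \<bar>psum (fps_nth F) s\<bar> \<le> C * (int s + 1) ^ 2"
    and "\<exists>p. F * (1 - fps_X) ^ m = fps_of_poly p"
  shows "\<exists>p. F * (1 - fps_X) ^ 2 = fps_of_poly p"
proof (cases "m \<ge> 2")
  case True
  then show ?thesis using assms(2)
    by (induction m rule: dec_induct) (use fps_descent[OF bound] in blast)+
next
  case False
  then have "(1 - fps_X :: int fps) ^ 2 = (1 - fps_X) ^ m * (1 - fps_X) ^ (2 - m)"
    by (simp add: power_add[symmetric])
  moreover have "1 - fps_X = fps_of_poly [:1, -1 :: int:]"
    by (rule fps_ext) (auto simp: coeff_pCons split: nat.split)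
  ultimately show ?thesis using assms(2) by (metis fps_of_poly_mult mult.assoc fps_of_poly_power)
qed

text \<open>The first differences of \<open>F\<close> are partial sums of the coefficients of
  \<open>q\<close>, which end at \<open>poly q 1\<close>. For a two-dimensional ring this reads the
  multiplicity off as the eventual slope of the Hilbert function.\<close>

lemma fps_double_pole:
  fixes F :: "int fps"
  assumes "F * (1 - fps_X) ^ 2 = fps_of_poly q"
  shows "\<exists>N. \<forall>s\<ge>N. fps_nth F (Suc s) - fps_nth F s = poly q 1"
proof -
  have q: "poly q 1 = psum (coeff q) s" if "degree q \<le> s" for s
    unfolding poly_altdef psum_def using that
    by (simp, intro sum.mono_neutral_left) (auto simp: coeff_eq_0)
  have "fps_nth F (Suc s) - fps_nth F s = psum (coeff q) (Suc s)" for s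
  proof -
    have "(F * (1 - fps_X)) * (1 - fps_X) = fps_of_poly q" using assms by (simp add: power2_eq_square mult.assoc)
    then have "psum (coeff q) (Suc s) = fps_nth (F * (1 - fps_X)) (Suc s)"
      using psum_mult_one_minus_X[of "F * (1 - fps_X)" "Suc s"] by (simp add: psum_def)
    then show ?thesis by (simp add: algebra_simps)
  qed
  then show ?thesis using q le_SucI by metis
qed


section \<open>Hilbert functions of two-dimensional local rings\<close>

definition lex_down :: "nat \<Rightarrow> nat \<Rightarrow> nat list set \<Rightarrow> bool"
  where "lex_down m s \<Sigma> \<longleftrightarrow> \<Sigma> \<subseteq> exps m s \<and> (\<forall>\<alpha>\<in>\<Sigma>. \<forall>\<beta>\<in>exps m s. lexless \<beta> \<alpha> \<longrightarrow> \<beta> \<in> \<Sigma>)"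

lemma lex_down_exps: "lex_down m s (exps m s)"
  by (auto simp: lex_down_def)

lemma lex_down_below:
  assumes "lex_down m s \<Sigma>" "\<alpha> \<in> \<Sigma>"
  shows "lex_down m s (below \<alpha>)"
proof -
  have "exps (length \<alpha>) (sum_list \<alpha>) = exps m s" using assms by (auto simp: lex_down_def exps_def)
  then show ?thesis unfolding lex_down_def below_def using lexless_trans by blast
qed

lemma lex_down_induct [consumes 1, case_names empty max]:
  assumes "lex_down m s \<Sigma>" and "P {}"
    and step: "\<And>\<Sigma> \<alpha>. lex_down m s \<Sigma> \<Longrightarrow> \<alpha> \<in> \<Sigma> \<Longrightarrow> (\<And>\<beta>. \<beta> \<in> \<Sigma> \<Longrightarrow> \<beta> \<noteq> \<alpha> \<Longrightarrow> lexless \<beta> \<alpha>) \<Longrightarrow>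
      \<Sigma> = insert \<alpha> (below \<alpha>) \<Longrightarrow> \<alpha> \<notin> below \<alpha> \<Longrightarrow> P (below \<alpha>) \<Longrightarrow> P \<Sigma>"
  shows "P \<Sigma>"
  using assms(1)
proof (induction "card \<Sigma>" arbitrary: \<Sigma>)
  case 0
  then have "\<Sigma> = {}" using finite_subset[OF _ finite_exps, of \<Sigma> m s] by (simp add: lex_down_def)
  then show ?case using assms(2) by simp
next
  case (Suc n)
  have sub: "\<Sigma> \<subseteq> exps m s" and "\<Sigma> \<noteq> {}" using Suc by (auto simp: lex_down_def)
  then obtain \<alpha> where \<alpha>: "\<alpha> \<in> \<Sigma>" "\<And>\<beta>. \<beta> \<in> \<Sigma> \<Longrightarrow> \<beta> \<noteq> \<alpha> \<Longrightarrow> lexless \<beta> \<alpha>"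
    using lexless_max by blast
  have e: "exps (length \<alpha>) (sum_list \<alpha>) = exps m s" using \<alpha>(1) sub by (auto simp: exps_def)
  have eq: "\<Sigma> - {\<alpha>} = below \<alpha>"
    unfolding below_def e using \<alpha> Suc.prems lexless_irrefl by (auto simp: lex_down_def)
  have "P (below \<alpha>)"
  proof (rule Suc.hyps(1))
    show "n = card (below \<alpha>)" using Suc.hyps(2) \<alpha>(1) by (simp add: eq[symmetric])
    show "lex_down m s (below \<alpha>)" by (rule lex_down_below[OF Suc.prems \<alpha>(1)])
  qed
  then show ?case by (intro step[OF Suc.prems \<alpha>]) (use \<alpha>(1) eq in auto)
qed

context pmod
begin

lemma len_cyclic_le:
  assumes "subspace L" "ring.subspace \<qq>" "\<And>c. c \<in> \<qq> \<Longrightarrow> c *s a \<in> L"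
    and "\<And>y. y \<in> N \<Longrightarrow> \<exists>c. y - c *s a \<in> L"
  shows "len L N \<le> ring.len \<qq> UNIV"
proof -
  interpret h: pmod_hom "(*)" scale "\<lambda>c. c *s a"
    by unfold_locales (auto simp: algebra_simps)
  show ?thesis by (rule h.len_hom_ge) (use assms in auto)
qed

end

section \<open>Lengths between consecutive powers, adjoining one monomial at a time\<close>

context
  fixes Z T :: "'p::comm_ring_1 set" and as :: "'p list"
  assumes Z: "ring.subspace Z" and T: "ring.subspace T" and ZT: "Z \<subseteq> T"
begin

lemma ssum_Dlex_sub: "ring.subspace (ssum T (ring.Dlex Z as \<Sigma>))"
  by (intro ring.subspace_ssum T) (simp add: ring.Dlex_def)

lemma ssum_Dlex_empty: "ssum T (ring.Dlex Z as {}) = T"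
proof -
  have "ring.Dlex Z as {} = Z"
    unfolding ring.Dlex_def using ring.span_subspace[OF subset_refl, of Z] Z ring.span_superset[of Z]
    by simp
  then show ?thesis using ring.ssum_absorb[OF T Z ZT] by simp
qed

lemma ssum_Dlex_max:
  assumes "lex_down (length as) s \<Sigma>" "\<alpha> \<in> \<Sigma>" "\<And>\<beta>. \<beta> \<in> \<Sigma> \<Longrightarrow> \<beta> \<noteq> \<alpha> \<Longrightarrow> lexless \<beta> \<alpha>"
    and g: "g \<in> ssum T (ring.Dlex Z as \<Sigma>)"
  shows "\<exists>c. g - c * mon as \<alpha> \<in> ssum T (ring.Dlex Z as (below \<alpha>))"
proof -
  obtain t d where td: "g = t + d" "t \<in> T" "d \<in> ring.Dlex Z as \<Sigma>" using g unfolding ssum_def by blast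
  obtain c d' where "d' \<in> ring.Dlex Z as (below \<alpha>)" "d = mon as \<alpha> * c + d'"
    using ring.Dlex_remove_max(2)[of \<Sigma> as s \<alpha> d Z] td(3) assms(1-3) unfolding lex_down_def by blast
  then have "g - c * mon as \<alpha> = t + d'" "t + d' \<in> ssum T (ring.Dlex Z as (below \<alpha>))"
    using td by (auto simp: mult.commute intro: ssumI)
  then show ?thesis by metis
qed

lemma ssum_Dlex_mono: "\<Sigma> \<subseteq> \<Sigma>' \<Longrightarrow> ssum T (ring.Dlex Z as \<Sigma>) \<subseteq> ssum T (ring.Dlex Z as \<Sigma>')"
  unfolding ring.Dlex_def by (intro ssum_mono ring.span_mono) auto

lemma mon_in_ssum_Dlex: "\<alpha> \<in> \<Sigma> \<Longrightarrow> mon as \<alpha> \<in> ssum T (ring.Dlex Z as \<Sigma>)"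
proof -
  assume "\<alpha> \<in> \<Sigma>"
  then have "mon as \<alpha> * 1 \<in> ring.Dlex Z as \<Sigma>" unfolding ring.Dlex_def by (intro ring.span_base) blast
  then show ?thesis using ring.ssum_upper2[OF T] by auto
qed

lemma T_ssum_Dlex: "T \<subseteq> ssum T (ring.Dlex Z as \<Sigma>)"
  by (rule ring.ssum_upper1) (simp add: ring.Dlex_def)

text \<open>Each adjoined monomial yields a cyclic quotient annihilated by \<open>\<qq>\<close>,
  whose length is at most that of the ring modulo \<open>\<qq>\<close>.\<close>

lemma len_Dlex_le:
  assumes \<qq>: "ring.subspace \<qq>" "\<And>c \<alpha>. c \<in> \<qq> \<Longrightarrow> \<alpha> \<in> exps (length as) s \<Longrightarrow> c * mon as \<alpha> \<in> T"
    and "lex_down (length as) s \<Sigma>"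
  shows "ring.len T (ssum T (ring.Dlex Z as \<Sigma>)) \<le> of_nat (card \<Sigma>) * ring.len \<qq> UNIV"
  using assms(3)
proof (induction rule: lex_down_induct)
  case (max \<Sigma> \<alpha>)
  let ?L = "ssum T (ring.Dlex Z as (below \<alpha>))" and ?N = "ssum T (ring.Dlex Z as \<Sigma>)"
  have "ring.len T ?N = ring.len T ?L + ring.len ?L ?N"
    by (rule ring.len_add[OF T ssum_Dlex_sub ssum_Dlex_sub T_ssum_Dlex])
      (use max(4) in \<open>auto intro!: ssum_Dlex_mono\<close>)
  also have "ring.len ?L ?N \<le> ring.len \<qq> UNIV"
  proof (rule ring.len_cyclic_le[OF ssum_Dlex_sub \<qq>(1), of "mon as \<alpha>"])
    show "c * mon as \<alpha> \<in> ?L" if "c \<in> \<qq>" for c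
      using \<qq>(2)[OF that, of \<alpha>] max(1,2) T_ssum_Dlex by (auto simp: lex_down_def)
    show "\<exists>c. y - c * mon as \<alpha> \<in> ?L" if "y \<in> ?N" for y
      using ssum_Dlex_max[OF max(1,2)] max(3) that by blast
  qed
  finally have "ring.len T ?N \<le> ring.len T ?L + ring.len \<qq> UNIV" by (simp add: add_left_mono)
  also have "\<dots> \<le> of_nat (card (below \<alpha>)) * ring.len \<qq> UNIV + ring.len \<qq> UNIV"
    by (intro add_right_mono max)
  also have "\<dots> = of_nat (card \<Sigma>) * ring.len \<qq> UNIV"
  proof -
    have "finite (below \<alpha>)" unfolding below_def using finite_exps by auto
    then have "card \<Sigma> = Suc (card (below \<alpha>))" using max(4,5) by (metis card_insert_disjoint)
    then show ?thesis by (simp add: distrib_right add.commute)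
  qed
  finally show ?case .
qed (simp add: ssum_Dlex_empty)

text \<open>With residue length 1, each adjoined monomial contributes 0 or 1, and 0 exactly if it is
  congruent modulo \<open>T\<close> to a combination of smaller monomials. Length becomes a count of
  monomials, open to the results on order ideals.\<close>

lemma len_Dlex_eq:
  assumes \<qq>: "ring.subspace \<qq>" "ring.len \<qq> UNIV = 1" "\<And>c \<alpha>. c \<in> \<qq> \<Longrightarrow> \<alpha> \<in> exps (length as) s \<Longrightarrow> c * mon as \<alpha> \<in> T"
    and "lex_down (length as) s \<Sigma>"
  shows "ring.len T (ssum T (ring.Dlex Z as \<Sigma>)) =
    of_nat (card {\<alpha> \<in> \<Sigma>. mon as \<alpha> \<notin> ssum T (ring.Dlex Z as (below \<alpha>))})"
  using assms(4)
proof (induction rule: lex_down_induct)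
  case (max \<Sigma> \<alpha>)
  let ?L = "ssum T (ring.Dlex Z as (below \<alpha>))" and ?N = "ssum T (ring.Dlex Z as \<Sigma>)"
  let ?S = "\<lambda>\<Sigma>. {\<alpha> \<in> \<Sigma>. mon as \<alpha> \<notin> ssum T (ring.Dlex Z as (below \<alpha>))}"
  have LN: "?L \<subseteq> ?N" using max(4) by (auto intro!: ssum_Dlex_mono)
  have "ring.len T ?N = ring.len T ?L + ring.len ?L ?N"
    by (rule ring.len_add[OF T ssum_Dlex_sub ssum_Dlex_sub T_ssum_Dlex LN])
  moreover have "ring.len ?L ?N = (if mon as \<alpha> \<in> ?L then 0 else 1)"
  proof (cases "mon as \<alpha> \<in> ?L")
    case True
    have "?N \<subseteq> ?L"
    proof
      fix g assume "g \<in> ?N"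
      then obtain c where "g - c * mon as \<alpha> \<in> ?L" using ssum_Dlex_max[OF max(1,2)] max(3) by blast
      then have "g - c * mon as \<alpha> + c * mon as \<alpha> \<in> ?L"
        using True by (intro ring.subspace_add[OF ssum_Dlex_sub] ring.subspace_scale[OF ssum_Dlex_sub])
      then show "g \<in> ?L" by simp
    qed
    then have "?L = ?N" using LN by blast
    then show ?thesis using True by simp
  next
    case False
    have "ring.len ?L ?N \<le> ring.len \<qq> UNIV"
    proof (rule ring.len_cyclic_le[OF ssum_Dlex_sub \<qq>(1), of "mon as \<alpha>"])
      show "c * mon as \<alpha> \<in> ?L" if "c \<in> \<qq>" for c
        using \<qq>(3)[OF that, of \<alpha>] max(1,2) T_ssum_Dlex by (auto simp: lex_down_def)
      show "\<exists>c. y - c * mon as \<alpha> \<in> ?L" if "y \<in> ?N" for y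
        using ssum_Dlex_max[OF max(1,2)] max(3) that by blast
    qed
    moreover have "1 \<le> ring.len ?L ?N"
      by (rule ring.len_ge_1[OF ssum_Dlex_sub ssum_Dlex_sub]) (use LN False mon_in_ssum_Dlex[OF max(2)] in blast)
    ultimately show ?thesis using \<qq>(2) False by simp
  qed
  moreover have "card (?S \<Sigma>) = (if mon as \<alpha> \<in> ?L then card (?S (below \<alpha>)) else Suc (card (?S (below \<alpha>))))"
  proof -
    have "finite (?S (below \<alpha>))" unfolding below_def using finite_exps by auto
    moreover have "?S \<Sigma> = (if mon as \<alpha> \<in> ?L then ?S (below \<alpha>) else insert \<alpha> (?S (below \<alpha>)))"
      by (subst max(4)) auto
    ultimately show ?thesis using max(5) by simp
  qed
  ultimately show ?case using max(6) by (simp add: add.commute)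
qed (simp add: ssum_Dlex_empty)

end

text \<open>The growth forces at least \<open>\<mu> n^2 / 2\<close>, the upper bound allows about
  \<open>r e n^2 / 2\<close>; everything is doubled to stay in the integers, and the lower-order
  terms are beaten by one large \<open>n\<close>.\<close>

lemma quadratic_comparison:
  fixes k h :: "nat \<Rightarrow> nat" and e :: int
  assumes growth: "\<And>n. k (s0 + n) + n * \<mu> \<le> k (Suc (s0 + n))"
    and upper: "\<And>s. k s \<le> r * (\<Sum>t<s. h t)"
    and linear: "\<And>s. s \<ge> N \<Longrightarrow> int (h (Suc s)) - int (h s) = e"
  shows "int \<mu> \<le> int r * e"
proof (rule ccontr)
  assume "\<not> ?thesis"
  then have \<mu>: "int r * e + 1 \<le> int \<mu>" by simp
  have low: "int \<mu> * (int n * (int n - 1)) \<le> 2 * int (k (s0 + n))" for n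
  proof (induction n)
    case (Suc n)
    have "int (k (s0 + n)) + int n * int \<mu> \<le> int (k (s0 + Suc n))"
      using growth[of n] by (metis add_Suc_right of_nat_add of_nat_mono of_nat_mult)
    moreover have "int \<mu> * (int (Suc n) * (int (Suc n) - 1)) = int \<mu> * (int n * (int n - 1)) + 2 * (int n * int \<mu>)"
      by (simp add: algebra_simps)
    ultimately show ?case using Suc by linarith
  qed simp
  \<comment> \<open>\<open>h t - e t\<close> is constant from \<open>N\<close> on, so the sum of its
    absolute values up to \<open>N\<close> bounds it everywhere.\<close>
  define c where "c = (\<Sum>t\<le>N. \<bar>int (h t) - e * int t\<bar>)"
  have c: "int (h t) \<le> e * int t + c" for t
  proof (cases "t \<le> N")
    case True
    then have "\<bar>int (h t) - e * int t\<bar> \<le> c" unfolding c_def by (intro member_le_sum) auto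
    then show ?thesis by linarith
  next
    case False
    then have "N \<le> t" by simp
    then have "int (h t) - e * int t = int (h N) - e * int N"
    proof (induction t rule: dec_induct)
      case (step t)
      then show ?case using linear[of t] by (simp add: algebra_simps)
    qed simp
    moreover have "\<bar>int (h N) - e * int N\<bar> \<le> c" unfolding c_def by (intro member_le_sum) auto
    ultimately show ?thesis by linarith
  qed
  have up: "2 * int (\<Sum>t<s. h t) \<le> e * (int s * (int s - 1)) + 2 * c * int s" for s
  proof (induction s)
    case (Suc s)
    have "e * (int (Suc s) * (int (Suc s) - 1)) + 2 * c * int (Suc s) =
        e * (int s * (int s - 1)) + 2 * c * int s + 2 * (e * int s + c)"
      by (simp add: algebra_simps)
    moreover have "2 * int (\<Sum>t<Suc s. h t) \<le> e * (int s * (int s - 1)) + 2 * c * int s + 2 * (e * int s + c)"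
      using Suc c[of s] by simp
    ultimately show ?case by (simp only:)
  qed simp
  have c0: "c \<ge> 0" unfolding c_def by (intro sum_nonneg) auto
  define R where "R = int r * e"
  \<comment> \<open>\<open>A (n + 1)\<close> dominates the lower-order terms once
    \<open>\<mu> \<ge> r e + 1\<close> leaves \<open>n (n - 1)\<close> on the left. For
    \<open>n = A + 2\<close> the resulting inequality would read
    \<open>A^2 + 3 A + 2 \<le> A^2 + 3 A\<close>.\<close>
  define A where "A = \<bar>R\<bar> * (2 * int s0 + int s0 * int s0 + int s0) + 2 * int r * c * (int s0 + 1)"
  have A0: "A \<ge> 0" unfolding A_def using c0 by simp
  define n where "n = nat (A + 2)"
  have n: "int n = A + 2" using A0 by (simp add: n_def)
  let ?s = "int s0 + int n"
  have "(R + 1) * (int n * (int n - 1)) \<le> int \<mu> * (int n * (int n - 1))"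
    using \<mu> n A0 by (intro mult_right_mono) (auto simp: R_def)
  also have "\<dots> \<le> 2 * int (k (s0 + n))" by (rule low)
  also have "\<dots> \<le> 2 * int (r * (\<Sum>t<s0 + n. h t))" using upper[of "s0 + n"] by linarith
  also have "\<dots> = int r * (2 * int (\<Sum>t<s0 + n. h t))" by simp
  also have "\<dots> \<le> int r * (e * (?s * (?s - 1)) + 2 * c * ?s)"
    using up[of "s0 + n"] by (intro mult_left_mono) auto
  also have "\<dots> = R * (?s * (?s - 1)) + 2 * int r * c * ?s" by (simp add: R_def algebra_simps)
  finally have "int n * (int n - 1) \<le> R * (2 * int s0 * int n + int s0 * int s0 - int s0) + 2 * int r * c * ?s"
    by (simp add: algebra_simps)
  also have "\<dots> \<le> \<bar>R\<bar> * ((2 * int s0 + int s0 * int s0 + int s0) * (int n + 1)) + 2 * int r * c * ((int s0 + 1) * (int n + 1))"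
  proof (rule add_mono)
    have "R * (2 * int s0 * int n + int s0 * int s0 - int s0) \<le> \<bar>R\<bar> * \<bar>2 * int s0 * int n + int s0 * int s0 - int s0\<bar>"
      by (metis abs_ge_self abs_mult)
    also have "\<dots> \<le> \<bar>R\<bar> * ((2 * int s0 + int s0 * int s0 + int s0) * (int n + 1))"
    proof (rule mult_left_mono)
      have "\<bar>2 * int s0 * int n + int s0 * int s0 - int s0\<bar> \<le> 2 * int s0 * int n + int s0 * int s0 + int s0"
        by (intro abs_leI) (auto simp: algebra_simps)
      also have "\<dots> \<le> (2 * int s0 + int s0 * int s0 + int s0) * (int n + 1)"
        by (simp add: algebra_simps)
      finally show "\<bar>2 * int s0 * int n + int s0 * int s0 - int s0\<bar> \<le> (2 * int s0 + int s0 * int s0 + int s0) * (int n + 1)" .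
    qed simp
    finally show "R * (2 * int s0 * int n + int s0 * int s0 - int s0) \<le> \<bar>R\<bar> * ((2 * int s0 + int s0 * int s0 + int s0) * (int n + 1))" .
    show "2 * int r * c * ?s \<le> 2 * int r * c * ((int s0 + 1) * (int n + 1))"
      using c0 by (intro mult_left_mono) (auto simp: algebra_simps)
  qed
  also have "\<dots> = A * (int n + 1)" by (simp add: A_def algebra_simps)
  finally show False unfolding n by (simp add: algebra_simps)
qed


text \<open>A Noetherian local ring \<open>P / Z\<close> with maximal ideal generated by
  \<open>as\<close> and a regular sequence \<open>x\<close>, \<open>y\<close>. The inclusion
  \<open>param\<close> makes \<open>x\<close>, \<open>y\<close> generate a primary ideal, which
  turns dimension two into a statement about lengths.\<close>

locale local_data =
  fixes Z :: "'p::comm_ring_1 set" and as :: "'p list" and x y :: 'p and k :: nat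
  assumes Z: "ring.subspace Z" and acc: "ring.acc Z"
    and one: "1 \<notin> ring.Fil Z as 1"
    and unit: "\<And>u. u \<notin> ring.Fil Z as 1 \<Longrightarrow> \<exists>v. u * v - 1 \<in> Z"
    and x: "x \<in> ring.Fil Z as 1" and y: "y \<in> ring.Fil Z as 1"
    and x_reg: "\<And>b. x * b \<in> Z \<Longrightarrow> b \<in> Z"
    and y_reg: "\<And>b c. y * b - x * c \<in> Z \<Longrightarrow> \<exists>d. b - x * d \<in> Z"
    and param: "ring.Fil Z as k \<subseteq> ring.Fil Z [x, y] 1"
begin

abbreviation "I s \<equiv> ring.Fil Z as s"

lemma I_sub: "ring.subspace (I s)"
  by (rule ring.subspace_Fil)

lemma I_1_mult: "c \<in> I 1 \<Longrightarrow> b \<in> I s \<Longrightarrow> c * b \<in> I (Suc s)"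
proof -
  assume c: "c \<in> I 1" and b: "b \<in> I s"
  have "c \<in> {c. c * b \<in> I (Suc s)}"
  proof (rule ideal_mult_mem[OF Z c])
    show "Z \<subseteq> {c. c * b \<in> I (Suc s)}"
      using ring.subspace_scale[OF Z] ring.Fil_base by (fastforce simp: mult.commute)
    show "set as \<subseteq> {c. c * b \<in> I (Suc s)}" using ring.Fil_mult[OF Z] b by blast
  qed (use ring.subspace_add[OF I_sub] ring.subspace_scale[OF I_sub] in \<open>auto simp: distrib_right mult.assoc\<close>)
  then show ?thesis by simp
qed

lemma mon_in_I: "\<alpha> \<in> exps (length as) s \<Longrightarrow> mon as \<alpha> \<in> I s"
proof -
  assume "\<alpha> \<in> exps (length as) s"
  then have "mon as \<alpha> * 1 \<in> I s" unfolding ring.Fil_def ring.Dlex_def by (intro ring.span_base) blast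
  then show ?thesis by simp
qed

lemma I_1_neq: "I 1 \<subset> UNIV"
  using one by blast

lemma len_I_1: "ring.len (I 1) UNIV = 1"
proof (rule antisym)
  show "1 \<le> ring.len (I 1) UNIV" by (rule ring.len_ge_1[OF I_sub _ I_1_neq]) simp
  show "ring.len (I 1) UNIV \<le> 1" unfolding ring.len_def
  proof (rule chain_length_leI)
    fix n and C :: "nat \<Rightarrow> 'p set"
    assume C: "\<And>i. i \<le> n \<Longrightarrow> ring.subspace (C i) \<and> I 1 \<subseteq> C i \<and> C i \<subseteq> UNIV" "\<And>i. i < n \<Longrightarrow> C i \<subset> C (Suc i)"
    have "n \<le> 1"
    proof (rule ccontr)
      assume "\<not> n \<le> 1"
      then have n: "1 < n" "0 < n" by auto
      then obtain u where u: "u \<in> C 1" "u \<notin> C 0" using C(2)[of 0] by auto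
      then have "u \<notin> I 1" using C(1)[of 0] by blast
      then obtain v where v: "u * v - 1 \<in> Z" using unit by blast
      have C1: "ring.subspace (C 1)" "I 1 \<subseteq> C 1" using C(1)[of 1] n(1) by auto
      have "u * v - 1 \<in> C 1" using v ring.Fil_base[of Z as 1] C1(2) by blast
      moreover have "v * u \<in> C 1" using ring.subspace_scale[OF C1(1) u(1)] .
      ultimately have "v * u - (u * v - 1) \<in> C 1" using ring.subspace_diff[OF C1(1)] by blast
      then have "1 \<in> C 1" by (simp add: mult.commute)
      then have "c \<in> C 1" for c using ring.subspace_scale[OF C1(1), of 1 c] by simp
      then show False using C(2)[of 1] n by auto
    qed
    then show "enat n \<le> 1" by (simp add: one_enat_def)
  qed
qed

text \<open>The standard monomials of the associated graded ring: those that are not leading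
  monomials of its relations, for the lexicographic order within each degree.\<close>

definition Std :: "nat list set"
  where "Std = {\<alpha>. mon as \<alpha> \<notin> ssum (I (Suc (sum_list \<alpha>))) (ring.Dlex Z as (below \<alpha>))}"

definition h :: "nat \<Rightarrow> nat"
  where "h s = card (Std \<inter> exps (length as) s)"

lemma len_h: "ring.len (I (Suc s)) (I s) = enat (h s)"
proof -
  have "ring.len (I (Suc s)) (ssum (I (Suc s)) (ring.Dlex Z as (exps (length as) s))) =
      of_nat (card {\<alpha> \<in> exps (length as) s. mon as \<alpha> \<notin> ssum (I (Suc s)) (ring.Dlex Z as (below \<alpha>))})"
    by (rule len_Dlex_eq[OF Z I_sub ring.Fil_base I_sub len_I_1 _ lex_down_exps])
      (rule I_1_mult[OF _ mon_in_I])
  moreover have "{\<alpha> \<in> exps (length as) s. mon as \<alpha> \<notin> ssum (I (Suc s)) (ring.Dlex Z as (below \<alpha>))} = Std \<inter> exps (length as) s"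
    by (auto simp: Std_def exps_def)
  moreover have "ssum (I (Suc s)) (ring.Dlex Z as (exps (length as) s)) = I s"
    unfolding ring.Fil_def[symmetric]
    using ring.ssum_least[OF ring.Fil_antimono_Suc[OF Z] subset_refl I_sub] ring.ssum_upper2[OF I_sub] by blast
  ultimately show ?thesis by (simp add: h_def of_nat_eq_enat)
qed

lemma len_sum_h: "ring.len (I s) UNIV = enat (\<Sum>t<s. h t)"
proof (induction s)
  case 0
  then show ?case by (simp add: ring.Fil_0 zero_enat_def)
next
  case (Suc s)
  have "ring.len (I (Suc s)) UNIV = ring.len (I (Suc s)) (I s) + ring.len (I s) UNIV"
    by (rule ring.len_add[OF I_sub I_sub _ ring.Fil_antimono_Suc[OF Z]]) auto
  then show ?case using Suc len_h by (simp add: add.commute)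
qed

text \<open>A relation with leading monomial \<open>\<alpha>\<close>, multiplied by a complementary
  monomial, is one for the multiple \<open>\<beta>\<close>. So the standard monomials form an order
  ideal, and their series is rational.\<close>

lemma Std_down:
  assumes "\<beta> \<in> Std" "length \<beta> = length as" "vle \<alpha> \<beta>"
  shows "\<alpha> \<in> Std"
proof (rule ccontr)
  assume "\<alpha> \<notin> Std"
  then obtain j d where jd: "mon as \<alpha> = j + d" "j \<in> I (Suc (sum_list \<alpha>))" "d \<in> ring.Dlex Z as (below \<alpha>)"
    unfolding Std_def ssum_def by blast
  obtain \<delta> where \<delta>: "length \<delta> = length \<alpha>" "\<beta> = vadd \<alpha> \<delta>" "sum_list \<beta> = sum_list \<alpha> + sum_list \<delta>"
    using vle_vadd_ex[OF assms(3)] by blast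
  have len: "length \<delta> = length as" using \<delta>(1) assms list_all2_lengthD by metis
  have "mon as \<beta> = mon as \<delta> * j + mon as \<delta> * d"
    unfolding \<delta>(2) mon_vadd[OF \<delta>(1)[symmetric]] jd(1) by (simp add: algebra_simps)
  moreover have "mon as \<delta> * j \<in> I (Suc (sum_list \<beta>))"
    using ring.family_mon[of "set as" "\<lambda>s. I (Suc s)" as \<delta> j "sum_list \<alpha>"] ring.Fil_mult[OF Z] jd(2) len \<delta>(3) by simp
  moreover have "mon as \<delta> * d \<in> ring.Dlex Z as (below \<beta>)"
    unfolding \<delta>(2) by (rule ring.Dlex_vadd[OF jd(3) \<delta>(1)[symmetric] Z])
  ultimately show False using assms(1) unfolding Std_def ssum_def by blast
qed

text \<open>For \<open>J\<close> generated by \<open>x\<close>, \<open>y\<close>, the quotient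
  \<open>J^s / J^(s+1)\<close> is generated by \<open>s + 1\<close> monomials, each cyclic over the
  finite-length ring modulo \<open>J\<close>. Summation gives a quadratic bound, and
  \<open>J^s\<close> lies in \<open>I s\<close>.\<close>

lemma len_I_quadratic: "\<exists>c. \<forall>s. (\<Sum>t<s. h t) \<le> c * s * s"
proof -
  let ?Q = "\<lambda>s. ring.Fil Z [x, y] s"
  have Q_sub: "ring.subspace (?Q s)" for s by (rule ring.subspace_Fil)
  have QI: "?Q s \<subseteq> I s" for s
  proof (induction s)
    case (Suc s)
    have "z * b \<in> I (Suc s)" if "z \<in> set [x, y]" "b \<in> ?Q s" for z b
      using that x y I_1_mult Suc by auto
    then show ?case unfolding ring.Fil_Suc[OF Z, of "[x, y]"]
      using ring.Fil_base by (intro ring.span_minimal I_sub) blast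
  qed (simp add: ring.Fil_0)
  \<comment> \<open>Finiteness of the length modulo \<open>x\<close>, \<open>y\<close> is what
    \<open>param\<close> provides.\<close>
  have "ring.len (?Q 1) UNIV \<le> ring.len (I k) UNIV"
    by (rule ring.len_mono[OF param]) simp
  then obtain c where c: "ring.len (?Q 1) UNIV = enat c" using len_sum_h[of k] by (auto dest: enat_ile)
  have step: "ring.len (?Q (Suc s)) (?Q s) \<le> of_nat (Suc s * c)" for s
  proof -
    have Q1: "q * b \<in> ?Q (Suc s)" if q: "q \<in> ?Q 1" and b: "b \<in> ?Q s" for q b
    proof -
      have "q \<in> {q. q * b \<in> ?Q (Suc s)}"
      proof (rule ideal_mult_mem[OF Z q])
        show "Z \<subseteq> {q. q * b \<in> ?Q (Suc s)}"
          using ring.subspace_scale[OF Z] ring.Fil_base by (fastforce simp: mult.commute)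
        show "set [x, y] \<subseteq> {q. q * b \<in> ?Q (Suc s)}" using ring.Fil_mult[OF Z] b by blast
      qed (use ring.subspace_add[OF Q_sub] ring.subspace_scale[OF Q_sub] in \<open>auto simp: distrib_right mult.assoc\<close>)
      then show ?thesis by simp
    qed
    have "ring.len (?Q (Suc s)) (ssum (?Q (Suc s)) (ring.Dlex Z [x, y] (exps (length [x, y]) s)))
        \<le> of_nat (card (exps (length [x, y]) s)) * ring.len (?Q 1) UNIV"
    proof (rule len_Dlex_le[OF Z Q_sub ring.Fil_base Q_sub _ lex_down_exps])
      fix q \<alpha> assume q: "q \<in> ?Q 1" and \<alpha>: "\<alpha> \<in> exps (length [x, y]) s"
      have "mon [x, y] \<alpha> * 1 \<in> ?Q s" unfolding ring.Fil_def ring.Dlex_def using \<alpha> by (intro ring.span_base) blast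
      then show "q * mon [x, y] \<alpha> \<in> ?Q (Suc s)" using Q1[OF q] by simp
    qed
    moreover have "?Q s \<subseteq> ssum (?Q (Suc s)) (ring.Dlex Z [x, y] (exps (length [x, y]) s))"
      using ring.ssum_upper2[OF Q_sub] unfolding ring.Fil_def by blast
    then have "ring.len (?Q (Suc s)) (?Q s) \<le> ring.len (?Q (Suc s)) (ssum (?Q (Suc s)) (ring.Dlex Z [x, y] (exps (length [x, y]) s)))"
      by (intro ring.len_mono) auto
    moreover have "card (exps (length [x, y]) s) \<le> Suc s"
    proof -
      have "exps (length [x, y]) s \<subseteq> (\<lambda>i. [i, s - i]) ` {..s}"
      proof
        fix \<alpha> assume "\<alpha> \<in> exps (length [x, y]) s"
        then have "length \<alpha> = Suc (Suc 0)" "sum_list \<alpha> = s" by (auto simp: exps_def)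
        then obtain i j where "\<alpha> = [i, j]" "i + j = s" by (auto simp: length_Suc_conv)
        then show "\<alpha> \<in> (\<lambda>i. [i, s - i]) ` {..s}" by (auto intro!: image_eqI[of _ _ i])
      qed
      then have "card (exps (length [x, y]) s) \<le> card ((\<lambda>i. [i, s - i]) ` {..s})" by (intro card_mono) auto
      also have "\<dots> \<le> card {..s}" by (rule card_image_le) simp
      finally show ?thesis by simp
    qed
    then have "of_nat (card (exps (length [x, y]) s)) * ring.len (?Q 1) UNIV \<le> of_nat (Suc s * c)"
      unfolding c of_nat_eq_enat by (simp del: mult_Suc)
    ultimately show ?thesis by (meson order_trans)
  qed
  have "ring.len (?Q s) UNIV \<le> of_nat (c * s * s)" for s
  proof (induction s)
    case (Suc s)
    have "ring.len (?Q (Suc s)) UNIV = ring.len (?Q (Suc s)) (?Q s) + ring.len (?Q s) UNIV"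
      by (rule ring.len_add[OF Q_sub Q_sub _ ring.Fil_antimono_Suc[OF Z]]) auto
    also have "\<dots> \<le> of_nat (Suc s * c) + of_nat (c * s * s)" by (intro add_mono step Suc)
    also have "\<dots> \<le> of_nat (c * Suc s * Suc s)"
      unfolding of_nat_eq_enat by (simp add: algebra_simps)
    finally show ?case .
  qed (simp add: ring.Fil_0)
  then have "enat (\<Sum>t<s. h t) \<le> of_nat (c * s * s)" for s
    using ring.len_mono[OF QI, of UNIV UNIV s] len_sum_h[of s] by (metis order_trans subset_refl)
  then show ?thesis by (auto simp: of_nat_eq_enat)
qed

text \<open>Rationality holds with as many factors \<open>1 - fps_X\<close> as there are generators;
  the quadratic bound reduces them to two.\<close>

lemma hilbert_series: "\<exists>q. Abs_fps (\<lambda>s. int (h s)) * (1 - fps_X) ^ 2 = fps_of_poly q"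
proof -
  have eq: "Abs_fps (\<lambda>s. int (h s)) = mon_series (length as) Std"
    by (simp add: mon_series_def h_def)
  obtain c where c: "\<And>s. (\<Sum>t<s. h t) \<le> c * s * s" using len_I_quadratic by blast
  show ?thesis
  proof (rule fps_pole_order_2)
    fix s
    have "psum (fps_nth (Abs_fps (\<lambda>s. int (h s)))) s = int (\<Sum>t<Suc s. h t)"
      unfolding psum_def lessThan_Suc_atMost by simp
    also have "\<dots> \<le> int (c * Suc s * Suc s)" using c[of "Suc s"] by linarith
    finally have "psum (fps_nth (Abs_fps (\<lambda>s. int (h s)))) s \<le> int c * (int s + 1) ^ 2"
      by (simp add: power2_eq_square algebra_simps)
    moreover have "psum (fps_nth (Abs_fps (\<lambda>s. int (h s)))) s \<ge> 0" by (simp add: psum_def sum_nonneg)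
    ultimately show "\<bar>psum (fps_nth (Abs_fps (\<lambda>s. int (h s)))) s\<bar> \<le> int c * (int s + 1) ^ 2" by simp
  next
    show "\<exists>p. Abs_fps (\<lambda>s. int (h s)) * (1 - fps_X) ^ length as = fps_of_poly p"
      unfolding eq by (rule mon_series_rational) (rule Std_down)
  qed
qed

end


section \<open>Modules over a two-dimensional local ring\<close>

locale local_module = local_data Z as x y k + M: pmod scale
  for Z :: "'p::comm_ring_1 set" and as x y k
    and scale :: "'p \<Rightarrow> 'v::ab_group_add \<Rightarrow> 'v" (infixr "*s" 75) +
  fixes K' N :: "'v set"
  assumes K': "M.subspace K'" and N: "M.subspace N" and K'N: "K' \<subseteq> N"
    and ZK': "\<And>z v. z \<in> Z \<Longrightarrow> z *s v \<in> K'"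
    and fg: "\<exists>T. finite T \<and> T \<subseteq> N \<and> N = M.span (K' \<union> T)"
begin

text \<open>The maximal ideal times \<open>X\<close>, with the relations \<open>K'\<close> of the
  module \<open>N / K'\<close> added.\<close>

definition nmul :: "'v set \<Rightarrow> 'v set"
  where "nmul X = M.span (K' \<union> {a *s v | a v. a \<in> set as \<and> v \<in> X})"

definition gens :: nat
  where "gens = (LEAST r. \<exists>T. finite T \<and> card T = r \<and> T \<subseteq> N \<and> N = M.span (K' \<union> T))"

definition gen :: "nat \<Rightarrow> 'v"
  where "gen = (SOME v. N = M.span (K' \<union> v ` {..<gens}))"

lemma gen: "N = M.span (K' \<union> gen ` {..<gens})"
proof -
  have "\<exists>r T. finite T \<and> card T = r \<and> T \<subseteq> N \<and> N = M.span (K' \<union> T)" using fg by blast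
  then have "\<exists>T. finite T \<and> card T = gens \<and> T \<subseteq> N \<and> N = M.span (K' \<union> T)"
    unfolding gens_def by (rule LeastI_ex)
  then obtain T where T: "finite T" "card T = gens" "N = M.span (K' \<union> T)" by blast
  obtain v where "bij_betw v {0..<card T} T" using ex_bij_betw_nat_finite[OF T(1)] by blast
  then have "N = M.span (K' \<union> v ` {..<gens})"
    using T by (simp add: bij_betw_def atLeast0LessThan)
  then show ?thesis
    unfolding gen_def by (rule someI[where P = "\<lambda>v. N = M.span (K' \<union> v ` {..<gens})"])
qed

lemma gens_le:
  assumes "finite T" "N = M.span (K' \<union> T)"
  shows "gens \<le> card T"
proof -
  have "T \<subseteq> N" using assms M.span_base by blast
  then show ?thesis unfolding gens_def using assms by (intro Least_le) blast
qed

lemma gen_N: "i < gens \<Longrightarrow> gen i \<in> N"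
  by (subst gen) (auto intro: M.span_base)

definition \<psi> :: "(nat \<Rightarrow> 'p) \<Rightarrow> 'v"
  where "\<psi> f = (\<Sum>i<gens. f i *s gen i)"

lemma psi_hom: "pmod_hom (fscale (*)) scale \<psi>"
  by unfold_locales
    (auto simp: \<psi>_def fscale_def M.scale_left_distrib sum.distrib M.scale_sum_right)

sublocale psi: pmod_hom "fscale (*)" scale \<psi>
  by (rule psi_hom)

lemma psi_N: "\<psi> f \<in> N"
  unfolding \<psi>_def using gen_N by (intro M.subspace_sum[OF N] M.subspace_scale[OF N]) auto

lemma psi_unit: "i < gens \<Longrightarrow> \<psi> (\<lambda>j. if j = i then c else 0) = c *s gen i"
proof -
  assume i: "i < gens"
  have "\<psi> (\<lambda>j. if j = i then c else 0) = (\<Sum>j<gens. if j = i then c *s gen i else 0)"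
    unfolding \<psi>_def by (rule sum.cong) auto
  then show ?thesis using i by simp
qed

lemma psi_surj: "v \<in> N \<Longrightarrow> \<exists>f. v - \<psi> f \<in> K'"
proof -
  assume "v \<in> N"
  moreover have "N \<subseteq> ssum (range \<psi>) K'"
  proof -
    have sub: "M.subspace (ssum (range \<psi>) K')"
      by (intro M.subspace_ssum K' psi.subspace_image) simp
    have "gen i \<in> ssum (range \<psi>) K'" if "i < gens" for i
      using psi_unit[OF that, of 1] M.ssum_upper1[OF K', of "range \<psi>"] by (metis M.scale_one rangeI subsetD)
    then have "K' \<union> gen ` {..<gens} \<subseteq> ssum (range \<psi>) K'"
      using M.ssum_upper2[of "range \<psi>" K'] psi.subspace_image[of UNIV] by auto
    then show ?thesis by (subst gen) (rule M.span_minimal[OF _ sub])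
  qed
  ultimately obtain f w where "v = \<psi> f + w" "w \<in> K'" unfolding ssum_def by blast
  then show ?thesis by (intro exI[of _ f]) simp
qed

definition K :: "(nat \<Rightarrow> 'p) set"
  where "K = \<psi> -` K'"

lemma K_sub: "free.subspace K"
  unfolding K_def by (rule psi.subspace_vimage[OF K'])

lemma Z_K: "prodn gens Z \<subseteq> K"
  unfolding K_def \<psi>_def prodn_def using ZK' by (auto intro!: M.subspace_sum[OF K'])

text \<open>A relation with a unit coefficient would express one generator by the others, against
  the minimality of \<open>gens\<close>.\<close>

lemma K_I1: "K \<subseteq> prodn gens (I 1)"
proof
  fix f assume f: "f \<in> K"
  show "f \<in> prodn gens (I 1)"
  proof (rule ccontr)
    assume "f \<notin> prodn gens (I 1)"
    then obtain i where i: "i < gens" "f i \<notin> I 1" unfolding prodn_def by blast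
    then obtain w where w: "f i * w - 1 \<in> Z" using unit by blast
    let ?T = "gen ` ({..<gens} - {i})"
    have "\<psi> f = f i *s gen i + (\<Sum>j\<in>{..<gens} - {i}. f j *s gen j)"
      unfolding \<psi>_def using i by (subst sum.remove[of _ i]) auto
    \<comment> \<open>\<open>w\<close> inverts \<open>f i\<close> only modulo \<open>Z\<close>; the
      last term corrects this and lies in \<open>K'\<close>.\<close>
    then have eq: "gen i = w *s \<psi> f - w *s (\<Sum>j\<in>{..<gens} - {i}. f j *s gen j) - (f i * w - 1) *s gen i"
      by (simp add: algebra_simps)
    have a: "w *s \<psi> f \<in> M.span (K' \<union> ?T)"
      using f by (intro M.span_scale M.span_base) (simp add: K_def)
    have b: "w *s (\<Sum>j\<in>{..<gens} - {i}. f j *s gen j) \<in> M.span (K' \<union> ?T)"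
      by (intro M.span_scale M.span_sum M.span_base) blast
    have c: "(f i * w - 1) *s gen i \<in> M.span (K' \<union> ?T)"
      using ZK'[OF w] by (intro M.span_base) blast
    have "gen i \<in> M.span (K' \<union> ?T)"
      by (subst eq) (rule M.span_diff[OF M.span_diff[OF a b] c])
    then have "gen j \<in> M.span (K' \<union> ?T)" if "j < gens" for j
      using that by (cases "j = i") (auto intro!: M.span_base)
    moreover have "K' \<subseteq> M.span (K' \<union> ?T)" using M.span_base by blast
    ultimately have "K' \<union> gen ` {..<gens} \<subseteq> M.span (K' \<union> ?T)" by auto
    then have "N \<subseteq> M.span (K' \<union> ?T)" by (subst gen) (rule M.span_minimal, auto)
    moreover have "M.span (K' \<union> ?T) \<subseteq> N"
      using K'N gen_N by (intro M.span_minimal N) auto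
    ultimately have "gens \<le> card ?T" by (intro gens_le) auto
    also have "\<dots> \<le> card ({..<gens} - {i})" by (rule card_image_le) simp
    also have "\<dots> < gens" using i by simp
    finally show False by simp
  qed
qed

text \<open>The \<open>s\<close>-th power of the maximal ideal times \<open>N\<close>, written
  through the presentation; \<open>Npow_Suc\<close> identifies it with iterated
  \<open>nmul\<close>.\<close>

definition Npow :: "nat \<Rightarrow> 'v set"
  where "Npow s = ssum (\<psi> ` prodn gens (I s)) K'"

lemma Npow_sub: "M.subspace (Npow s)"
  unfolding Npow_def by (intro M.subspace_ssum K' psi.subspace_image ring.subspace_prodn I_sub)

lemma K'_Npow: "K' \<subseteq> Npow s"
  unfolding Npow_def by (intro M.ssum_upper2 psi.subspace_image ring.subspace_prodn I_sub)

lemma Npow_N: "Npow s \<subseteq> N"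
  unfolding Npow_def using psi_N K'N by (intro M.ssum_least N) auto

lemma Npow_0: "Npow 0 = N"
proof
  show "N \<subseteq> Npow 0"
  proof
    fix v assume "v \<in> N"
    then obtain f where "v - \<psi> f \<in> K'" using psi_surj by blast
    then have "\<psi> f + (v - \<psi> f) \<in> Npow 0" unfolding Npow_def
      by (intro ssumI imageI) (simp_all add: ring.Fil_0 prodn_def)
    then show "v \<in> Npow 0" by simp
  qed
qed (rule Npow_N)

lemma Npow_Suc: "nmul (Npow s) = Npow (Suc s)"
proof
  show "nmul (Npow s) \<subseteq> Npow (Suc s)" unfolding nmul_def
  proof (rule M.span_minimal[OF _ Npow_sub])
    have "a *s v \<in> Npow (Suc s)" if a: "a \<in> set as" and v: "v \<in> Npow s" for a v
    proof -
      obtain f w where fw: "v = \<psi> f + w" "f \<in> prodn gens (I s)" "w \<in> K'"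
        using v unfolding Npow_def ssum_def by blast
      have "a *s v = \<psi> (fscale (*) a f) + a *s w" unfolding fw(1) by (simp add: M.scale_right_distrib psi.hom_scale)
      moreover have "fscale (*) a f \<in> prodn gens (I (Suc s))"
        using fw(2) ring.Fil_mult[OF Z a] by (auto simp: prodn_def fscale_def)
      ultimately show ?thesis unfolding Npow_def using M.subspace_scale[OF K' fw(3)] by (auto intro: ssumI)
    qed
    then show "K' \<union> {a *s v |a v. a \<in> set as \<and> v \<in> Npow s} \<subseteq> Npow (Suc s)" using K'_Npow by blast
  qed
  have sub: "M.subspace (nmul (Npow s))" by (simp add: nmul_def)
  have K'_nmul: "K' \<subseteq> nmul (Npow s)" unfolding nmul_def using M.span_base by blast
  have "c *s gen i \<in> nmul (Npow s)" if i: "i < gens" and c: "c \<in> I (Suc s)" for c i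
  proof -
    have "I (Suc s) \<subseteq> {c. c *s gen i \<in> nmul (Npow s)}"
      unfolding ring.Fil_Suc[OF Z]
    proof (rule ring.span_minimal)
      show "ring.subspace {c. c *s gen i \<in> nmul (Npow s)}"
        using M.subspace_0[OF sub] M.subspace_add[OF sub] M.subspace_scale[OF sub]
        by (intro ring.subspaceI) (auto simp: M.scale_left_distrib simp flip: M.scale_scale)
      have "(a * b) *s gen i \<in> nmul (Npow s)" if a: "a \<in> set as" and b: "b \<in> I s" for a b
      proof -
        have "\<psi> (\<lambda>j. if j = i then b else 0) \<in> \<psi> ` prodn gens (I s)"
          using b ring.subspace_0[OF I_sub] by (auto simp: prodn_def)
        then have "b *s gen i \<in> Npow s"
          unfolding psi_unit[OF i] Npow_def using M.ssum_upper1[OF K', of "\<psi> ` prodn gens (I s)"] by blast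
        then have "a *s (b *s gen i) \<in> nmul (Npow s)" unfolding nmul_def using a by (intro M.span_base) blast
        then show ?thesis by simp
      qed
      then show "Z \<union> {a * x |a x. a \<in> set as \<and> x \<in> I s} \<subseteq> {c. c *s gen i \<in> nmul (Npow s)}"
        using ZK' K'_nmul by blast
    qed
    then show ?thesis using c by blast
  qed
  then have "\<psi> f \<in> nmul (Npow s)" if "f \<in> prodn gens (I (Suc s))" for f
    unfolding \<psi>_def using that by (intro M.subspace_sum[OF sub]) (auto simp: prodn_def)
  then show "Npow (Suc s) \<subseteq> nmul (Npow s)"
    unfolding Npow_def[of "Suc s"] using K'_nmul by (intro M.ssum_least sub) auto
qed

lemma psi_Npow_iff: "\<psi> f \<in> Npow s \<longleftrightarrow> f \<in> ssum K (prodn gens (I s))"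
proof
  assume "\<psi> f \<in> Npow s"
  then obtain g w where gw: "\<psi> f = \<psi> g + w" "g \<in> prodn gens (I s)" "w \<in> K'" unfolding Npow_def ssum_def by blast
  then have "f - g \<in> K" unfolding K_def by (simp add: psi.hom_diff)
  then have "(f - g) + g \<in> ssum K (prodn gens (I s))" using gw(2) by (rule ssumI)
  then show "f \<in> ssum K (prodn gens (I s))" by simp
next
  assume "f \<in> ssum K (prodn gens (I s))"
  then obtain k g where "f = k + g" "k \<in> K" "g \<in> prodn gens (I s)" unfolding ssum_def by blast
  then have "\<psi> f = \<psi> g + \<psi> k" "\<psi> k \<in> K'" by (auto simp: psi.hom_add K_def add.commute)
  then show "\<psi> f \<in> Npow s" unfolding Npow_def using \<open>g \<in> _\<close> by (auto intro: ssumI)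
qed

text \<open>Transport along the isomorphism of \<open>F / K\<close> with \<open>N / K'\<close>, for
  \<open>F\<close> the free module of rank \<open>gens\<close>.\<close>

lemma len_Npow: "M.len (Npow t) (Npow s) = free.len (ssum K (prodn gens (I t))) (ssum K (prodn gens (I s)))" if "s \<le> t"
proof (rule psi.len_hom_eq[symmetric])
  have mono: "prodn gens (I t) \<subseteq> prodn gens (I s)" by (rule prodn_mono[OF ring.Fil_antimono[OF Z that]])
  have sub: "free.subspace (ssum K (prodn gens (I s)))" for s
    by (intro free.subspace_ssum K_sub ring.subspace_prodn I_sub)
  show "free.subspace (ssum K (prodn gens (I s)))" "free.subspace (ssum K (prodn gens (I t)))" by (rule sub)+
  show "ssum K (prodn gens (I t)) \<subseteq> ssum K (prodn gens (I s))" by (rule ssum_mono[OF subset_refl mono])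
  show "Npow t \<subseteq> Npow s" unfolding Npow_def by (intro ssum_mono image_mono mono subset_refl)
  show "\<psi> ` ssum K (prodn gens (I s)) \<subseteq> Npow s" using psi_Npow_iff by blast
  show "\<psi> f \<in> Npow t \<longleftrightarrow> f \<in> ssum K (prodn gens (I t))" for f by (rule psi_Npow_iff)
  fix v assume v: "v \<in> Npow s"
  then obtain f where f: "v - \<psi> f \<in> K'" using psi_surj Npow_N by blast
  have "v - (v - \<psi> f) \<in> Npow s" using v f K'_Npow M.subspace_diff[OF Npow_sub] by blast
  then have "f \<in> ssum K (prodn gens (I s))" using psi_Npow_iff by simp
  then show "\<exists>f\<in>ssum K (prodn gens (I s)). v - \<psi> f \<in> Npow t" using f K'_Npow by blast
qed (rule Npow_sub)+

lemma ssum_K_1: "ssum K (prodn gens (I 1)) = prodn gens (I 1)"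
  using free.ssum_least[OF K_I1 subset_refl] free.ssum_upper2[OF K_sub] ring.subspace_prodn[OF I_sub] by blast

lemma len_nmul: "M.len (nmul N) N = enat gens"
proof -
  have "ssum K (prodn gens (I 0)) = prodn gens (I 0)" 
    using free.ssum_upper2[OF K_sub, of "prodn gens (I 0)"] by (auto simp: ring.Fil_0 prodn_def)
  then have "M.len (Npow 1) (Npow 0) = free.len (prodn gens (I 1)) (prodn gens (I 0))"
    using len_Npow[of 0 1] ssum_K_1 by simp
  also have "\<dots> = of_nat gens * ring.len (I 1) (I 0)"
    by (rule ring.len_prodn[OF I_sub I_sub ring.Fil_antimono[OF Z]]) simp
  finally show ?thesis using len_I_1 Npow_Suc[of 0] by (simp add: Npow_0 ring.Fil_0 of_nat_eq_enat)
qed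

theorem hilbert_step:
  assumes colon: "\<And>v. v \<in> N \<Longrightarrow> (\<And>a. a \<in> set as \<Longrightarrow> a *s v \<in> K') \<Longrightarrow> v \<in> K'"
    and mult: "\<And>s. s \<ge> s0 \<Longrightarrow> int (h (Suc s)) - int (h s) = int (h 1) - 1"
  shows "M.len (nmul N) N \<le> M.len (nmul (nmul N)) (nmul N)"
proof -
  interpret D: depth_two_kernel Z as gens K x y
  proof
    show "ring.len (I s) UNIV \<noteq> \<infinity>" for s using len_sum_h by simp
    fix g assume g: "\<And>a. a \<in> set as \<Longrightarrow> fscale (*) a g \<in> K"
    have "\<psi> g \<in> K'" by (rule colon[OF psi_N]) (use g in \<open>simp add: K_def psi.hom_scale\<close>)
    then show "g \<in> K" by (simp add: K_def)
  qed (fact Z acc K_sub Z_K K_I1 x y x_reg y_reg)+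
  obtain \<mu> where \<mu>: "free.len (D.Ks 2) K = enat \<mu>" using D.len_Ks_fin by (metis not_enat_eq)
  define kK where "kK s = the_enat (free.len (D.Ks s) K)" for s
  have kK: "free.len (D.Ks s) K = enat (kK s)" for s
    unfolding kK_def using D.len_Ks_fin[of s] by (cases "free.len (D.Ks s) K") auto
  obtain n0 where n0: "\<And>n. free.len (D.Ks (n0 + n)) K + of_nat n * free.len (D.Ks 2) K \<le> free.len (D.Ks (Suc (n0 + n))) K"
    using D.Ks_growth by blast
  \<comment> \<open>The slope of the Hilbert function is the multiplicity, which \<open>mult\<close>
    gives as \<open>h 1 - 1\<close>.\<close>
  have "int \<mu> \<le> int gens * (int (h 1) - 1)"
  proof (rule quadratic_comparison)
    show "kK (n0 + n) + n * \<mu> \<le> kK (Suc (n0 + n))" for n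
      using n0[of n] \<mu> unfolding kK of_nat_eq_enat by simp
    show "kK s \<le> gens * (\<Sum>t<s. h t)" for s
      using D.len_Ks_le[of s] unfolding kK len_sum_h of_nat_eq_enat by simp
  qed (rule mult)
  moreover have "free.len (prodn gens (I 2)) (prodn gens (I 1)) =
      free.len (prodn gens (I 2)) (ssum K (prodn gens (I 2))) + free.len (ssum K (prodn gens (I 2))) (prodn gens (I 1))"
  proof (rule free.len_add)
    show "free.subspace (ssum K (prodn gens (I 2)))" by (intro free.subspace_ssum K_sub ring.subspace_prodn I_sub)
    show "prodn gens (I 2) \<subseteq> ssum K (prodn gens (I 2))" by (rule free.ssum_upper2[OF K_sub])
    have "prodn gens (I 2) \<subseteq> prodn gens (I 1)" by (rule prodn_mono[OF ring.Fil_antimono[OF Z]]) simp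
    then show "ssum K (prodn gens (I 2)) \<subseteq> prodn gens (I 1)"
      by (intro free.ssum_least K_I1 ring.subspace_prodn I_sub)
  qed (rule ring.subspace_prodn[OF I_sub])+
  moreover have "free.len (prodn gens (I 2)) (prodn gens (I 1)) = enat (gens * h 1)"
  proof -
    have "free.len (prodn gens (I 2)) (prodn gens (I 1)) = of_nat gens * ring.len (I 2) (I 1)"
      by (rule ring.len_prodn[OF I_sub I_sub ring.Fil_antimono[OF Z]]) simp
    then show ?thesis using len_h[of 1] by (simp add: of_nat_eq_enat numeral_2_eq_2)
  qed
  moreover have "free.len (prodn gens (I 2)) (ssum K (prodn gens (I 2))) = enat \<mu>"
  proof -
    interpret id: pmod_hom "fscale (*)" "fscale (*)" "\<lambda>g :: nat \<Rightarrow> 'p. g"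
      by unfold_locales auto
    \<comment> \<open>The isomorphism of \<open>K / (K \<inter> L)\<close> with
      \<open>(K + L) / L\<close> for \<open>L = prodn gens (I 2)\<close>.\<close>
    have "free.len (D.Ks 2) K = free.len (prodn gens (I 2)) (ssum K (prodn gens (I 2)))"
    proof (rule id.len_hom_eq)
      show "(\<lambda>g. g) ` K \<subseteq> ssum K (prodn gens (I 2))"
        using free.ssum_upper1[OF ring.subspace_prodn[OF I_sub]] by auto
      show "prodn gens (I 2) \<subseteq> ssum K (prodn gens (I 2))" by (rule free.ssum_upper2[OF K_sub])
      show "free.subspace (ssum K (prodn gens (I 2)))" by (intro free.subspace_ssum K_sub ring.subspace_prodn I_sub)
      show "g \<in> prodn gens (I 2) \<longleftrightarrow> g \<in> D.Ks 2" if "g \<in> K" for g using that by (simp add: D.Ks_def)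
      show "\<exists>g\<in>K. f - g \<in> prodn gens (I 2)" if f: "f \<in> ssum K (prodn gens (I 2))" for f
      proof -
        obtain g g' where "f = g + g'" "g \<in> K" "g' \<in> prodn gens (I 2)" using f unfolding ssum_def by blast
        then show ?thesis by (intro bexI[of _ g]) auto
      qed
    qed (fact D.Ks_sub K_sub D.Ks_K ring.subspace_prodn[OF I_sub])+
    then show ?thesis using \<mu> by simp
  qed
  moreover have "M.len (nmul (nmul N)) (nmul N) = free.len (ssum K (prodn gens (I 2))) (prodn gens (I 1))"
    using len_Npow[of 1 2] Npow_Suc[of 0] Npow_Suc[of 1] ssum_K_1 by (simp add: Npow_0 numeral_2_eq_2)
  ultimately have "enat (gens * h 1) = enat \<mu> + M.len (nmul (nmul N)) (nmul N)" "int \<mu> \<le> int gens * (int (h 1) - 1)"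
    by simp_all
  then obtain l where l: "M.len (nmul (nmul N)) (nmul N) = enat l" "gens * h 1 = \<mu> + l"
    by (cases "M.len (nmul (nmul N)) (nmul N)") auto
  have "int gens * int (h 1) = int \<mu> + int l" using l(2) by (metis of_nat_add of_nat_mult)
  then have "int gens \<le> int l" using \<open>int \<mu> \<le> _\<close> by (simp add: right_diff_distrib)
  then show ?thesis using l(1) len_nmul by simp
qed

end


section \<open>Parameters\<close>

definition prime_ideal :: "'p::comm_ring_1 set \<Rightarrow> bool"
  where "prime_ideal C \<longleftrightarrow> ring.subspace C \<and> 1 \<notin> C \<and> (\<forall>a b. a * b \<in> C \<longrightarrow> a \<in> C \<or> b \<in> C)"

lemma span_insert_ideal:
  assumes "ring.subspace C" "u \<in> ring.span (C \<union> {a})"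
  shows "\<exists>c\<in>C. \<exists>p. u = c + p * (a :: 'p::comm_ring_1)"
proof -
  have eq: "ring.span C = C" using assms(1) by (rule ring.span_subspace[OF subset_refl ring.span_superset])
  then obtain c v where "u = c + v" "c \<in> C" "v \<in> ring.span {a}"
    using assms(2) unfolding ring.span_Un eq by blast
  then show ?thesis unfolding ring.span_singleton by auto
qed

text \<open>The principle that an ideal maximal with a property tends to be prime, with the
  multiplicative condition on the property as a hypothesis. It is applied to avoiding a
  multiplicative set and to containing no power of an ideal.\<close>

lemma maximal_avoiding_prime:
  fixes Z :: "'p::comm_ring_1 set"
  assumes acc: "ring.acc Z" and J: "ring.subspace J" "Z \<subseteq> J" "Pr J"
    and mult: "\<And>C a b. ring.subspace C \<Longrightarrow> J \<subseteq> C \<Longrightarrow> Pr C \<Longrightarrow> a * b \<in> C \<Longrightarrow>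
      \<not> Pr (ring.span (C \<union> {a})) \<Longrightarrow> \<not> Pr (ring.span (C \<union> {b})) \<Longrightarrow> False"
    and one: "\<And>C. ring.subspace C \<Longrightarrow> Pr C \<Longrightarrow> 1 \<notin> C"
  obtains C where "prime_ideal C" "J \<subseteq> C" "Pr C"
proof -
  let ?F = "{C. ring.subspace C \<and> J \<subseteq> C \<and> Pr C}"
  obtain C where C: "C \<in> ?F" "\<And>C'. C' \<in> ?F \<Longrightarrow> C \<subseteq> C' \<Longrightarrow> C' = C"
    by (rule ring.acc_maximal[OF acc, of J ?F]) (use J in auto)
  have max: "\<not> Pr (ring.span (C \<union> {a}))" if "a \<notin> C" for a
  proof
    assume "Pr (ring.span (C \<union> {a}))"
    moreover have "C \<subseteq> ring.span (C \<union> {a})" using ring.span_base by blast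
    ultimately have "ring.span (C \<union> {a}) = C" using C by (intro C(2)) auto
    then show False using ring.span_base[of a "C \<union> {a}"] that by simp
  qed
  have "prime_ideal C" unfolding prime_ideal_def
    using C(1) one[of C] mult[of C] max by blast
  then show thesis using that C(1) by blast
qed

text \<open>A nonzerodivisor modulo \<open>J\<close> lies in no minimal prime over \<open>J\<close>.
  The products of powers of \<open>t\<close> with elements outside \<open>C\<close> form a
  multiplicative set disjoint from \<open>J\<close>, and a prime disjoint from it lies in
  \<open>C\<close> and omits \<open>t\<close>.\<close>

lemma prime_below:
  fixes Z :: "'p::comm_ring_1 set"
  assumes acc: "ring.acc Z" and J: "ring.subspace J" "Z \<subseteq> J" "J \<subseteq> C"
    and C: "prime_ideal C" and reg: "\<And>b. t * b \<in> J \<Longrightarrow> b \<in> J"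
  obtains D where "prime_ideal D" "J \<subseteq> D" "D \<subseteq> C" "t \<notin> D"
proof -
  define S where "S = {t ^ i * s | i s. s \<notin> C}"
  have S_mult: "a * b \<in> S" if ab: "a \<in> S" "b \<in> S" for a b
  proof -
    obtain i s j s' where *: "a = t ^ i * s" "s \<notin> C" "b = t ^ j * s'" "s' \<notin> C" using ab unfolding S_def by blast
    then have "a * b = t ^ (i + j) * (s * s')" by (simp add: power_add mult_ac)
    moreover have "s * s' \<notin> C" using * C unfolding prime_ideal_def by blast
    ultimately show ?thesis unfolding S_def by blast
  qed
  have S_C: "s \<in> S" if "s \<notin> C" for s
    unfolding S_def using that by (intro CollectI exI[of _ 0] exI[of _ s]) simp
  have J_S: "J \<inter> S = {}"
  proof -
    have "t ^ i * s \<in> J \<Longrightarrow> s \<in> J" for i s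
      by (induction i) (auto simp: mult.assoc intro: reg)
    then show ?thesis using J(3) unfolding S_def by blast
  qed
  obtain D where D: "prime_ideal D" "J \<subseteq> D" "D \<inter> S = {}"
  proof (rule maximal_avoiding_prime[OF acc J(1,2), of "\<lambda>D. D \<inter> S = {}"])
    show "J \<inter> S = {}" by (rule J_S)
  next
    fix D a b
    assume D: "ring.subspace D" "D \<inter> S = {}" and ab: "a * b \<in> D"
      and "ring.span (D \<union> {a}) \<inter> S \<noteq> {}" "ring.span (D \<union> {b}) \<inter> S \<noteq> {}"
    then obtain u w where uw: "u \<in> ring.span (D \<union> {a})" "u \<in> S" "w \<in> ring.span (D \<union> {b})" "w \<in> S" by blast
    obtain c p where cp: "c \<in> D" "u = c + p * a" using span_insert_ideal[OF D(1) uw(1)] by blast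
    obtain d q where dq: "d \<in> D" "w = d + q * b" using span_insert_ideal[OF D(1) uw(3)] by blast
    have "u * w = w * c + (p * a) * d + (p * q) * (a * b)"
      unfolding cp(2) dq(2) by (simp add: algebra_simps)
    moreover have "w * c + (p * a) * d + (p * q) * (a * b) \<in> D"
      by (rule ring.subspace_add[OF D(1) ring.subspace_add[OF D(1)
          ring.subspace_scale[OF D(1) cp(1)] ring.subspace_scale[OF D(1) dq(1)]] ring.subspace_scale[OF D(1) ab]])
    ultimately show False using S_mult[OF uw(2,4)] D(2) by auto
  next
    fix D :: "'p set" assume "D \<inter> S = {}"
    then show "1 \<notin> D" using S_C[of 1] C unfolding prime_ideal_def by blast
  qed blast
  have "t \<in> S" unfolding S_def
    using C by (intro CollectI exI[of _ 1]) (auto simp: prime_ideal_def intro!: exI[of _ 1])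
  then have "t \<notin> D" using D(3) by blast
  moreover have "D \<subseteq> C" using D(3) S_C by blast
  ultimately show thesis using that D by blast
qed

lemma Fil_add_subset:
  fixes Z :: "'p::comm_ring_1 set"
  assumes Z: "ring.subspace Z" and C: "ring.subspace C" "Z \<subseteq> C"
    and "\<And>u w. u \<in> ring.Fil Z as i \<Longrightarrow> w \<in> ring.Fil Z as j \<Longrightarrow> u * w \<in> C"
  shows "ring.Fil Z as (i + j) \<subseteq> C"
  using C assms(4)
proof (induction i arbitrary: C)
  case 0
  then show ?case using 0(3)[of 1] by (auto simp: ring.Fil_0)
next
  case (Suc i)
  have "a * t \<in> C" if a: "a \<in> set as" and t: "t \<in> ring.Fil Z as (i + j)" for a t
  proof -
    have "ring.Fil Z as (i + j) \<subseteq> {t. a * t \<in> C}"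
    proof (rule Suc.IH)
      show "ring.subspace {t. a * t \<in> C}"
        using ring.subspace_0[OF Suc.prems(1)] ring.subspace_add[OF Suc.prems(1)] ring.subspace_scale[OF Suc.prems(1)]
        by (intro ring.subspaceI) (auto simp: distrib_left mult.left_commute)
      show "Z \<subseteq> {t. a * t \<in> C}" using Suc.prems(1,2) ring.subspace_scale by blast
      fix u w assume "u \<in> ring.Fil Z as i" "w \<in> ring.Fil Z as j"
      then have "(a * u) * w \<in> C" by (intro Suc.prems(3) ring.Fil_mult[OF Z a])
      then show "u * w \<in> {t. a * t \<in> C}" by (simp add: mult.assoc)
    qed
    then show ?thesis using t by blast
  qed
  then show ?case unfolding add_Suc ring.Fil_Suc[OF Z, of as "i + j"]
    using Suc.prems(1,2) by (intro ring.span_minimal) auto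
qed

text \<open>Dimension two forces the ideal generated by a regular sequence \<open>x, y\<close> to be primary to the
  maximal ideal: otherwise a prime containing \<open>x, y\<close> starts a chain of four primes.\<close>

lemma regular_pair_primary:
  fixes Z :: "'p::comm_ring_1 set"
  assumes acc: "ring.acc Z" and Z: "ring.subspace Z"
    and one: "1 \<notin> ring.Fil Z as 1"
    and unit: "\<And>u. u \<notin> ring.Fil Z as 1 \<Longrightarrow> \<exists>v. u * v - 1 \<in> Z"
    and x: "x \<in> ring.Fil Z as 1" and y: "y \<in> ring.Fil Z as 1"
    and x_reg: "\<And>b. x * b \<in> Z \<Longrightarrow> b \<in> Z"
    and y_reg: "\<And>b c. y * b - x * c \<in> Z \<Longrightarrow> \<exists>d. b - x * d \<in> Z"
    and dim: "\<And>C D E F. prime_ideal C \<Longrightarrow> prime_ideal D \<Longrightarrow> prime_ideal E \<Longrightarrow> prime_ideal F \<Longrightarrow>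
      Z \<subseteq> C \<Longrightarrow> C \<subset> D \<Longrightarrow> D \<subset> E \<Longrightarrow> E \<subset> F \<Longrightarrow> False"
  shows "\<exists>k. ring.Fil Z as k \<subseteq> ring.Fil Z [x, y] 1"
proof (rule ccontr)
  let ?I = "ring.Fil Z as" and ?J = "ring.Fil Z [x, y] 1"
  have unit': "1 \<in> C" if C: "ring.subspace C" "Z \<subseteq> C" "u \<in> C" "u \<notin> ?I 1" for C u
  proof -
    obtain v where v: "u * v - 1 \<in> Z" using unit[OF C(4)] by blast
    have "v * u - (u * v - 1) \<in> C"
      by (rule ring.subspace_diff[OF C(1) ring.subspace_scale[OF C(1,3)]]) (use v C(2) in blast)
    then show ?thesis by (simp add: mult.commute)
  qed
  assume no: "\<not> ?thesis"
  \<comment> \<open>Maximal among the ideals above \<open>x\<close>, \<open>y\<close> that contain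
    no power of the maximal ideal, \<open>C\<close> is prime and strictly inside the maximal ideal,
    which tops the chain.\<close>
  obtain C where C: "prime_ideal C" "?J \<subseteq> C" "\<forall>k. \<not> ?I k \<subseteq> C"
  proof (rule maximal_avoiding_prime[OF acc ring.subspace_Fil[of Z "[x, y]" 1] ring.Fil_base, of "\<lambda>C. \<forall>k. \<not> ?I k \<subseteq> C"])
    show "\<forall>k. \<not> ?I k \<subseteq> ?J" using no by blast
  next
    fix C a b
    assume C: "ring.subspace C" "?J \<subseteq> C" "\<forall>k. \<not> ?I k \<subseteq> C" and ab: "a * b \<in> C"
      and "\<not> (\<forall>k. \<not> ?I k \<subseteq> ring.span (C \<union> {a}))" "\<not> (\<forall>k. \<not> ?I k \<subseteq> ring.span (C \<union> {b}))"
    then obtain i j where ij: "?I i \<subseteq> ring.span (C \<union> {a})" "?I j \<subseteq> ring.span (C \<union> {b})" by blast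
    have "?I (i + j) \<subseteq> C"
    proof (rule Fil_add_subset[OF Z C(1)])
      show "Z \<subseteq> C" using C(2) ring.Fil_base by blast
      fix u w assume uw: "u \<in> ?I i" "w \<in> ?I j"
      obtain c p where cp: "c \<in> C" "u = c + p * a" using span_insert_ideal[OF C(1)] ij(1) uw(1) by blast
      obtain d q where dq: "d \<in> C" "w = d + q * b" using span_insert_ideal[OF C(1)] ij(2) uw(2) by blast
      have "u * w = w * c + (p * a) * d + (p * q) * (a * b)"
        unfolding cp(2) dq(2) by (simp add: algebra_simps)
      moreover have "w * c + (p * a) * d + (p * q) * (a * b) \<in> C"
        by (rule ring.subspace_add[OF C(1) ring.subspace_add[OF C(1)
          ring.subspace_scale[OF C(1) cp(1)] ring.subspace_scale[OF C(1) dq(1)]] ring.subspace_scale[OF C(1) ab]])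
      ultimately show "u * w \<in> C" by simp
    qed
    then show False using C(3) by blast
  next
    fix C assume C: "ring.subspace C" "\<forall>k. \<not> ?I k \<subseteq> C"
    show "1 \<notin> C"
    proof
      assume "1 \<in> C"
      then have "c \<in> C" for c using ring.subspace_scale[OF C(1), of 1 c] by simp
      then show False using C(2) by blast
    qed
  qed blast
  have C_sub: "ring.subspace C" and C1: "1 \<notin> C" using C(1) by (auto simp: prime_ideal_def)
  have ZC: "Z \<subseteq> C" using C(2) ring.Fil_base by blast
  have C_I: "C \<subset> ?I 1" using unit'[OF C_sub ZC] C1 C(3) by blast
  have F: "prime_ideal (?I 1)" unfolding prime_ideal_def
  proof (intro conjI allI impI)
    fix a b assume ab: "a * b \<in> ?I 1"
    show "a \<in> ?I 1 \<or> b \<in> ?I 1"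
    proof (rule ccontr)
      assume "\<not> ?thesis"
      then obtain v where v: "a * v - 1 \<in> Z" and b: "b \<notin> ?I 1" using unit by blast
      have "a * v - 1 \<in> ?I 1" using v ring.Fil_base[of Z as 1] by blast
      then have "v * (a * b) - b * (a * v - 1) \<in> ?I 1"
        by (rule ring.subspace_diff[OF ring.subspace_Fil ring.subspace_scale[OF ring.subspace_Fil ab]
            ring.subspace_scale[OF ring.subspace_Fil]])
      moreover have "v * (a * b) - b * (a * v - 1) = b" by (simp add: algebra_simps)
      ultimately show False using b by simp
    qed
  qed (use one ring.subspace_Fil in auto)
  let ?X = "ring.Fil Z [x] 1"
  have X: "u \<in> ?X \<longleftrightarrow> (\<exists>d. u - x * d \<in> Z)" for u
  proof -
    have "?X = ring.span (Z \<union> range (\<lambda>d. x * d))"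
      using ring.Fil_Suc[OF Z, of "[x]" 0] by (simp add: ring.Fil_0 full_SetCompr_eq)
    moreover have "ring.span Z = Z" by (rule ring.span_subspace[OF subset_refl ring.span_superset Z])
    moreover have "ring.span (range (\<lambda>d. x * d)) = range (\<lambda>d. x * d)"
    proof (rule ring.span_subspace[OF subset_refl ring.span_superset])
      have "ring.span {x} = range (\<lambda>d. x * d)" unfolding ring.span_singleton by (simp add: mult.commute)
      then show "ring.subspace (range (\<lambda>d. x * d))" using ring.subspace_span by metis
    qed
    ultimately have eq: "?X = {z + v | z v. z \<in> Z \<and> v \<in> range (\<lambda>d. x * d)}" by (simp add: ring.span_Un)
    show ?thesis
    proof
      assume "u \<in> ?X"
      then obtain z d where "z \<in> Z" "u = z + x * d" unfolding eq by blast
      then show "\<exists>d. u - x * d \<in> Z" by (intro exI[of _ d]) simp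
    next
      assume "\<exists>d. u - x * d \<in> Z"
      then obtain d where "u - x * d \<in> Z" by blast
      then show "u \<in> ?X" unfolding eq
        by (intro CollectI exI[of _ "u - x * d"] exI[of _ "x * d"]) auto
    qed
  qed
  have xJ: "x \<in> ?J" "y \<in> ?J"
    using ring.Fil_mult[OF Z, of _ "[x, y]" 1 0] by (force simp: ring.Fil_0)+
  have XC: "?X \<subseteq> C"
  proof
    fix u assume "u \<in> ?X"
    then obtain d where d: "u - x * d \<in> Z" using X by blast
    have "(u - x * d) + d * x \<in> C"
      using d ZC xJ(1) C(2) by (intro ring.subspace_add[OF C_sub] ring.subspace_scale[OF C_sub]) auto
    then show "u \<in> C" by (simp add: mult.commute)
  qed
  have y_reg': "b \<in> ?X" if "y * b \<in> ?X" for b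
    using that y_reg unfolding X by blast
  \<comment> \<open>Going down twice: \<open>y\<close> is regular modulo \<open>x\<close>, so some
    prime inside \<open>C\<close> still contains \<open>x\<close> but omits \<open>y\<close>; as
    \<open>x\<close> is regular, a further prime inside that one omits \<open>x\<close>.\<close>
  obtain D where D: "prime_ideal D" "?X \<subseteq> D" "D \<subseteq> C" "y \<notin> D"
    using prime_below[OF acc ring.subspace_Fil ring.Fil_base XC C(1) y_reg'] by blast
  have ZD: "Z \<subseteq> D" using D(2) ring.Fil_base by blast
  obtain E where E: "prime_ideal E" "Z \<subseteq> E" "E \<subseteq> D" "x \<notin> E"
    using prime_below[OF acc Z subset_refl ZD D(1) x_reg] by blast
  have "x \<in> D" using D(2) X[of x] ring.subspace_0[OF Z] by (metis diff_self mult_1_right subsetD)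
  then have "E \<subset> D" using E by blast
  moreover have "D \<subset> C" using D xJ(2) C(2) by blast
  ultimately show False using dim[OF E(1) D(1) C(1) F E(2)] C_I by blast
qed


section \<open>Presentations of rings and modules\<close>

text \<open>A ring with a carrier becomes a quotient of a ring that is a type: the integral
  polynomial ring with one variable per element of the type, realised as the monoid ring of
  multisets. Evaluation is multiplicative on multisets and extends by the universal property of the
  free abelian group.\<close>

lemma (in cring) ex_presentation:
  "\<exists>\<pi> :: ('a multiset \<Rightarrow>\<^sub>0 int) \<Rightarrow> 'a. (\<forall>p. \<pi> p \<in> carrier R) \<and> (\<forall>p q. \<pi> (p + q) = \<pi> p \<oplus> \<pi> q) \<and>
    (\<forall>p q. \<pi> (p * q) = \<pi> p \<otimes> \<pi> q) \<and> \<pi> 1 = \<one> \<and> carrier R \<subseteq> range \<pi>"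
proof -
  \<comment> \<open>Elements outside the carrier are skipped, which makes \<open>g\<close> commute
    on the whole type, as folding over multisets requires.\<close>
  define g where "g = (\<lambda>b a. if a \<in> carrier R \<and> b \<in> carrier R then b \<otimes> a else a)"
  interpret g: comp_fun_commute g
    by standard (auto simp: g_def fun_eq_iff m_lcomm)
  define f where "f = fold_mset g \<one>"
  have f_empty: "f {#} = \<one>" and f_insert: "f (add_mset b X) = g b (f X)" for b X
    by (simp_all add: f_def)
  have f_closed: "f X \<in> carrier R" for X
    by (induction X) (auto simp: f_empty f_insert g_def)
  have f_add: "f (X + Y) = f X \<otimes> f Y" for X Y
  proof (induction X)
    case empty
    then show ?case using f_closed[of Y] by (simp add: f_empty)
  next
    case (add b X)
    then show ?case using f_closed by (auto simp: f_insert g_def m_assoc)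
  qed
  obtain h where h: "h \<in> hom (free_Abelian_group UNIV) (add_monoid R)" "\<And>X. h (frag_of X) = f X"
    by (rule comm_group.free_Abelian_group_universal[OF a_comm_group, of f UNIV]) (use f_closed in auto)
  have h_closed: "h p \<in> carrier R" for p
    using h(1) by (auto simp: hom_def free_Abelian_group_def)
  have h_add: "h (p + q) = h p \<oplus> h q" for p q
    using h(1) by (auto simp: hom_def free_Abelian_group_def)
  have h_diff: "h (p - q) = h p \<ominus> h q" for p q
  proof -
    have "h p = h (p - q) \<oplus> h q" using h_add[of "p - q" q] by simp
    then show ?thesis using h_closed by (simp add: a_minus_def a_assoc r_neg)
  qed
  have h_0: "h 0 = \<zero>" using h_diff[of 0 0] h_closed[of 0] by (simp add: a_minus_def r_neg)
  have h_frag: "h (frag_of X * q) = f X \<otimes> h q" for X q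
  proof -
    have "Poly_Mapping.keys q \<subseteq> UNIV" by simp
    then show ?thesis
    proof (induction q rule: frag_induction)
      case zero
      then show ?case using h_0 f_closed by simp
    next
      case (one Y)
      have "frag_of X * frag_of Y = frag_of (X + Y)" by (simp add: mult_single)
      then show ?case by (simp add: h(2) f_add)
    next
      case (diff a b)
      have "frag_of X * (a - b) = frag_of X * a - frag_of X * b" by (rule right_diff_distrib)
      then show ?case using diff h_closed f_closed by (simp add: h_diff a_minus_def r_distr r_minus)
    qed
  qed
  have h_mult: "h (p * q) = h p \<otimes> h q" for p q
  proof -
    have "Poly_Mapping.keys p \<subseteq> UNIV" by simp
    then show ?thesis
    proof (induction p rule: frag_induction)
      case zero
      then show ?case using h_0 h_closed by simp
    next
      case (one X)
      then show ?case using h_frag h(2) by simp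
    next
      case (diff a b)
      have "(a - b) * q = a * q - b * q" by (rule left_diff_distrib)
      then show ?case using diff h_closed by (simp add: h_diff a_minus_def l_distr l_minus)
    qed
  qed
  have "frag_of ({#} :: 'a multiset) = 1" by (simp flip: zero_multiset_def)
  then have h_1: "h 1 = \<one>" using h(2)[of "{#}"] by (simp add: f_empty)
  have "b \<in> range h" if "b \<in> carrier R" for b
    using h(2)[of "{#b#}"] that by (auto simp: f_empty f_insert g_def intro!: image_eqI[of _ _ "frag_of {#b#}"])
  then show ?thesis using h_closed h_add h_mult h_1 by blast
qed

text \<open>The dictionary between modules with a carrier and submodules of a typed
  \<open>P\<close>-module. The map lives on a submodule \<open>D\<close>, so that the same
  presentation restricts to the submodules whose quotients give the Hilbert function.\<close>

locale semilinear = V: pmod scale + M: module R M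
  for scale :: "'p::comm_ring_1 \<Rightarrow> 'v::ab_group_add \<Rightarrow> 'v" (infixr "*s" 75)
    and R :: "('a, 'r) ring_scheme" and M :: "('a, 'c, 't) module_scheme" +
  fixes \<rho> :: "'p \<Rightarrow> 'a" and \<phi> :: "'v \<Rightarrow> 'c" and D :: "'v set"
  assumes rho_closed: "\<rho> c \<in> carrier R"
    and rho_surj: "a \<in> carrier R \<Longrightarrow> \<exists>c. \<rho> c = a"
    and D: "V.subspace D"
    and phi_closed: "v \<in> D \<Longrightarrow> \<phi> v \<in> carrier M"
    and phi_add: "v \<in> D \<Longrightarrow> w \<in> D \<Longrightarrow> \<phi> (v + w) = \<phi> v \<oplus>\<^bsub>M\<^esub> \<phi> w"
    and phi_scale: "v \<in> D \<Longrightarrow> \<phi> (c *s v) = \<rho> c \<odot>\<^bsub>M\<^esub> \<phi> v"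
begin

definition pre :: "'c set \<Rightarrow> 'v set"
  where "pre H = {v \<in> D. \<phi> v \<in> H}"

definition ker :: "'v set"
  where "ker = pre {\<zero>\<^bsub>M\<^esub>}"

lemma phi_0: "\<phi> 0 = \<zero>\<^bsub>M\<^esub>"
proof -
  have "0 \<in> D" by (rule V.subspace_0[OF D])
  then have "\<phi> 0 = \<phi> 0 \<oplus>\<^bsub>M\<^esub> \<phi> 0" "\<phi> 0 \<in> carrier M" using phi_add[of 0 0] phi_closed by auto
  then show ?thesis by (metis M.M.add.r_cancel_one')
qed

lemma phi_minus: "v \<in> D \<Longrightarrow> \<phi> (- v) = \<ominus>\<^bsub>M\<^esub> \<phi> v"
proof -
  assume v: "v \<in> D"
  then have "- v \<in> D" by (rule V.subspace_neg[OF D])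
  then have "\<phi> (- v) \<oplus>\<^bsub>M\<^esub> \<phi> v = \<zero>\<^bsub>M\<^esub>" using phi_add[of "- v" v] v phi_0 by simp
  then show ?thesis using phi_closed v \<open>- v \<in> D\<close> by (metis M.M.minus_equality)
qed

lemma phi_diff: "v \<in> D \<Longrightarrow> w \<in> D \<Longrightarrow> \<phi> (v - w) = \<phi> v \<ominus>\<^bsub>M\<^esub> \<phi> w"
  using phi_add[of v "- w"] phi_minus[of w] V.subspace_neg[OF D, of w] by (simp add: M.M.minus_eq)

lemma pre_sub: "submodule H R M \<Longrightarrow> V.subspace (pre H)"
proof -
  assume H: "submodule H R M"
  show ?thesis
  proof (rule V.subspaceI)
    show "0 \<in> pre H" using V.subspace_0[OF D] phi_0 subgroup.one_closed[OF submodule.axioms(1)[OF H]]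
      by (simp add: pre_def)
  next
    fix v w assume "v \<in> pre H" "w \<in> pre H"
    then show "v + w \<in> pre H" using V.subspace_add[OF D] phi_add M.submoduleE(5)[OF H] by (simp add: pre_def)
  next
    fix c v assume "v \<in> pre H"
    then show "c *s v \<in> pre H" using V.subspace_scale[OF D] phi_scale M.submoduleE(4)[OF H rho_closed]
      by (simp add: pre_def)
  qed
qed

lemma img_sub:
  assumes C: "V.subspace C" "C \<subseteq> D"
  shows "submodule (\<phi> ` C) R M"
proof (rule M.submoduleI)
  show "\<phi> ` C \<subseteq> carrier M" using C phi_closed by blast
  show "\<zero>\<^bsub>M\<^esub> \<in> \<phi> ` C" using V.subspace_0[OF C(1)] phi_0 by force
next
  fix a assume "a \<in> \<phi> ` C"
  then obtain v where "v \<in> C" "a = \<phi> v" by blast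
  then show "\<ominus>\<^bsub>M\<^esub> a \<in> \<phi> ` C" using phi_minus[of v] C(2) V.subspace_neg[OF C(1)] by (metis imageI subsetD)
next
  fix a b assume "a \<in> \<phi> ` C" "b \<in> \<phi> ` C"
  then obtain v w where "v \<in> C" "a = \<phi> v" "w \<in> C" "b = \<phi> w" by blast
  then show "a \<oplus>\<^bsub>M\<^esub> b \<in> \<phi> ` C" using phi_add[of v w] C(2) V.subspace_add[OF C(1)] by (metis imageI subsetD)
next
  fix a b assume "a \<in> carrier R" "b \<in> \<phi> ` C"
  then obtain c v where "\<rho> c = a" "v \<in> C" "b = \<phi> v" using rho_surj by blast
  then show "a \<odot>\<^bsub>M\<^esub> b \<in> \<phi> ` C" using phi_scale[of v c] C(2) V.subspace_scale[OF C(1)] by (metis imageI subsetD)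
qed

lemma ker_sub: "V.subspace ker"
proof -
  have "\<phi> ` {0} = {\<zero>\<^bsub>M\<^esub>}" using phi_0 by simp
  then have "submodule {\<zero>\<^bsub>M\<^esub>} R M" using img_sub[of "{0}"] V.subspace_0[OF D] by simp
  then show ?thesis unfolding ker_def by (rule pre_sub)
qed

lemma ker_pre: "submodule H R M \<Longrightarrow> ker \<subseteq> pre H"
  using subgroup.one_closed[OF submodule.axioms(1)] by (fastforce simp: ker_def pre_def)

lemma pre_D: "pre H \<subseteq> D"
  by (auto simp: pre_def)

end

locale presented = semilinear scale R M \<rho> \<phi> D
  for scale :: "'p::comm_ring_1 \<Rightarrow> 'v::ab_group_add \<Rightarrow> 'v" (infixr "*s" 75)
    and R :: "('a, 'r) ring_scheme" and M :: "('a, 'c, 't) module_scheme"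
    and \<rho> :: "'p \<Rightarrow> 'a" and \<phi> :: "'v \<Rightarrow> 'c" and D :: "'v set" +
  assumes phi_surj: "m \<in> carrier M \<Longrightarrow> \<exists>v\<in>D. \<phi> v = m"
begin

lemma img_pre: "H \<subseteq> carrier M \<Longrightarrow> \<phi> ` pre H = H"
  unfolding pre_def using phi_surj by blast

lemma pre_img:
  assumes "V.subspace C" "ker \<subseteq> C" "C \<subseteq> D"
  shows "pre (\<phi> ` C) = C"
proof
  show "pre (\<phi> ` C) \<subseteq> C"
  proof
    fix v assume "v \<in> pre (\<phi> ` C)"
    then obtain w where w: "v \<in> D" "w \<in> C" "\<phi> v = \<phi> w" unfolding pre_def by auto
    then have wD: "w \<in> D" using assms(3) by blast
    have "\<phi> (v - w) = \<zero>\<^bsub>M\<^esub>" using phi_diff[OF w(1) wD] w(3) phi_closed[OF wD] by (simp add: M.M.minus_eq M.M.r_neg)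
    then have "v - w \<in> ker" using V.subspace_diff[OF D w(1) wD] by (simp add: ker_def pre_def)
    then have "(v - w) + w \<in> C" using w(2) assms V.subspace_add by blast
    then show "v \<in> C" by simp
  qed
qed (use assms(3) in \<open>auto simp: pre_def\<close>)

lemma gen_submodule_eq:
  assumes S: "S \<subseteq> carrier M"
  shows "gen_submodule R M S = \<phi> ` V.span (ker \<union> pre S)"
proof
  have sub: "V.span (ker \<union> pre S) \<subseteq> D"
    by (rule V.span_minimal[OF _ D]) (auto simp: ker_def pre_def)
  have "S \<subseteq> \<phi> ` V.span (ker \<union> pre S)"
  proof
    fix m assume m: "m \<in> S"
    then obtain v where "v \<in> D" "\<phi> v = m" using S phi_surj by blast
    then have "v \<in> pre S" using m by (simp add: pre_def)
    then show "m \<in> \<phi> ` V.span (ker \<union> pre S)" using \<open>\<phi> v = m\<close> V.span_base by blast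
  qed
  then show "gen_submodule R M S \<subseteq> \<phi> ` V.span (ker \<union> pre S)"
    unfolding gen_submodule_def using img_sub[OF V.subspace_span sub] by blast
  show "\<phi> ` V.span (ker \<union> pre S) \<subseteq> gen_submodule R M S"
    unfolding gen_submodule_def
  proof (rule Inter_greatest)
    fix N assume "N \<in> {N. submodule N R M \<and> S \<subseteq> N}"
    then have N: "submodule N R M" "S \<subseteq> N" by auto
    have "V.span (ker \<union> pre S) \<subseteq> pre N"
      by (rule V.span_minimal[OF _ pre_sub[OF N(1)]]) (use ker_pre[OF N(1)] N(2) in \<open>auto simp: pre_def\<close>)
    then show "\<phi> ` V.span (ker \<union> pre S) \<subseteq> N" by (auto simp: pre_def)
  qed
qed

lemma gen_submodule_sub: "S \<subseteq> carrier M \<Longrightarrow> submodule (gen_submodule R M S) R M"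
  unfolding gen_submodule_eq
  by (rule img_sub[OF V.subspace_span]) (rule V.span_minimal[OF _ D], auto simp: ker_def pre_def)

definition q :: "'c set \<Rightarrow> 'v \<Rightarrow> 'c set"
  where "q L v = L +>\<^bsub>M\<^esub> \<phi> v"

lemma quot_facts:
  assumes L: "submodule L R M"
  shows quot_carrier: "carrier (quot_module M L) = q L ` D"
    and quot_add: "\<And>v w. v \<in> D \<Longrightarrow> w \<in> D \<Longrightarrow> q L v \<oplus>\<^bsub>quot_module M L\<^esub> q L w = q L (v + w)"
    and quot_eq_iff: "\<And>v w. v \<in> D \<Longrightarrow> w \<in> D \<Longrightarrow> q L v = q L w \<longleftrightarrow> v - w \<in> pre L"
    and quot_scale: "\<And>c v. v \<in> D \<Longrightarrow> \<rho> c \<odot>\<^bsub>quot_module M L\<^esub> q L v = q L (c *s v)"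
    and quot_0: "q L 0 = \<zero>\<^bsub>quot_module M L\<^esub>"
    and quot_group: "group (add_monoid (quot_module M L))"
proof -
  let ?Q = "quot_module M L"
  have Lsub: "subgroup L (add_monoid M)" by (rule submodule.axioms(1)[OF L])
  interpret L: abelian_subgroup L M
    by (rule abelian_subgroupI3) (auto intro: additive_subgroup.intro Lsub M.abelian_group_axioms)
  have Q_carrier: "carrier ?Q = q L ` D"
    unfolding quot_module_def q_def A_RCOSETS_def' using phi_closed phi_surj by (auto simp: image_iff)
  have q_add: "q L v \<oplus>\<^bsub>?Q\<^esub> q L w = q L (v + w)" if "v \<in> D" "w \<in> D" for v w
    using that by (simp add: quot_module_def q_def phi_closed L.a_rcos_sum phi_add)
  have q_eq_iff: "q L v = q L w \<longleftrightarrow> v - w \<in> pre L" if "v \<in> D" "w \<in> D" for v w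
  proof -
    have "v - w \<in> pre L \<longleftrightarrow> \<phi> v \<ominus>\<^bsub>M\<^esub> \<phi> w \<in> L"
      using that V.subspace_diff[OF D] by (simp add: pre_def phi_diff)
    also have "\<dots> \<longleftrightarrow> \<phi> v \<in> L +>\<^bsub>M\<^esub> \<phi> w"
      using L.a_rcos_module[of "\<phi> w" "\<phi> v"] that phi_closed by (simp add: M.M.minus_eq)
    also have "\<dots> \<longleftrightarrow> q L v = q L w"
      unfolding q_def using that phi_closed
      by (metis L.a_rcos_self L.a_repr_independence')
    finally show ?thesis by simp
  qed
  have q_scale: "\<rho> c \<odot>\<^bsub>?Q\<^esub> q L v = q L (c *s v)" if v: "v \<in> D" for c v
  proof -
    have "L +>\<^bsub>M\<^esub> (\<rho> c \<odot>\<^bsub>M\<^esub> x) = q L (c *s v)" if x: "x \<in> q L v" for x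
    proof -
      have "q L v \<subseteq> carrier M" unfolding q_def using phi_closed[OF v] L.a_subset M.M.a_r_coset_subset_G by blast
      then obtain w where w: "w \<in> D" "x = \<phi> w" using x phi_surj by blast
      have "q L v = q L w" unfolding q_def
        using L.a_repr_independence'[of x "\<phi> v"] x w phi_closed[OF v] unfolding q_def by simp
      then have "c *s (v - w) \<in> pre L" using q_eq_iff[OF v w(1)] V.subspace_scale[OF pre_sub[OF L]] by blast
      then have "q L (c *s w) = q L (c *s v)"
        using q_eq_iff[of "c *s v" "c *s w"] v w(1) V.subspace_scale[OF D] by (simp add: V.scale_right_diff_distrib)
      then show ?thesis using w phi_scale[OF w(1)] by (simp add: q_def)
    qed
    moreover have "q L v \<noteq> {}" unfolding q_def using L.a_rcos_self[OF phi_closed[OF v]] by blast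
    ultimately show ?thesis unfolding quot_module_def by simp
  qed
  have q_0: "q L 0 = \<zero>\<^bsub>?Q\<^esub>"
    unfolding q_def phi_0 quot_module_def using L.zero_closed L.a_subset
    by (simp add: M.M.a_coset_join2 Lsub)
  have Q_group: "group (add_monoid ?Q)"
  proof -
    have "group (M A_Mod L)" by (rule L.a_factorgroup_is_group)
    then show ?thesis
      by (simp add: group_def monoid_def group_axioms_def Units_def quot_module_def A_FactGroup_def')
  qed
  show "carrier ?Q = q L ` D" by (rule Q_carrier)
  show "group (add_monoid ?Q)" by (rule Q_group)
  show "q L 0 = \<zero>\<^bsub>?Q\<^esub>" by (rule q_0)
  show "q L v \<oplus>\<^bsub>?Q\<^esub> q L w = q L (v + w)" if "v \<in> D" "w \<in> D" for v w using that by (rule q_add)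
  show "q L v = q L w \<longleftrightarrow> v - w \<in> pre L" if "v \<in> D" "w \<in> D" for v w using that by (rule q_eq_iff)
  show "\<rho> c \<odot>\<^bsub>?Q\<^esub> q L v = q L (c *s v)" if "v \<in> D" for c v using that by (rule q_scale)
qed

text \<open>The correspondence between the submodules of \<open>M / L\<close> and those between
  \<open>pre L\<close> and \<open>D\<close>, carried out on cosets because the quotient is a bare
  record.\<close>

lemma module_length_quot:
  assumes L: "submodule L R M"
  shows "module_length R (quot_module M L) = V.len (pre L) D"
proof -
  let ?Q = "quot_module M L"
  have Q_minus: "inv\<^bsub>add_monoid ?Q\<^esub> q L v = q L (- v)" if v: "v \<in> D" for v
  proof (rule group.inv_equality[OF quot_group[OF L]])
    have mv: "- v \<in> D" by (rule V.subspace_neg[OF D v])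
    show "q L (- v) \<otimes>\<^bsub>add_monoid ?Q\<^esub> q L v = \<one>\<^bsub>add_monoid ?Q\<^esub>"
      using quot_add[OF L mv v] quot_0[OF L] by simp
    show "q L v \<in> carrier (add_monoid ?Q)" "q L (- v) \<in> carrier (add_monoid ?Q)"
      using v mv by (auto simp: quot_carrier[OF L])
  qed
  have sub_X: "submodule (q L ` C) R ?Q" if C: "V.subspace C" "C \<subseteq> D" for C
  proof (intro submodule.intro subgroup.intro submodule_axioms.intro)
    show "q L ` C \<subseteq> carrier (add_monoid ?Q)" using C by (auto simp: quot_carrier[OF L])
    show "\<one>\<^bsub>add_monoid ?Q\<^esub> \<in> q L ` C" using V.subspace_0[OF C(1)] quot_0[OF L] by force
  next
    fix a b assume "a \<in> q L ` C" "b \<in> q L ` C"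
    then obtain v w where vw: "v \<in> C" "a = q L v" "w \<in> C" "b = q L w" by blast
    then have "a \<otimes>\<^bsub>add_monoid ?Q\<^esub> b = q L (v + w)" using quot_add[OF L, of v w] C by auto
    then show "a \<otimes>\<^bsub>add_monoid ?Q\<^esub> b \<in> q L ` C" using V.subspace_add[OF C(1)] vw by blast
  next
    fix a assume "a \<in> q L ` C"
    then obtain v where v: "v \<in> C" "a = q L v" by blast
    then have "inv\<^bsub>add_monoid ?Q\<^esub> a = q L (- v)" using Q_minus C by auto
    then show "inv\<^bsub>add_monoid ?Q\<^esub> a \<in> q L ` C" using V.subspace_neg[OF C(1) v(1)] by blast
  next
    fix a b assume "a \<in> carrier R" "b \<in> q L ` C"
    then obtain c v where cv: "\<rho> c = a" "v \<in> C" "b = q L v" using rho_surj by blast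
    then have "a \<odot>\<^bsub>?Q\<^esub> b = q L (c *s v)" using quot_scale[OF L, of v c] C by auto
    then show "a \<odot>\<^bsub>?Q\<^esub> b \<in> q L ` C" using V.subspace_scale[OF C(1)] cv by blast
  qed
  have sub_C: "V.subspace {v \<in> D. q L v \<in> X} \<and> pre L \<subseteq> {v \<in> D. q L v \<in> X} \<and> {v \<in> D. q L v \<in> X} \<subseteq> D"
    if X: "submodule X R ?Q" for X
  proof (intro conjI V.subspaceI)
    have X0: "q L 0 \<in> X" using subgroup.one_closed[OF submodule.axioms(1)[OF X]] quot_0[OF L] by simp
    then show "0 \<in> {v \<in> D. q L v \<in> X}" using V.subspace_0[OF D] by simp
    show "pre L \<subseteq> {v \<in> D. q L v \<in> X}"
    proof
      fix v assume v: "v \<in> pre L"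
      then have "q L v = q L 0" using quot_eq_iff[OF L, of v 0] pre_D V.subspace_0[OF D] by auto
      then show "v \<in> {v \<in> D. q L v \<in> X}" using X0 v pre_D by auto
    qed
  next
    fix v w assume "v \<in> {v \<in> D. q L v \<in> X}" "w \<in> {v \<in> D. q L v \<in> X}"
    then show "v + w \<in> {v \<in> D. q L v \<in> X}"
      using subgroup.m_closed[OF submodule.axioms(1)[OF X], of "q L v" "q L w"] V.subspace_add[OF D] quot_add[OF L] by simp
  next
    fix c v assume "v \<in> {v \<in> D. q L v \<in> X}"
    then show "c *s v \<in> {v \<in> D. q L v \<in> X}"
      using submodule.smult_closed[OF X rho_closed, of "q L v" c] V.subspace_scale[OF D] quot_scale[OF L] by simp
  qed blast
  have len_eq: "module_length R ?Q = chain_length (\<lambda>N. submodule N R ?Q)"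
    by (simp add: module_length_def chain_length_def)
  show ?thesis unfolding len_eq V.len_def
  proof (rule antisym)
    show "chain_length (\<lambda>N. submodule N R ?Q) \<le> chain_length (\<lambda>C. V.subspace C \<and> pre L \<subseteq> C \<and> C \<subseteq> D)"
    proof (rule chain_length_le_map[of _ _ "\<lambda>X. {v \<in> D. q L v \<in> X}"])
      fix X Y assume "submodule X R ?Q" and Y: "submodule Y R ?Q" and XY: "X \<subset> Y"
      then obtain a where a: "a \<in> Y" "a \<notin> X" by blast
      moreover have "Y \<subseteq> carrier ?Q" using subgroup.subset[OF submodule.axioms(1)[OF Y]] by simp
      ultimately obtain v where "v \<in> D" "a = q L v" using quot_carrier[OF L] by blast
      then show "{v \<in> D. q L v \<in> X} \<subset> {v \<in> D. q L v \<in> Y}" using a XY by blast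
    qed (rule sub_C)
    show "chain_length (\<lambda>C. V.subspace C \<and> pre L \<subseteq> C \<and> C \<subseteq> D) \<le> chain_length (\<lambda>N. submodule N R ?Q)"
    proof (rule chain_length_le_map[of _ _ "\<lambda>C. q L ` C"])
      fix C C' assume C: "V.subspace C \<and> pre L \<subseteq> C \<and> C \<subseteq> D" and C': "V.subspace C' \<and> pre L \<subseteq> C' \<and> C' \<subseteq> D"
        and CC: "C \<subset> C'"
      then obtain v where v: "v \<in> C'" "v \<notin> C" by blast
      have "q L v \<notin> q L ` C"
      proof
        assume "q L v \<in> q L ` C"
        then obtain w where w: "w \<in> C" "q L v = q L w" by blast
        then have "v - w \<in> C" using quot_eq_iff[OF L, of v w] v C C' by blast
        then have "(v - w) + w \<in> C" using w C V.subspace_add by blast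
        then show False using v by simp
      qed
      then show "q L ` C \<subset> q L ` C'" using v CC by blast
    qed (use sub_X in blast)
  qed
qed

lemma quot_nonzerodivisor:
  assumes L: "submodule L R M" and nzd: "nonzerodivisor_on (\<rho> c) (quot_module M L)"
    and v: "v \<in> D" "c *s v \<in> pre L"
  shows "v \<in> pre L"
proof -
  have 0: "0 \<in> D" and cv: "c *s v \<in> D" using V.subspace_0[OF D] V.subspace_scale[OF D v(1)] by auto
  have "q L (c *s v) = q L 0" using quot_eq_iff[OF L cv 0] v(2) by simp
  then have "\<rho> c \<odot>\<^bsub>quot_module M L\<^esub> q L v = \<zero>\<^bsub>quot_module M L\<^esub>"
    using quot_scale[OF L v(1)] quot_0[OF L] by simp
  moreover have "q L v \<in> carrier (quot_module M L)" using quot_carrier[OF L] v(1) by blast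
  ultimately have "q L v = q L 0" using nzd quot_0[OF L] unfolding nonzerodivisor_on_def by simp
  then show ?thesis using quot_eq_iff[OF L v(1) 0] by simp
qed

lemma ideal_smult_sub:
  assumes "J \<subseteq> carrier R"
  shows "submodule (ideal_smult R J M) R M"
  unfolding ideal_smult_def by (rule gen_submodule_sub) (use assms in auto)

lemma first_regular:
  assumes xs: "regular_sequence R M xs" "0 < length xs" and c: "\<rho> c = xs ! 0"
    and v: "v \<in> D" "c *s v \<in> ker"
  shows "v \<in> ker"
proof -
  let ?L = "ideal_smult R (Idl\<^bsub>R\<^esub> {}) M"
  \<comment> \<open>The first element of a regular sequence acts on the quotient by the ideal
    generated by the empty set, hence on \<open>M\<close> itself.\<close>
  have Idl: "Idl\<^bsub>R\<^esub> {} \<subseteq> {\<zero>\<^bsub>R\<^esub>}" by (rule M.R.genideal_minimal[OF M.R.zeroideal]) simp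
  then have carr: "Idl\<^bsub>R\<^esub> {} \<subseteq> carrier R" by auto
  have zero: "submodule {\<zero>\<^bsub>M\<^esub>} R M" using img_sub[of "{0}"] V.subspace_0[OF D] phi_0 by simp
  have "?L \<subseteq> {\<zero>\<^bsub>M\<^esub>}" unfolding ideal_smult_def gen_submodule_def
    using Idl zero by (intro Inter_lower) auto
  moreover have sub: "submodule ?L R M" by (rule ideal_smult_sub[OF carr])
  ultimately have L: "pre ?L = ker" using ker_pre[OF sub] by (auto simp: ker_def pre_def)
  have "nonzerodivisor_on (\<rho> c) (quot_module M ?L)"
    using xs unfolding regular_sequence_def c by force
  from quot_nonzerodivisor[OF sub this v(1)] show ?thesis using v(2) L by simp
qed

context
  fixes \<mm> :: "'a set" and Z :: "'p set" and as :: "'p list"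
  assumes ideal: "ideal \<mm> R" and Z: "ring.subspace Z" "\<And>z. z \<in> Z \<Longrightarrow> \<rho> z = \<zero>\<^bsub>R\<^esub>"
    and mm: "\<And>c. \<rho> c \<in> \<mm> \<longleftrightarrow> c \<in> ring.Fil Z as 1"
begin

definition W :: "nat \<Rightarrow> 'c set"
  where "W n = ideal_smult R (\<mm> [^]\<^bsub>ideals_set R\<^esub> n) M"

lemma ideal_power: "ideal (\<mm> [^]\<^bsub>ideals_set R\<^esub> (n::nat)) R"
proof (induction n)
  case 0
  then show ?case using M.R.oneideal by (simp add: nat_pow_def ideals_set_def)
next
  case (Suc n)
  then show ?case using M.R.ideal_prod_is_ideal[OF Suc ideal] by (simp add: nat_pow_def ideals_set_def)
qed

lemma ideal_power_Suc: "\<mm> [^]\<^bsub>ideals_set R\<^esub> Suc n = ideal_prod R (\<mm> [^]\<^bsub>ideals_set R\<^esub> n) \<mm>"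
  by (simp add: nat_pow_def ideals_set_def)

lemma power_carrier: "\<mm> [^]\<^bsub>ideals_set R\<^esub> (n::nat) \<subseteq> carrier R"
  using ideal.Icarr[OF ideal_power] by blast

lemma W_sub: "submodule (W n) R M"
  unfolding W_def by (rule ideal_smult_sub[OF power_carrier])

lemma W_carrier: "W n \<subseteq> carrier M"
  by (rule M.submoduleE(1)[OF W_sub])

lemma W_mem: "a \<in> \<mm> [^]\<^bsub>ideals_set R\<^esub> n \<Longrightarrow> m \<in> carrier M \<Longrightarrow> a \<odot>\<^bsub>M\<^esub> m \<in> W n"
  unfolding W_def ideal_smult_def gen_submodule_def by blast

lemma W_least:
  assumes "submodule H R M" "\<And>a m. a \<in> \<mm> [^]\<^bsub>ideals_set R\<^esub> n \<Longrightarrow> m \<in> carrier M \<Longrightarrow> a \<odot>\<^bsub>M\<^esub> m \<in> H"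
  shows "W n \<subseteq> H"
  unfolding W_def ideal_smult_def gen_submodule_def using assms by (intro Inter_lower) blast

lemma W_0: "pre (W 0) = D"
proof -
  have "m \<in> W 0" if "m \<in> carrier M" for m
    using W_mem[of "\<one>\<^bsub>R\<^esub>" 0 m] that by (simp add: nat_pow_def ideals_set_def)
  then show ?thesis using phi_closed by (auto simp: pre_def)
qed

text \<open>Multiplying by \<open>\<mm>\<close> amounts to applying the finitely many generators
  \<open>as\<close>, because the product of ideals is generated by products and \<open>Z\<close>
  acts as zero. In this form the powers match \<open>nmul\<close>.\<close>

lemma W_Suc: "pre (W (Suc n)) = V.span (ker \<union> {a *s v | a v. a \<in> set as \<and> v \<in> pre (W n)})" (is "_ = ?Y")
proof
  have Y_sub: "V.subspace ?Y" by simp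
  have "a *s v \<in> D" if "v \<in> pre (W n)" for a v using that pre_D V.subspace_scale[OF D] by blast
  then have YD: "?Y \<subseteq> D" by (intro V.span_minimal[OF _ D]) (auto simp: ker_def pre_def)
  have kerY: "ker \<subseteq> ?Y" using V.span_base by blast
  have key: "c *s u \<in> ?Y" if c: "\<rho> c \<in> \<mm>" and u: "u \<in> pre (W n)" for c u
  proof -
    have "c \<in> {c. c *s u \<in> ?Y}"
    proof (rule ideal_mult_mem[OF Z(1)])
      show "c \<in> ring.Fil Z as 1" using c mm by simp
      have "z *s u \<in> ker" if "z \<in> Z" for z
        using u Z(2)[OF that] phi_scale[of u z] phi_closed[of u] V.subspace_scale[OF D, of u z]
        by (simp add: ker_def pre_def)
      then show "Z \<subseteq> {c. c *s u \<in> ?Y}" using kerY by (simp add: subset_iff)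
      have "a *s u \<in> ?Y" if "a \<in> set as" for a
        by (rule V.span_base, rule UnI2) (use that u in blast)
      then show "set as \<subseteq> {c. c *s u \<in> ?Y}" by (simp add: subset_iff)
      fix c d assume d: "d \<in> {c. c *s u \<in> ?Y}"
      show "c * d \<in> {c. c *s u \<in> ?Y}"
        using d V.subspace_scale[OF Y_sub, of "d *s u" c] by simp
      assume "c \<in> {c. c *s u \<in> ?Y}"
      then show "c + d \<in> {c. c *s u \<in> ?Y}"
        using d V.subspace_add[OF Y_sub] by (simp add: V.scale_left_distrib)
    qed
    then show ?thesis by simp
  qed
  have "W (Suc n) \<subseteq> \<phi> ` ?Y"
  proof (rule W_least[OF img_sub[OF Y_sub YD]])
    fix a m assume a: "a \<in> \<mm> [^]\<^bsub>ideals_set R\<^esub> Suc n" and m: "m \<in> carrier M"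
    from a have "a \<in> ideal_prod R (\<mm> [^]\<^bsub>ideals_set R\<^esub> n) \<mm>" unfolding ideal_power_Suc .
    then have "a \<in> carrier R \<and> a \<odot>\<^bsub>M\<^esub> m \<in> \<phi> ` ?Y"
    proof (induction rule: ideal_prod.induct)
      case (prod i j)
      then have ij: "i \<in> carrier R" "j \<in> carrier R" using power_carrier ideal.Icarr[OF ideal] by blast+
      have "i \<odot>\<^bsub>M\<^esub> m \<in> W n" using W_mem prod(1) m by blast
      moreover obtain c where c: "\<rho> c = j" using rho_surj ij by blast
      ultimately obtain u where u: "u \<in> D" "\<phi> u = i \<odot>\<^bsub>M\<^esub> m" "u \<in> pre (W n)"
        using phi_surj[of "i \<odot>\<^bsub>M\<^esub> m"] ij m by (auto simp: pre_def)
      have "(i \<otimes>\<^bsub>R\<^esub> j) \<odot>\<^bsub>M\<^esub> m = j \<odot>\<^bsub>M\<^esub> (i \<odot>\<^bsub>M\<^esub> m)"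
        using ij m M.smult_assoc1[of j i m] M.R.m_comm by simp
      then have "(i \<otimes>\<^bsub>R\<^esub> j) \<odot>\<^bsub>M\<^esub> m = \<phi> (c *s u)" using phi_scale[OF u(1)] u(2) c by simp
      then show ?case using key[of c u] c prod(2) u(3) ij by auto
    next
      case (sum s1 s2)
      then have "(s1 \<oplus>\<^bsub>R\<^esub> s2) \<odot>\<^bsub>M\<^esub> m = s1 \<odot>\<^bsub>M\<^esub> m \<oplus>\<^bsub>M\<^esub> s2 \<odot>\<^bsub>M\<^esub> m"
        using M.smult_l_distr m by blast
      then show ?case using sum M.submoduleE(5)[OF img_sub[OF Y_sub YD]] by auto
    qed
    then show "a \<odot>\<^bsub>M\<^esub> m \<in> \<phi> ` ?Y" ..
  qed
  then show "pre (W (Suc n)) \<subseteq> ?Y" using pre_img[OF Y_sub kerY YD] by (auto simp: pre_def)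
  have "a *s v \<in> pre (W (Suc n))" if a: "a \<in> set as" and v: "v \<in> pre (W n)" for a v
  proof -
    have "a * 1 \<in> ring.Fil Z as (Suc 0)" by (rule ring.Fil_mult[OF Z(1) a]) (simp add: ring.Fil_0)
    then have a_mm: "\<rho> a \<in> \<mm>" using mm by simp
    \<comment> \<open>The elements that \<open>a\<close> carries into the next power form a
      submodule, so it suffices to test the generators of \<open>W n\<close>.\<close>
    let ?H = "{w \<in> D. a *s w \<in> pre (W (Suc n))}"
    have H: "V.subspace ?H"
      using V.subspace_0[OF D] V.subspace_add[OF D] V.subspace_scale[OF D]
        V.subspace_0[OF pre_sub[OF W_sub]] V.subspace_add[OF pre_sub[OF W_sub]] V.subspace_scale[OF pre_sub[OF W_sub]]
      by (intro V.subspaceI) (auto simp: V.scale_right_distrib V.scale_left_commute[of a] simp del: V.scale_scale)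
    have kerH: "ker \<subseteq> ?H"
      using V.subspace_scale[OF ker_sub, of _ a] ker_pre[OF W_sub] by (auto simp: ker_def pre_def)
    have "W n \<subseteq> \<phi> ` ?H"
    proof (rule W_least[OF img_sub[OF H]])
      fix b m assume b: "b \<in> \<mm> [^]\<^bsub>ideals_set R\<^esub> n" and m: "m \<in> carrier M"
      have bc: "b \<in> carrier R" using b power_carrier by blast
      obtain w where w: "w \<in> D" "\<phi> w = b \<odot>\<^bsub>M\<^esub> m" using phi_surj[of "b \<odot>\<^bsub>M\<^esub> m"] bc m by auto
      have "b \<otimes>\<^bsub>R\<^esub> \<rho> a \<in> \<mm> [^]\<^bsub>ideals_set R\<^esub> Suc n"
        unfolding ideal_power_Suc by (rule ideal_prod.prod[OF b a_mm])
      then have "(b \<otimes>\<^bsub>R\<^esub> \<rho> a) \<odot>\<^bsub>M\<^esub> m \<in> W (Suc n)" using m by (rule W_mem)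
      moreover have "(b \<otimes>\<^bsub>R\<^esub> \<rho> a) \<odot>\<^bsub>M\<^esub> m = \<phi> (a *s w)"
        unfolding M.R.m_comm[OF bc rho_closed] M.smult_assoc1[OF rho_closed bc m] phi_scale[OF w(1)] w(2) ..
      ultimately have "\<phi> (a *s w) \<in> W (Suc n)" by (rule back_subst[of "\<lambda>z. z \<in> W (Suc n)"])
      then have "w \<in> ?H" using w(1) V.subspace_scale[OF D w(1), of a] unfolding pre_def by blast
      then show "b \<odot>\<^bsub>M\<^esub> m \<in> \<phi> ` ?H" unfolding w(2)[symmetric] by (rule imageI)
    qed blast
    then have "pre (W n) \<subseteq> ?H" using pre_img[OF H kerH] by (auto simp: pre_def)
    then show ?thesis using v by blast
  qed
  then show "?Y \<subseteq> pre (W (Suc n))"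
    using ker_pre[OF W_sub] by (intro V.span_minimal pre_sub[OF W_sub]) auto
qed

lemma W_antimono: "pre (W (Suc n)) \<subseteq> pre (W n)"
  unfolding W_Suc using ker_pre[OF W_sub] V.subspace_scale[OF pre_sub[OF W_sub]]
  by (intro V.span_minimal pre_sub[OF W_sub]) auto

lemma hilbert_fun_len: "hilbert_fun R \<mm> M n = the_enat (V.len (pre (W (Suc n))) (pre (W n)))"
proof -
  have mod: "module R (M\<lparr>carrier := W n\<rparr>)"
    by (rule submodule.submodule_is_module[OF W_sub M.module_axioms])
  interpret N: presented scale R "M\<lparr>carrier := W n\<rparr>" \<rho> \<phi> "pre (W n)"
  proof (intro presented.intro semilinear.intro semilinear_axioms.intro presented_axioms.intro V.pmod_axioms mod)
    show "V.subspace (pre (W n))" by (rule pre_sub[OF W_sub])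
    show "\<exists>v\<in>pre (W n). \<phi> v = m" if m: "m \<in> carrier (M\<lparr>carrier := W n\<rparr>)" for m
    proof -
      have "m \<in> W n" using m by simp
      then show ?thesis using img_pre[OF W_carrier, of n] by (metis imageE)
    qed
    show "\<phi> v \<in> carrier (M\<lparr>carrier := W n\<rparr>)" if "v \<in> pre (W n)" for v
      using that by (simp add: pre_def)
    show "\<phi> (v + w) = \<phi> v \<oplus>\<^bsub>M\<lparr>carrier := W n\<rparr>\<^esub> \<phi> w" if "v \<in> pre (W n)" "w \<in> pre (W n)" for v w
      using that phi_add by (simp add: pre_def)
    show "\<phi> (c *s v) = \<rho> c \<odot>\<^bsub>M\<lparr>carrier := W n\<rparr>\<^esub> \<phi> v" if "v \<in> pre (W n)" for c v
      using that phi_scale by (simp add: pre_def)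
  qed (fact rho_closed rho_surj)+
  have pre_eq: "N.pre (W (Suc n)) = pre (W (Suc n))"
    unfolding N.pre_def using W_antimono by (auto simp: pre_def)
  have "submodule (\<phi> ` pre (W (Suc n))) R (M\<lparr>carrier := W n\<rparr>)"
    by (rule N.img_sub[OF pre_sub[OF W_sub] W_antimono])
  then have "submodule (W (Suc n)) R (M\<lparr>carrier := W n\<rparr>)" by (simp add: img_pre[OF W_carrier])
  from N.module_length_quot[OF this] show ?thesis
    unfolding hilbert_fun_def pre_eq by (simp add: W_def)
qed

end

end


section \<open>Local rings and presentations\<close>

lemma enat_le_SupE:
  assumes "enat n \<le> Sup {enat (f z) | z. P z}" "0 < n"
  obtains z where "P z" "n \<le> f z"
proof (rule ccontr)
  assume "\<not> thesis"
  then have "\<And>z. P z \<Longrightarrow> f z \<le> n - 1" using that assms(2) by (metis Suc_pred' less_Suc_eq_le not_le_imp_less)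
  then have "Sup {enat (f z) | z. P z} \<le> enat (n - 1)" by (intro Sup_least) auto
  then have "enat n \<le> enat (n - 1)" using assms(1) by (rule order_trans[rotated])
  then show False using assms(2) by simp
qed

lemma depth_geE:
  assumes "enat n \<le> depth R \<mm> M" "0 < n"
  obtains xs where "set xs \<subseteq> \<mm>" "regular_sequence R M xs" "n \<le> length xs"
  by (rule enat_le_SupE[OF assms(1)[unfolded depth_def] assms(2)]) (use that in blast)

lemma krull_dim_eq: "krull_dim R = chain_length (\<lambda>P. primeideal P R)"
  by (simp add: krull_dim_def chain_length_def)

lemma krull_dim_iso_le:
  assumes "cring R" "cring S" "h \<in> ring_iso R S"
  shows "krull_dim S \<le> krull_dim R"
  unfolding krull_dim_eq
proof (rule chain_length_le_map[of _ _ "\<lambda>Q. {r \<in> carrier R. h r \<in> Q}"])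
  interpret R: cring R by fact
  interpret S: cring S by fact
  interpret h: ring_hom_ring R S h
    by (rule ring_hom_ringI2) (use assms R.ring_axioms S.ring_axioms in \<open>auto simp: ring_iso_def\<close>)
  show "primeideal {r \<in> carrier R. h r \<in> Q} R" if "primeideal Q S" for Q
    by (rule h.primeideal_vimage[OF assms(1) that])
  fix X Y assume Y: "primeideal Y S" and XY: "X \<subset> Y"
  then obtain s where s: "s \<in> Y" "s \<notin> X" by blast
  then have "s \<in> carrier S" by (intro ideal.Icarr[OF primeideal.axioms(1)[OF Y]])
  moreover have "h ` carrier R = carrier S" using assms(3) by (simp add: ring_iso_def bij_betw_def)
  ultimately obtain r where "r \<in> carrier R" "h r = s" by (metis imageE)
  then show "{r \<in> carrier R. h r \<in> X} \<subset> {r \<in> carrier R. h r \<in> Y}" using s XY by blast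
qed

text \<open>\<open>module_dim\<close> passes to the quotient by the annihilator, which is zero for
  the ring itself; the isomorphism with that quotient preserves chains of primes.\<close>

lemma krull_dim_quot_zero:
  assumes "cring R"
  shows "krull_dim (R Quot {\<zero>\<^bsub>R\<^esub>}) = krull_dim R"
proof -
  interpret R: cring R by fact
  have I: "ideal {\<zero>\<^bsub>R\<^esub>} R" by (rule R.zeroideal)
  interpret I: ideal "{\<zero>\<^bsub>R\<^esub>}" R by (rule I)
  have q: "cring (R Quot {\<zero>\<^bsub>R\<^esub>})" by (rule I.quotient_is_cring[OF assms])
  have iso: "(+>\<^bsub>R\<^esub>) {\<zero>\<^bsub>R\<^esub>} \<in> ring_iso R (R Quot {\<zero>\<^bsub>R\<^esub>})"
  proof -
    have "inj_on ((+>\<^bsub>R\<^esub>) {\<zero>\<^bsub>R\<^esub>}) (carrier R)"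
      by (rule inj_onI) (simp add: a_r_coset_def')
    moreover have "(+>\<^bsub>R\<^esub>) {\<zero>\<^bsub>R\<^esub>} ` carrier R = carrier (R Quot {\<zero>\<^bsub>R\<^esub>})"
      by (auto simp: FactRing_def A_RCOSETS_def')
    ultimately show ?thesis using I.rcos_ring_hom by (simp add: ring_iso_def bij_betw_def)
  qed
  from krull_dim_iso_le[OF assms q iso]
    krull_dim_iso_le[OF q assms ring_iso_set_sym[OF R.ring_axioms iso]]
  show ?thesis by (rule antisym)
qed

lemma ring_module_is_module:
  assumes "cring R"
  shows "module R (ring_module R)"
proof -
  interpret R: cring R by fact
  have "abelian_group (ring_module R)"
  proof (rule abelian_groupI)
    show "\<exists>y\<in>carrier (ring_module R). y \<oplus>\<^bsub>ring_module R\<^esub> x = \<zero>\<^bsub>ring_module R\<^esub>"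
      if "x \<in> carrier (ring_module R)" for x
      using that R.l_neg[of x] by (auto simp: ring_module_def intro!: bexI[of _ "\<ominus>\<^bsub>R\<^esub> x"])
  qed (auto simp: ring_module_def R.a_ac)
  then show ?thesis
    by (intro moduleI assms) (auto simp: ring_module_def R.l_distr R.r_distr R.m_assoc)
qed

locale presented_local = noetherian_local_ring R \<mm>
  for R :: "('a, 'r) ring_scheme" (structure) and \<mm> :: "'a set" +
  fixes \<pi> :: "'p::comm_ring_1 \<Rightarrow> 'a"
  assumes pi_closed: "\<pi> p \<in> carrier R"
    and pi_add: "\<pi> (p + q) = \<pi> p \<oplus> \<pi> q"
    and pi_mult: "\<pi> (p * q) = \<pi> p \<otimes> \<pi> q"
    and pi_one: "\<pi> 1 = \<one>"
    and pi_surj: "carrier R \<subseteq> range \<pi>"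
begin

definition Z :: "'p set"
  where "Z = {p. \<pi> p = \<zero>}"

lemma pi_surjE: "a \<in> carrier R \<Longrightarrow> \<exists>p. \<pi> p = a"
  using pi_surj by blast

sublocale RM: presented "(*)" R "ring_module R" \<pi> \<pi> UNIV
proof (intro presented.intro semilinear.intro semilinear_axioms.intro presented_axioms.intro pmod_times
    ring_module_is_module is_cring)
  show "\<exists>v\<in>UNIV. \<pi> v = m" if "m \<in> carrier (ring_module R)" for m
    using that pi_surjE by (simp add: ring_module_def)
qed (use pi_closed pi_add pi_mult pi_surjE in \<open>auto simp: ring_module_def\<close>)

lemma RM_ker: "RM.ker = Z"
  unfolding RM.ker_def RM.pre_def Z_def by (simp add: ring_module_def)

lemma Z_sub: "ring.subspace Z"
  using RM.ker_sub by (simp add: RM_ker)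

lemma pi_0: "\<pi> 0 = \<zero>"
  using ring.subspace_0[OF Z_sub] by (simp add: Z_def)

lemma vimage_sub:
  assumes "ideal J R"
  shows "ring.subspace (\<pi> -` J)" "Z \<subseteq> \<pi> -` J"
proof -
  interpret J: ideal J R by fact
  show "ring.subspace (\<pi> -` J)"
    by (rule ring.subspaceI) (auto simp: pi_0 pi_add pi_mult pi_closed J.I_l_closed)
  show "Z \<subseteq> \<pi> -` J" by (auto simp: Z_def)
qed

lemma image_ideal:
  assumes "ring.subspace C"
  shows "ideal (\<pi> ` C) R"
proof (rule idealI)
  show "ring R" by (rule ring_axioms)
  have "submodule (\<pi> ` C) R (ring_module R)" using RM.img_sub[OF assms] by simp
  then have sub: "subgroup (\<pi> ` C) (add_monoid (ring_module R))" by (rule submodule.axioms)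
  show "subgroup (\<pi> ` C) (add_monoid R)"
    using sub by (simp add: subgroup_def ring_module_def m_inv_def)
  fix a x assume "a \<in> \<pi> ` C" "x \<in> carrier R"
  then obtain p q where "p \<in> C" "a = \<pi> p" "x = \<pi> q" using pi_surjE by blast
  then show "x \<otimes> a \<in> \<pi> ` C" "a \<otimes> x \<in> \<pi> ` C"
    using ring.subspace_scale[OF assms, of p q] by (auto simp: pi_mult[symmetric] mult.commute)
qed

lemma vimage_image:
  assumes "ring.subspace C" "Z \<subseteq> C"
  shows "\<pi> -` \<pi> ` C = C"
  using RM.pre_img[OF assms(1)] assms(2) by (simp add: RM_ker RM.pre_def vimage_def)

lemma acc_Z: "ring.acc Z"
  unfolding ring.acc_def
proof (intro allI impI)
  fix N :: "nat \<Rightarrow> 'p set"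
  assume N: "\<forall>k. ring.subspace (N k) \<and> Z \<subseteq> N k \<and> N k \<subseteq> N (Suc k)"
  have mono: "N i \<subseteq> N j" if "i \<le> j" for i j using lift_Suc_mono_le[of N] N that by auto
  let ?C = "range (\<lambda>k. \<pi> ` N k)"
  have "subset.chain {I. ideal I R} ?C"
    unfolding subset_chain_def
  proof (intro conjI ballI)
    show "?C \<subseteq> {I. ideal I R}" using N image_ideal by blast
    fix X Y assume "X \<in> ?C" "Y \<in> ?C"
    then obtain i j where "X = \<pi> ` N i" "Y = \<pi> ` N j" by blast
    then show "X \<subseteq> Y \<or> Y \<subseteq> X" using mono[of i j] mono[of j i] by (meson image_mono nat_le_linear)
  qed
  then have "\<Union>?C \<in> ?C" by (intro ideal_chain_is_trivial) auto
  then obtain k where k: "\<Union>?C = \<pi> ` N k" by blast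
  have "N j = N k" if "j \<ge> k" for j
  proof -
    have "\<pi> ` N j \<subseteq> \<pi> ` N k" using k by blast
    then have "\<pi> -` \<pi> ` N j \<subseteq> \<pi> -` \<pi> ` N k" by blast
    then show ?thesis using vimage_image N mono[OF that] by blast
  qed
  then show "\<exists>k. \<forall>j\<ge>k. N j = N k" by blast
qed

definition nn :: "'p set"
  where "nn = \<pi> -` \<mm>"

lemma max_ideal: "ideal \<mm> R" and one_notin: "\<one> \<notin> \<mm>"
proof -
  interpret m: maximalideal \<mm> R by (rule maximal)
  show "ideal \<mm> R" by (rule m.ideal_axioms)
  show "\<one> \<notin> \<mm>" using m.I_notcarr m.one_imp_carrier by blast
qed

lemma nn_sub: "ring.subspace nn" and Z_nn: "Z \<subseteq> nn" and one_nn: "1 \<notin> nn"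
  using vimage_sub[OF max_ideal] one_notin by (auto simp: nn_def pi_one)

text \<open>In a local ring the nonunits form the maximal ideal. A maximal ideal containing a
  nonunit \<open>p\<close> is obtained from the chain condition, and uniqueness identifies it with
  \<open>\<mm>\<close>.\<close>

lemma nn_iff: "p \<in> nn \<longleftrightarrow> \<not> (\<exists>v. p * v - 1 \<in> Z)"
proof
  assume p: "p \<in> nn"
  show "\<not> (\<exists>v. p * v - 1 \<in> Z)"
  proof
    assume "\<exists>v. p * v - 1 \<in> Z"
    then obtain v where "p * v - 1 \<in> nn" using Z_nn by blast
    then have "v * p - (p * v - 1) \<in> nn" using ring.subspace_scale[OF nn_sub p] ring.subspace_diff[OF nn_sub] by blast
    then show False using one_nn by (simp add: mult.commute)
  qed
next
  assume no: "\<not> (\<exists>v. p * v - 1 \<in> Z)"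
  let ?F = "{C. ring.subspace C \<and> ring.span (Z \<union> {p}) \<subseteq> C \<and> 1 \<notin> C}"
  have Z_span: "Z \<union> {p} \<subseteq> ring.span (Z \<union> {p})" by (rule ring.span_superset)
  have "1 \<notin> ring.span (Z \<union> {p})"
  proof
    assume "1 \<in> ring.span (Z \<union> {p})"
    then obtain c v where "c \<in> Z" "1 = c + v * p" using span_insert_ideal[OF Z_sub] by blast
    then have "p * v - 1 = - c" by (simp add: algebra_simps)
    then show False using no ring.subspace_neg[OF Z_sub \<open>c \<in> Z\<close>] by metis
  qed
  then have "ring.span (Z \<union> {p}) \<in> ?F" by simp
  then obtain C where C: "C \<in> ?F" "\<And>C'. C' \<in> ?F \<Longrightarrow> C \<subseteq> C' \<Longrightarrow> C' = C"
    by (rule ring.acc_maximal[OF acc_Z, of _ ?F]) (use Z_span in auto)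
  have ZC: "Z \<subseteq> C" and pC: "p \<in> C" and Cs: "ring.subspace C" using C(1) Z_span by auto
  have "maximalideal (\<pi> ` C) R"
  proof (rule maximalidealI[OF image_ideal[OF Cs]])
    show "carrier R \<noteq> \<pi> ` C"
    proof
      assume "carrier R = \<pi> ` C"
      then have "1 \<in> \<pi> -` \<pi> ` C" using pi_one by auto
      then show False using vimage_image[OF Cs ZC] C(1) by simp
    qed
    fix J assume J: "ideal J R" "\<pi> ` C \<subseteq> J" "J \<subseteq> carrier R"
    show "J = \<pi> ` C \<or> J = carrier R" 
    proof (cases "1 \<in> \<pi> -` J")
      case True
      then show ?thesis using J(1) pi_one ideal.one_imp_carrier by auto
    next
      case False
      have "C \<subseteq> \<pi> -` J" using J(2) by blast
      then have "\<pi> -` J = C" using False vimage_sub[OF J(1)] C(1) by (intro C(2)) auto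
      then have "J = \<pi> ` C" using J(3) pi_surj by (metis image_vimage_eq inf.absorb1 order_trans)
      then show ?thesis ..
    qed
  qed
  then have "\<pi> ` C = \<mm>" by (rule maximal_unique)
  then show "p \<in> nn" using pC by (auto simp: nn_def)
qed

lemma ex_generators: "\<exists>as. ring.Fil Z as 1 = nn"
proof -
  obtain S where S: "S \<subseteq> carrier R" "finite S" "\<mm> = Idl S" using finetely_gen[OF max_ideal] by blast
  obtain s where s: "\<And>a. a \<in> carrier R \<Longrightarrow> \<pi> (s a) = a" using pi_surjE by metis
  obtain as0 where as0: "set as0 = S" using finite_list[OF S(2)] by blast
  let ?as = "map s as0"
  have "ring.Fil Z ?as 1 = nn"
  proof
    have S_mm: "S \<subseteq> \<mm>" using genideal_self[OF S(1)] S(3) by simp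
    have "a * v \<in> nn" if a: "a \<in> set ?as" for a v
    proof -
      obtain b where b: "b \<in> S" "a = s b" using a as0 unfolding set_map by blast
      then have "\<pi> a \<in> \<mm>" using s[of b] S(1) S_mm by (simp add: subset_iff)
      then have "a \<in> nn" by (simp add: nn_def)
      then show ?thesis using ring.subspace_scale[OF nn_sub, of a v] by (simp add: mult.commute)
    qed
    then show "ring.Fil Z ?as 1 \<subseteq> nn"
      using ring.Fil_Suc[OF Z_sub, of ?as 0] Z_nn
        ring.span_minimal[OF _ nn_sub, of "Z \<union> {a * x |a x. a \<in> set ?as \<and> x \<in> ring.Fil Z ?as 0}"] by auto
    have "S \<subseteq> \<pi> ` ring.Fil Z ?as 1"
    proof
      fix b assume b: "b \<in> S"
      have "s b * 1 \<in> ring.Fil Z ?as (Suc 0)"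
        by (rule ring.Fil_mult[OF Z_sub]) (use b as0 in \<open>auto simp: ring.Fil_0\<close>)
      then show "b \<in> \<pi> ` ring.Fil Z ?as 1" using s[of b] b S(1) by force
    qed
    then have "\<mm> \<subseteq> \<pi> ` ring.Fil Z ?as 1"
      unfolding S(3) by (rule genideal_minimal[OF image_ideal[OF ring.subspace_Fil]])
    then show "nn \<subseteq> ring.Fil Z ?as 1"
      using vimage_image[OF ring.subspace_Fil ring.Fil_base] unfolding nn_def by blast
  qed
  then show ?thesis by blast
qed

lemma prime_image:
  assumes "prime_ideal C" "Z \<subseteq> C"
  shows "primeideal (\<pi> ` C) R"
proof (rule primeidealI)
  have C: "ring.subspace C" "1 \<notin> C" "\<And>a b. a * b \<in> C \<Longrightarrow> a \<in> C \<or> b \<in> C"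
    using assms(1) by (auto simp: prime_ideal_def)
  note vi = vimage_image[OF C(1) assms(2)]
  show "ideal (\<pi> ` C) R" by (rule image_ideal[OF C(1)])
  show "cring R" by (rule is_cring)
  show "carrier R \<noteq> \<pi> ` C"
  proof
    assume "carrier R = \<pi> ` C"
    then have "1 \<in> \<pi> -` \<pi> ` C" using pi_one by auto
    then show False using vi C(2) by simp
  qed
  fix a b assume "a \<in> carrier R" "b \<in> carrier R" "a \<otimes> b \<in> \<pi> ` C"
  then obtain p q where pq: "a = \<pi> p" "b = \<pi> q" "p * q \<in> \<pi> -` \<pi> ` C" using pi_surjE by (metis pi_mult vimageI)
  then show "a \<in> \<pi> ` C \<or> b \<in> \<pi> ` C" using vi C(3) by blast
qed

lemma no_long_chain:
  assumes "krull_dim R = 2" "prime_ideal C" "prime_ideal D" "prime_ideal E" "prime_ideal F"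
    "Z \<subseteq> C" "C \<subset> D" "D \<subset> E" "E \<subset> F"
  shows False
proof -
  let ?P = "\<lambda>i::nat. \<pi> ` (if i = 0 then C else if i = 1 then D else if i = 2 then E else F)"
  have strict: "\<pi> ` X \<subset> \<pi> ` Y" if "X \<subset> Y" "ring.subspace X" "Z \<subseteq> X" for X Y
    using vimage_image[OF that(2,3)] that(1) by blast
  have sub: "ring.subspace C" "ring.subspace D" "ring.subspace E" using assms by (auto simp: prime_ideal_def)
  have "enat 3 \<le> krull_dim R" unfolding krull_dim_eq
  proof (rule chain_length_geI[of _ _ ?P])
    fix i :: nat assume "i \<le> 3"
    show "primeideal (?P i) R" using prime_image assms by auto
  next
    fix i :: nat assume "i < 3"
    then consider "i = 0" | "i = 1" | "i = 2" by linarith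
    then show "?P i \<subset> ?P (Suc i)"
      by cases (use strict[OF assms(7) sub(1)] strict[OF assms(8) sub(2)] strict[OF assms(9) sub(3)] assms in auto)
  qed
  then show False using assms(1) by (simp add: numeral_eq_enat)
qed

end


section \<open>Hilbert functions of presented modules\<close>

context presented_local
begin

lemma regular_pair:
  assumes depth: "enat 2 \<le> depth R \<mm> (ring_module R)"
  obtains x y where "x \<in> nn" "y \<in> nn" "\<And>b. x * b \<in> Z \<Longrightarrow> b \<in> Z"
    "\<And>b c. y * b - x * c \<in> Z \<Longrightarrow> \<exists>d. b - x * d \<in> Z"
proof -
  obtain xs where xs: "set xs \<subseteq> \<mm>" "regular_sequence R (ring_module R) xs" "2 \<le> length xs"
    by (rule depth_geE[OF depth]) simp
  have len: "0 < length xs" "1 < length xs" using xs(3) by auto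
  have xs_mm: "xs ! 0 \<in> \<mm>" "xs ! 1 \<in> \<mm>" using xs(1) len by (auto simp: subset_iff)
  then have "xs ! 0 \<in> carrier R" "xs ! 1 \<in> carrier R" using ideal.Icarr[OF max_ideal] by auto
  then obtain x y where xy: "\<pi> x = xs ! 0" "\<pi> y = xs ! 1" using pi_surjE by metis
  have x_carr: "{\<pi> x} \<subseteq> carrier R" using pi_closed by simp
  define L where "L = ideal_smult R (Idl {\<pi> x}) (ring_module R)"
  have Idl: "ideal (Idl {\<pi> x}) R" by (rule genideal_ideal[OF x_carr])
  have L_sub: "submodule L R (ring_module R)"
    unfolding L_def using ideal.Icarr[OF Idl] by (intro RM.ideal_smult_sub) blast
  have ZL: "Z \<subseteq> RM.pre L" using RM.ker_pre[OF L_sub] by (simp add: RM_ker)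
  have nzd: "nonzerodivisor_on (\<pi> y) (quot_module (ring_module R) L)"
  proof -
    have "take 1 xs = [xs ! 0]" using len by (cases xs) auto
    moreover have "nonzerodivisor_on (xs ! 1)
        (quot_module (ring_module R) (ideal_smult R (Idl (set (take 1 xs))) (ring_module R)))"
      using xs(2) len(2) unfolding regular_sequence_def by blast
    ultimately show ?thesis unfolding L_def xy by simp
  qed
  \<comment> \<open>The preimage of the principal ideal of \<open>\<pi> x\<close>, described by
    elements. That \<open>L\<close> lies in its image yields the witness \<open>d\<close> at the
    end.\<close>
  define C where "C = {b. \<exists>d. b - x * d \<in> Z}"
  have C_sub: "ring.subspace C"
  proof (rule ring.subspaceI)
    show "0 \<in> C" unfolding C_def using ring.subspace_0[OF Z_sub] by (auto intro: exI[of _ 0])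
    fix b b' assume "b \<in> C" "b' \<in> C"
    then obtain d d' where "b - x * d \<in> Z" "b' - x * d' \<in> Z" unfolding C_def by blast
    then have "(b - x * d) + (b' - x * d') \<in> Z" by (rule ring.subspace_add[OF Z_sub])
    then have "b + b' - x * (d + d') \<in> Z" by (simp add: algebra_simps)
    then show "b + b' \<in> C" unfolding C_def by blast
  next
    fix c b assume "b \<in> C"
    then obtain d where "b - x * d \<in> Z" unfolding C_def by blast
    then have "c * (b - x * d) \<in> Z" by (rule ring.subspace_scale[OF Z_sub])
    moreover have "c * (b - x * d) = c * b - x * (c * d)"
      unfolding right_diff_distrib mult.left_commute[of c x] ..
    ultimately have "c * b - x * (c * d) \<in> Z" by simp
    then show "c * b \<in> C" unfolding C_def by blast
  qed
  have ZC: "Z \<subseteq> C" unfolding C_def by (auto intro: exI[of _ 0])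
  have "x \<in> C" unfolding C_def using ring.subspace_0[OF Z_sub] by (auto intro: exI[of _ 1])
  then have "Idl {\<pi> x} \<subseteq> \<pi> ` C" by (intro genideal_minimal image_ideal[OF C_sub]) auto
  then have "L \<subseteq> \<pi> ` C" unfolding L_def ideal_smult_def gen_submodule_def
  proof (intro Inter_lower, simp, intro conjI)
    show "submodule (\<pi> ` C) R (ring_module R)" by (rule RM.img_sub[OF C_sub]) simp
    assume "Idl {\<pi> x} \<subseteq> \<pi> ` C"
    then show "{a \<odot>\<^bsub>ring_module R\<^esub> b |a b. a \<in> Idl {\<pi> x} \<and> b \<in> carrier (ring_module R)} \<subseteq> \<pi> ` C"
      using ideal.I_r_closed[OF image_ideal[OF C_sub]] by (auto simp: ring_module_def)
  qed
  then have LC: "RM.pre L \<subseteq> C"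
    using vimage_image[OF C_sub ZC] unfolding RM.pre_def by blast
  show thesis
  proof (rule that)
    show "x \<in> nn" "y \<in> nn" using xs_mm xy by (auto simp: nn_def)
    show "b \<in> Z" if "x * b \<in> Z" for b
      using RM.first_regular[OF xs(2) len(1) xy(1), of b] that by (simp add: RM_ker)
    fix b c assume bc: "y * b - x * c \<in> Z"
    have "\<pi> x \<in> Idl {\<pi> x}" using genideal_self[OF x_carr] by simp
    then have "\<pi> x \<odot>\<^bsub>ring_module R\<^esub> \<pi> c \<in> L"
      unfolding L_def ideal_smult_def gen_submodule_def using RM.phi_closed[of c] by blast
    then have "x * c \<in> RM.pre L" unfolding RM.pre_def by (simp add: ring_module_def pi_mult)
    then have "(y * b - x * c) + x * c \<in> RM.pre L"
      using bc ZL ring.subspace_add[OF RM.pre_sub[OF L_sub]] by blast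
    then have "y * b \<in> RM.pre L" by simp
    then have "b \<in> RM.pre L" using RM.quot_nonzerodivisor[OF L_sub nzd] by simp
    then show "\<exists>d. b - x * d \<in> Z" using LC by (auto simp: C_def)
  qed
qed

lemma ex_local_data:
  assumes "krull_dim R = 2" "enat 2 \<le> depth R \<mm> (ring_module R)"
  obtains as x y k where "local_data Z as x y k" "ring.Fil Z as 1 = nn"
proof -
  obtain as where as: "ring.Fil Z as 1 = nn" using ex_generators by blast
  obtain x y where xy: "x \<in> nn" "y \<in> nn" "\<And>b. x * b \<in> Z \<Longrightarrow> b \<in> Z"
    "\<And>b c. y * b - x * c \<in> Z \<Longrightarrow> \<exists>d. b - x * d \<in> Z"
    using regular_pair[OF assms(2)] by blast
  have unit: "\<And>u. u \<notin> ring.Fil Z as 1 \<Longrightarrow> \<exists>v. u * v - 1 \<in> Z" using nn_iff as by blast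
  have "\<exists>k. ring.Fil Z as k \<subseteq> ring.Fil Z [x, y] 1"
    by (rule regular_pair_primary[OF acc_Z Z_sub])
      (use as one_nn unit xy no_long_chain[OF assms(1)] in blast)+
  then obtain k where "ring.Fil Z as k \<subseteq> ring.Fil Z [x, y] 1" by blast
  then have "local_data Z as x y k"
    unfolding local_data_def using Z_sub acc_Z as one_nn unit xy by blast
  then show thesis using as by (rule that)
qed

lemma hilbert_fun_ring:
  assumes ld: "local_data Z as x y k" and as: "ring.Fil Z as 1 = nn"
  shows "hilbert_fun R \<mm> (ring_module R) s = local_data.h Z as s"
proof -
  have z: "\<pi> z = \<zero>" if "z \<in> Z" for z using that by (simp add: Z_def)
  have m: "\<pi> c \<in> \<mm> \<longleftrightarrow> c \<in> ring.Fil Z as 1" for c using as by (simp add: nn_def)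
  note ctx = max_ideal Z_sub z m
  have W: "RM.pre (RM.W \<mm> s) = ring.Fil Z as s" for s
  proof (induction s)
    case 0
    then show ?case using RM.W_0[OF ctx] by (simp add: ring.Fil_0)
  next
    case (Suc s)
    have "RM.pre (RM.W \<mm> (Suc s)) = ring.span (RM.ker \<union> {a * v | a v. a \<in> set as \<and> v \<in> RM.pre (RM.W \<mm> s)})"
      by (rule RM.W_Suc[OF ctx])
    then show ?case unfolding RM_ker Suc ring.Fil_Suc[OF Z_sub] .
  qed
  have "hilbert_fun R \<mm> (ring_module R) s = the_enat (ring.len (RM.pre (RM.W \<mm> (Suc s))) (RM.pre (RM.W \<mm> s)))"
    by (rule RM.hilbert_fun_len[OF ctx])
  then show ?thesis unfolding W local_data.len_h[OF ld] by simp
qed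

text \<open>The embedding dimension is read off by presenting the maximal ideal as the module
  \<open>nn / Z\<close>, for which \<open>len_nmul\<close> equates the number of generators with a
  length. The rest carries minimal generating sets between \<open>R\<close> and
  \<open>P\<close>.\<close>

lemma min_gens_ideal:
  assumes ld: "local_data Z as x y k" and as: "ring.Fil Z as 1 = nn"
  shows "min_gens R ((ring_module R)\<lparr>carrier := \<mm>\<rparr>) = local_data.h Z as 1"
proof -
  let ?M = "(ring_module R)\<lparr>carrier := \<mm>\<rparr>"
  interpret L: local_data Z as x y k by (rule ld)
  interpret m: ideal \<mm> R by (rule max_ideal)
  have sub: "submodule \<mm> R (ring_module R)"
    using RM.img_sub[OF nn_sub] pi_surj m.Icarr by (simp add: nn_def image_vimage_eq inf.absorb1 subset_iff)
  interpret N: presented "(*)" R ?M \<pi> \<pi> nn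
  proof (intro presented.intro semilinear.intro semilinear_axioms.intro presented_axioms.intro pmod_times
      submodule.submodule_is_module[OF sub RM.M.module_axioms] nn_sub)
    show "\<exists>v\<in>nn. \<pi> v = a" if "a \<in> carrier ?M" for a
      using that pi_surjE[of a] m.Icarr by (auto simp: nn_def)
  qed (use pi_closed pi_surjE in \<open>auto simp: ring_module_def nn_def pi_add pi_mult\<close>)
  have ker: "N.ker = Z"
    using Z_nn unfolding N.ker_def N.pre_def by (auto simp: ring_module_def Z_def)
  have fg: "\<exists>T. finite T \<and> T \<subseteq> nn \<and> nn = ring.span (Z \<union> T)"
    by (rule ring.acc_finitely_generated[OF acc_Z nn_sub Z_nn]) blast
  interpret LM: local_module Z as x y k "(*)" Z nn
  proof (intro local_module.intro local_module_axioms.intro ld pmod_times Z_sub nn_sub Z_nn fg)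
    show "z * v \<in> Z" if "z \<in> Z" for z v using ring.subspace_scale[OF Z_sub that, of v] by (simp add: mult.commute)
  qed
  have "LM.nmul nn = ring.Fil Z as (Suc 1)" unfolding LM.nmul_def ring.Fil_Suc[OF Z_sub] as ..
  then have h1: "LM.gens = L.h 1" using LM.len_nmul L.len_h[of 1] as by simp
  obtain T where T: "finite T" "card T = LM.gens" "T \<subseteq> nn" "nn = ring.span (Z \<union> T)"
  proof -
    have "\<exists>r T. finite T \<and> card T = r \<and> T \<subseteq> nn \<and> nn = ring.span (Z \<union> T)" using fg by blast
    then have "\<exists>T. finite T \<and> card T = LM.gens \<and> T \<subseteq> nn \<and> nn = ring.span (Z \<union> T)"
      unfolding LM.gens_def by (rule LeastI_ex)
    then show thesis using that by blast
  qed
  have img: "\<pi> ` nn = \<mm>" unfolding nn_def using pi_surj m.Icarr by blast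
  have T_gen: "gen_submodule R ?M (\<pi> ` T) = carrier ?M"
  proof
    have S: "\<pi> ` T \<subseteq> carrier ?M" using T(3) by (auto simp: nn_def)
    show "gen_submodule R ?M (\<pi> ` T) \<subseteq> carrier ?M"
      using N.M.submoduleE(1)[OF N.gen_submodule_sub[OF S]] .
    have "T \<subseteq> N.pre (\<pi> ` T)" using T(3) by (auto simp: N.pre_def)
    then have "ring.span (Z \<union> T) \<subseteq> ring.span (N.ker \<union> N.pre (\<pi> ` T))"
      unfolding ker by (intro ring.span_mono) blast
    then have "nn \<subseteq> ring.span (N.ker \<union> N.pre (\<pi> ` T))" unfolding T(4)[symmetric] .
    then have "\<pi> ` nn \<subseteq> gen_submodule R ?M (\<pi> ` T)"
      unfolding N.gen_submodule_eq[OF S] by (rule image_mono)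
    then show "carrier ?M \<subseteq> gen_submodule R ?M (\<pi> ` T)" unfolding img by simp
  qed
  have "min_gens R ?M \<le> LM.gens"
  proof -
    have "min_gens R ?M \<le> card (\<pi> ` T)"
      unfolding min_gens_def
      by (rule Least_le, rule exI[of _ "\<pi> ` T"]) (use T T_gen in \<open>auto simp: nn_def\<close>)
    also have "\<dots> \<le> LM.gens" using card_image_le[OF T(1), of \<pi>] T(2) by simp
    finally show ?thesis .
  qed
  moreover have "LM.gens \<le> min_gens R ?M"
  proof -
    have "\<exists>r S. S \<subseteq> carrier ?M \<and> finite S \<and> card S = r \<and> gen_submodule R ?M S = carrier ?M"
      by (intro exI[of _ "card (\<pi> ` T)"] exI[of _ "\<pi> ` T"]) (use T T_gen in \<open>auto simp: nn_def\<close>)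
    then have "\<exists>S. S \<subseteq> carrier ?M \<and> finite S \<and> card S = min_gens R ?M \<and> gen_submodule R ?M S = carrier ?M"
      unfolding min_gens_def by (rule LeastI_ex)
    then obtain S where S: "S \<subseteq> \<mm>" "finite S" "card S = min_gens R ?M" "gen_submodule R ?M S = \<mm>" by auto
    have "\<forall>b\<in>S. \<exists>p. \<pi> p = b" using S(1) m.Icarr pi_surjE by blast
    then obtain s where s: "\<And>b. b \<in> S \<Longrightarrow> \<pi> (s b) = b" by metis
    let ?T = "s ` S"
    have T_nn: "?T \<subseteq> nn" using s S(1) by (auto simp: nn_def)
    have span_nn: "ring.span (Z \<union> ?T) \<subseteq> nn" using T_nn Z_nn by (intro ring.span_minimal nn_sub) auto
    have "submodule (\<pi> ` ring.span (Z \<union> ?T)) R ?M"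
      by (rule N.img_sub[OF ring.subspace_span span_nn])
    moreover have "S \<subseteq> \<pi> ` ring.span (Z \<union> ?T)"
    proof
      fix b assume b: "b \<in> S"
      then have "s b \<in> ring.span (Z \<union> ?T)" by (intro ring.span_base) blast
      then show "b \<in> \<pi> ` ring.span (Z \<union> ?T)" using s[OF b] by (metis imageI)
    qed
    ultimately have "gen_submodule R ?M S \<subseteq> \<pi> ` ring.span (Z \<union> ?T)"
      unfolding gen_submodule_def by blast
    then have "nn \<subseteq> \<pi> -` \<pi> ` ring.span (Z \<union> ?T)" unfolding S(4) nn_def by blast
    also have "\<dots> = ring.span (Z \<union> ?T)"
      by (rule vimage_image[OF ring.subspace_span]) (use ring.span_superset in blast)
    finally have "LM.gens \<le> card ?T" using span_nn S(2) by (intro LM.gens_le) auto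
    also have "\<dots> \<le> min_gens R ?M" using card_image_le[OF S(2), of s] S(3) by simp
    finally show ?thesis .
  qed
  ultimately show ?thesis using h1 by simp
qed

lemma annihilator_ring: "annihilator R (ring_module R) = {\<zero>}"
proof
  show "annihilator R (ring_module R) \<subseteq> {\<zero>}"
  proof
    fix a assume a: "a \<in> annihilator R (ring_module R)"
    then have "a \<in> carrier R" "a \<otimes> \<one> = \<zero>"
      using one_closed by (auto simp: annihilator_def ring_module_def simp del: r_one one_closed)
    then show "a \<in> {\<zero>}" by simp
  qed
qed (auto simp: annihilator_def ring_module_def)

text \<open>A polynomial is determined by its series, so \<open>h_poly\<close> is \<open>q\<close>
  and the multiplicity is the slope \<open>poly q 1\<close>. Minimal multiplicity makes it
  \<open>1 + (h 1 - 2)\<close>, where 2 is the dimension.\<close>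

lemma minimal_multiplicity_growth:
  assumes ld: "local_data Z as x y k" and as: "ring.Fil Z as 1 = nn"
    and dim: "krull_dim R = 2" and mult: "minimal_multiplicity R \<mm>"
  shows "\<exists>s0. \<forall>s\<ge>s0. int (local_data.h Z as (Suc s)) - int (local_data.h Z as s) = int (local_data.h Z as 1) - 1"
proof -
  interpret L: local_data Z as x y k by (rule ld)
  let ?F = "Abs_fps (\<lambda>s. int (L.h s))"
  obtain q where q: "?F * (1 - fps_X) ^ 2 = fps_of_poly q" using L.hilbert_series by blast
  have "the_enat (module_dim R (ring_module R)) = 2"
    unfolding module_dim_def annihilator_ring krull_dim_quot_zero[OF is_cring] dim
    by (simp add: numeral_eq_enat)
  then have "h_poly R \<mm> (ring_module R) = q"
    unfolding h_poly_def hilbert_fun_ring[OF ld as] using q by auto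
  then have "poly q 1 = 1 + codim R \<mm>"
    using mult by (simp add: minimal_multiplicity_def multiplicity_def)
  also have "\<dots> = int (L.h 1) - 1"
    unfolding codim_def min_gens_ideal[OF ld as] dim by (simp add: numeral_eq_enat)
  finally have "poly q 1 = int (L.h 1) - 1" .
  then show ?thesis using fps_double_pole[OF q] by simp
qed

text \<open>In the application \<open>Y\<close> is the kernel of the presentation of
  \<open>B\<close> and \<open>Z\<close> that of \<open>A\<close>. The growth data come from
  \<open>Y\<close>, the module and its powers are formed over \<open>A\<close>; both maximal ideals
  have the same preimage, so the filtrations agree.\<close>

lemma hilbert_fun_mono:
  fixes M :: "('a, 'c, 't) module_scheme"
  assumes ld: "local_data Y as x y k" and YZ: "Y \<subseteq> Z" and as: "ring.Fil Y as 1 = nn"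
    and growth: "\<And>s. s \<ge> s0 \<Longrightarrow>
      int (local_data.h Y as (Suc s)) - int (local_data.h Y as s) = int (local_data.h Y as 1) - 1"
    and mod: "module R M" and fin: "finitely_generated R M" and depth: "enat 1 \<le> depth R \<mm> M"
  shows "hilbert_fun R \<mm> M n \<le> hilbert_fun R \<mm> M (Suc n)"
proof -
  interpret M: module R M by (rule mod)
  interpret L: local_data Y as x y k by (rule ld)
  obtain S where S: "S \<subseteq> carrier M" "finite S" "gen_submodule R M S = carrier M"
    using fin unfolding finitely_generated_def by blast
  obtain r and m :: "nat \<Rightarrow> 'c" where m: "S = m ` {i. i < r}"
    using finite_imp_nat_seg_image_inj_on[OF S(2)] by blast
  have m_carr: "m i \<in> carrier M" if "i < r" for i using that S(1) m by blast
  define \<phi> where "\<phi> v = (\<Oplus>\<^bsub>M\<^esub>i\<in>{i. i < r}. \<pi> (v i) \<odot>\<^bsub>M\<^esub> m i)" for v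
  have term_carr: "(\<lambda>i. \<pi> (v i) \<odot>\<^bsub>M\<^esub> m i) \<in> {i. i < r} \<rightarrow> carrier M" for v
    using m_carr pi_closed by auto
  have semi: "semilinear (fscale (*)) R M \<pi> \<phi> UNIV"
  proof (intro semilinear.intro semilinear_axioms.intro ring.pmod_fscale mod)
    show "\<phi> v \<in> carrier M" for v
      unfolding \<phi>_def by (rule M.M.finsum_closed[OF term_carr])
    show "\<phi> (v + w) = \<phi> v \<oplus>\<^bsub>M\<^esub> \<phi> w" for v w
    proof -
      have "\<phi> (v + w) = (\<Oplus>\<^bsub>M\<^esub>i\<in>{i. i < r}. \<pi> (v i) \<odot>\<^bsub>M\<^esub> m i \<oplus>\<^bsub>M\<^esub> \<pi> (w i) \<odot>\<^bsub>M\<^esub> m i)"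
        unfolding \<phi>_def
        by (rule M.M.finsum_cong') (use m_carr pi_closed in \<open>auto simp: pi_add M.smult_l_distr\<close>)
      then show ?thesis unfolding \<phi>_def by (simp add: M.M.finsum_addf[OF term_carr term_carr])
    qed
    show "\<phi> (fscale (*) c v) = \<pi> c \<odot>\<^bsub>M\<^esub> \<phi> v" for c v
      unfolding \<phi>_def
      by (subst M.finsum_smult_ldistr[OF _ pi_closed term_carr], simp, rule M.M.finsum_cong')
        (use m_carr pi_closed in \<open>auto simp: fscale_def pi_mult M.smult_assoc1\<close>)
  qed (use pi_closed pi_surjE in auto)
  interpret P: semilinear "fscale (*)" R M \<pi> \<phi> UNIV by (rule semi)
  have term_in: "m j \<in> range \<phi>" if j: "j < r" for j
  proof -
    have "\<phi> (\<lambda>i. if i = j then 1 else 0) = (\<Oplus>\<^bsub>M\<^esub>i\<in>{i. i < r}. if j = i then m i else \<zero>\<^bsub>M\<^esub>)"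
      unfolding \<phi>_def by (rule M.M.finsum_cong') (use m_carr pi_one pi_0 in auto)
    also have "\<dots> = m j" by (rule M.M.finsum_singleton) (use j m_carr in auto)
    finally show ?thesis by (metis rangeI)
  qed
  interpret P: presented "fscale (*)" R M \<pi> \<phi> UNIV
  proof (intro presented.intro semi presented_axioms.intro)
    have "gen_submodule R M S \<subseteq> range \<phi>"
      unfolding gen_submodule_def using P.img_sub[of UNIV] term_in by (intro Inter_lower) (auto simp: m)
    then show "\<exists>v\<in>UNIV. \<phi> v = a" if "a \<in> carrier M" for a using that S(3) by auto
  qed
  have Y0: "\<pi> z = \<zero>" if "z \<in> Y" for z using that YZ by (auto simp: Z_def)
  have mm: "\<pi> c \<in> \<mm> \<longleftrightarrow> c \<in> ring.Fil Y as 1" for c using as by (simp add: nn_def)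
  note ctx = max_ideal L.Z Y0 mm
  define N where "N n = P.pre (P.W \<mm> n)" for n
  have N_sub: "free.subspace (N n)" and ker_N: "P.ker \<subseteq> N n" for n
  proof -
    have "submodule (P.W \<mm> n) R M" by (rule P.W_sub[OF ctx])
    then show "free.subspace (N n)" "P.ker \<subseteq> N n" unfolding N_def by (rule P.pre_sub, rule P.ker_pre)
  qed
  have base: "prodn r Z \<subseteq> P.ker"
  proof
    fix v assume v: "v \<in> prodn r Z"
    have "\<phi> v = (\<Oplus>\<^bsub>M\<^esub>i\<in>{i. i < r}. \<zero>\<^bsub>M\<^esub>)"
      unfolding \<phi>_def by (rule M.M.finsum_cong') (use v m_carr in \<open>auto simp: prodn_def Z_def\<close>)
    then show "v \<in> P.ker" by (simp add: P.ker_def P.pre_def M.M.finsum_zero)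
  qed
  have LM: "local_module Y as x y k (fscale (*)) P.ker (N n)" for n
  proof (intro local_module.intro local_module_axioms.intro ld ring.pmod_fscale P.ker_sub N_sub ker_N)
    show "fscale (*) z v \<in> P.ker" if "z \<in> Y" for z v
      using Y0[OF that] P.phi_closed[of v] by (simp add: P.ker_def P.pre_def P.phi_scale)
    \<comment> \<open>Finite generation holds modulo \<open>prodn r Z\<close>, by Noetherianity of
      the ring, and \<open>base\<close> places this inside the kernel.\<close>
    obtain T where T: "finite T" "T \<subseteq> N n" "N n = free.span (prodn r Z \<union> T)"
      using free.acc_finitely_generated[OF ring.acc_prodn[OF acc_Z Z_sub] N_sub, of r n] base ker_N by blast
    have "N n \<subseteq> free.span (P.ker \<union> T)" unfolding T(3) using base by (intro free.span_mono) blast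
    moreover have "free.span (P.ker \<union> T) \<subseteq> N n" using ker_N T(2) by (intro free.span_minimal N_sub) auto
    ultimately show "\<exists>T. finite T \<and> T \<subseteq> N n \<and> N n = free.span (P.ker \<union> T)" using T(1,2) by blast
  qed
  have nmul: "local_module.nmul as (fscale (*)) P.ker (N n) = N (Suc n)" for n
    unfolding local_module.nmul_def[OF LM[of n]] N_def by (rule P.W_Suc[OF ctx, symmetric])
  \<comment> \<open>Positive depth of \<open>M\<close>: an element killed by all generators of the
    maximal ideal is killed by a regular element. The submodules \<open>N n\<close> inherit
    this.\<close>
  have colon: "v \<in> P.ker" if v: "\<And>a. a \<in> set as \<Longrightarrow> fscale (*) a v \<in> P.ker" for v
  proof -
    obtain xs where xs: "set xs \<subseteq> \<mm>" "regular_sequence R M xs" "1 \<le> length xs"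
      by (rule depth_geE[OF depth]) simp
    have len: "0 < length xs" using xs(3) by linarith
    then have mm0: "xs ! 0 \<in> \<mm>" using xs(1) by (auto simp: subset_iff)
    then obtain w where w: "\<pi> w = xs ! 0" using pi_surjE ideal.Icarr[OF max_ideal] by metis
    have "w \<in> {c. fscale (*) c v \<in> P.ker}"
    proof (rule ideal_mult_mem[OF L.Z])
      show "w \<in> ring.Fil Y as 1" using mm[of w] mm0 w by simp
      show "Y \<subseteq> {c. fscale (*) c v \<in> P.ker}" using local_module.ZK'[OF LM] by blast
      show "set as \<subseteq> {c. fscale (*) c v \<in> P.ker}" using v by blast
      fix c d assume d: "d \<in> {c. fscale (*) c v \<in> P.ker}"
      show "c * d \<in> {c. fscale (*) c v \<in> P.ker}"
        using d free.subspace_scale[OF P.ker_sub, of "fscale (*) d v" c] by simp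
      assume "c \<in> {c. fscale (*) c v \<in> P.ker}"
      then show "c + d \<in> {c. fscale (*) c v \<in> P.ker}"
        using d free.subspace_add[OF P.ker_sub] by (simp add: free.scale_left_distrib)
    qed
    then show ?thesis using P.first_regular[OF xs(2) len w, of v] by simp
  qed
  have "free.len (N (Suc n)) (N n) \<le> free.len (N (Suc (Suc n))) (N (Suc n))"
    using local_module.hilbert_step[OF LM[of n] colon growth] unfolding nmul by blast
  moreover have "free.len (N (Suc n)) (N n) = enat (local_module.gens (fscale (*)) P.ker (N n))" for n
    using local_module.len_nmul[OF LM[of n]] unfolding nmul .
  moreover have "hilbert_fun R \<mm> M n = the_enat (free.len (N (Suc n)) (N n))" for n
    unfolding N_def by (rule P.hilbert_fun_len[OF ctx])
  ultimately show ?thesis by simp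
qed

end

theorem theorem1p1:
  fixes B :: "('b, 'r) ring_scheme" and \<nn> :: "'b set" and I :: "'b set"
    and A :: "('a, 's) ring_scheme" and \<mm> :: "'a set"
    and M :: "('a, 'c, 't) module_scheme"
  assumes "noetherian_local_ring B \<nn>"
    and "krull_dim B = 2"
    and "cohen_macaulay_ring B \<nn>"
    and "minimal_multiplicity B \<nn>"
    and "noetherian_local_ring A \<mm>"
    and "krull_dim A = 1"
    and "cohen_macaulay_ring A \<mm>"
    and "ideal I B"
    and "(B Quot I) \<simeq> A"
    and "module A M"
    and "finitely_generated A M"
    and "maximal_cohen_macaulay A \<mm> M"
  shows "\<forall>n. hilbert_fun A \<mm> M n \<le> hilbert_fun A \<mm> M (n + 1)"
proof
  fix n
  interpret B: noetherian_local_ring B \<nn> by fact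
  interpret A: noetherian_local_ring A \<mm> by fact
  interpret I: ideal I B by fact
  obtain \<pi> :: "('b multiset \<Rightarrow>\<^sub>0 int) \<Rightarrow> 'b" where \<pi>: "\<And>p. \<pi> p \<in> carrier B"
    "\<And>p q. \<pi> (p + q) = \<pi> p \<oplus>\<^bsub>B\<^esub> \<pi> q" "\<And>p q. \<pi> (p * q) = \<pi> p \<otimes>\<^bsub>B\<^esub> \<pi> q"
    "\<pi> 1 = \<one>\<^bsub>B\<^esub>" "carrier B \<subseteq> range \<pi>"
    using B.ex_presentation by blast
  obtain g where g: "g \<in> ring_iso (B Quot I) A" using assms(9) by (auto simp: is_ring_iso_def)
  define f where "f b = g (I +>\<^bsub>B\<^esub> b)" for b
  have f: "f \<in> ring_hom B A" "carrier A \<subseteq> f ` carrier B"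
  proof -
    have "g \<in> ring_hom (B Quot I) A" "g ` carrier (B Quot I) = carrier A"
      using g by (auto simp: ring_iso_def bij_betw_def)
    moreover have "carrier (B Quot I) = (+>\<^bsub>B\<^esub>) I ` carrier B"
      by (auto simp: FactRing_def A_RCOSETS_def')
    ultimately show "f \<in> ring_hom B A" "carrier A \<subseteq> f ` carrier B"
      using ring_hom_trans[OF I.rcos_ring_hom, of g A] by (auto simp: f_def[abs_def] comp_def)
  qed
  interpret PB: presented_local B \<nn> \<pi>
    by unfold_locales (use \<pi> in auto)
  interpret PA: presented_local A \<mm> "\<lambda>p. f (\<pi> p)"
  proof unfold_locales
    show "carrier A \<subseteq> range (\<lambda>p. f (\<pi> p))" using f(2) \<pi>(5) by blast
  qed (use \<pi> in \<open>auto simp: ring_hom_closed[OF f(1)] ring_hom_add[OF f(1)] ring_hom_mult[OF f(1)] ring_hom_one[OF f(1)]\<close>)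
  have "f \<zero>\<^bsub>B\<^esub> = \<zero>\<^bsub>A\<^esub>" by (rule ring_hom_zero[OF f(1) B.ring_axioms A.ring_axioms])
  then have ZZ: "PB.Z \<subseteq> PA.Z" by (auto simp: PB.Z_def PA.Z_def)
  \<comment> \<open>An element outside \<open>PB.nn\<close> is a unit modulo \<open>PB.Z\<close>,
    hence modulo \<open>PA.Z\<close>. With the converse inclusion the powers of \<open>\<mm>\<close>
    and of \<open>\<nn>\<close> act alike on \<open>M\<close>.\<close>
  have sub: "PA.nn \<subseteq> PB.nn" using PA.nn_iff PB.nn_iff ZZ by blast
  have nn_eq: "PB.nn = PA.nn"
  proof
    show "PB.nn \<subseteq> PA.nn"
    proof
      fix p assume p: "p \<in> PB.nn"
      show "p \<in> PA.nn"
      proof (rule ccontr)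
        assume "p \<notin> PA.nn"
        then obtain v where "p * v - 1 \<in> PB.nn" using PA.nn_iff PA.Z_nn sub by blast
        then have "v * p - (p * v - 1) \<in> PB.nn"
          by (rule ring.subspace_diff[OF PB.nn_sub ring.subspace_scale[OF PB.nn_sub p]])
        then show False using PB.one_nn by (simp add: mult.commute)
      qed
    qed
  qed (rule sub)
  have dB: "enat 2 \<le> depth B \<nn> (ring_module B)"
    using assms(2,3) by (simp add: cohen_macaulay_ring_def numeral_eq_enat)
  have dM: "enat 1 \<le> depth A \<mm> M"
    using assms(6,12) by (simp add: maximal_cohen_macaulay_def one_enat_def)
  obtain as x y k where ld: "local_data PB.Z as x y k" "ring.Fil PB.Z as 1 = PB.nn"
    using PB.ex_local_data[OF assms(2) dB] by blast
  obtain s0 where "\<forall>s\<ge>s0. int (local_data.h PB.Z as (Suc s)) - int (local_data.h PB.Z as s) =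
      int (local_data.h PB.Z as 1) - 1"
    using PB.minimal_multiplicity_growth[OF ld assms(2,4)] by blast
  then show "hilbert_fun A \<mm> M n \<le> hilbert_fun A \<mm> M (n + 1)"
    using PA.hilbert_fun_mono[OF ld(1) ZZ ld(2)[unfolded nn_eq] _ assms(10,11) dM, of s0 n] by simp
qed

end
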